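(* Let $(\mathcal{C},\mathbb{E},\mathfrak{s})$ be a small $R$-linear extriangulated category with enough projective objects and enough injective objects. Assume: (NI$+$) $(\omega_\sharp)^{-1}(\mathcal{I}(X,Q))=0$ in $\mathbb{E}_{\mathrm{I}}^{-1}(X,Y)$ for all $X,Y\in\mathcal{C}$ and every dominant extension $\omega\in\mathbb{E}(Y,Q)$, where $\omega_\sharp\colon\mathbb{E}_{\mathrm{I}}^{-1}(X,Y)\to\mathcal{C}(X,Q)$; (NII$+$) $(\iota^\sharp)^{-1}(\mathcal{P}(J,Y))=0$ in $\mathbb{E}_{\mathrm{II}}^{-1}(X,Y)$ for all $X,Y\in\mathcal{C}$ and every codominant extension $\iota\in\mathbb{E}(J,X)$, where $\iota^\sharp\colon\mathbb{E}_{\mathrm{II}}^{-1}(X,Y)\to\mathcal{C}(J,Y)$. Then there exists a unique sequence of natural isomorphisms $\{\psi^{(n)}\colon\mathbb{E}_{\mathrm{I}}^n\xrightarrow{\cong}\mathbb{E}_{\mathrm{II}}^n\}_{n\in\mathbb{Z}}$ such that: (i) $\psi^{(n)}=\mathrm{id}$ for all $n\ge0$; (ii) for all $n\in\mathbb{Z}$, $\delta\in\mathbb{E}(W,X)$ and $\rho\in\mathbb{E}(Y,Z)$, the two composites $\mathbb{E}_{\mathrm{I}}^n(X,Y)\to\mathbb{E}_{\mathrm{II}}^{n+2}(W,Z)$ $$\mathbb{E}_{\mathrm{I}}^n(X,Y)\xrightarrow{\rho_\sharp}\mathbb{E}_{\mathrm{I}}^{n+1}(X,Z)\xrightarrow{\psi^{(n+1)}_{X,Z}}\mathbb{E}_{\mathrm{II}}^{n+1}(X,Z)\xrightarrow{\delta^\sharp}\mathbb{E}_{\mathrm{II}}^{n+2}(W,Z)$$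 and $$\mathbb{E}_{\mathrm{I}}^n(X,Y)\xrightarrow{\psi^{(n)}_{X,Y}}\mathbb{E}_{\mathrm{II}}^n(X,Y)\xrightarrow{\delta^\sharp}\mathbb{E}_{\mathrm{II}}^{n+1}(W,Y)\xrightarrow{(\psi^{(n+1)}_{W,Y})^{-1}}\mathbb{E}_{\mathrm{I}}^{n+1}(W,Y)\xrightarrow{\rho_\sharp}\mathbb{E}_{\mathrm{I}}^{n+2}(W,Z)\xrightarrow{\psi^{(n+2)}_{W,Z}}\mathbb{E}_{\mathrm{II}}^{n+2}(W,Z)$$ are equal.
   Context: $R$ is a commutative ring with $1$; $\mathcal{C}$ is an additive $R$-linear category. Extriangulated categories: let $\mathbb{E}\colon\mathcal{C}^{\mathrm{op}}\times\mathcal{C}\to\mathrm{Mod}\,R$ be an $R$-bilinear functor. An element $\delta\in\mathbb{E}(C,A)$ is called an extension; for $a\colon A\to A'$ and $c\colon C'\to C$ put $a_*\delta=\mathbb{E}(C,a)(\delta)$ and $c^*\delta=\mathbb{E}(c,A)(\delta)$. A morphism of extensions from $\delta\in\mathbb{E}(C,A)$ to $\delta'\in\mathbb{E}(C',A')$ is a pair $(a\colon A\to A',\,c\colon C\to C')$ with $a_*\delta=c^*\delta'$. The extension $\delta\oplus\delta'\in\mathbb{E}(C\oplus C',A\oplus A')$ is the one with diagonal components $\delta,\delta'$ and zero off-diagonal components. Sequences $A\xrightarrow{x}B\xrightarrow{y}C$ and $A\xrightarrow{x'}B'\xrightarrow{y'}C$ are equivalent if there is an isomorphism $b\colon B\to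 B'$ with $bx=x'$, $y'b=y$; the class is written $[A\xrightarrow{x}B\xrightarrow{y}C]$. An additive realization $\mathfrak{s}$ assigns to each $\delta\in\mathbb{E}(C,A)$ such a class $\mathfrak{s}(\delta)=[A\xrightarrow{x}B\xrightarrow{y}C]$ so that: for each morphism $(a,c)\colon\delta\to\delta'$ with $\mathfrak{s}(\delta')=[A'\xrightarrow{x'}B'\xrightarrow{y'}C']$ there is $b\colon B\to B'$ with $bx=x'a$, $y'b=cy$; $\mathfrak{s}(0)=[A\to A\oplus C\to C]$ (canonical maps); and $\mathfrak{s}(\delta\oplus\delta')=\mathfrak{s}(\delta)\oplus\mathfrak{s}(\delta')$. The triple $(\mathcal{C},\mathbb{E},\mathfrak{s})$ is an ($R$-linear) extriangulated category if moreover: (ET3) if $\mathfrak{s}(\delta)=[A\xrightarrow{x}B\xrightarrow{y}C]$, $\mathfrak{s}(\delta')=[A'\xrightarrow{x'}B'\xrightarrow{y'}C']$ and $bx=x'a$, then there is $c$ with $cy=y'b$ and $a_*\delta=c^*\delta'$; (ET3)$^{\mathrm{op}}$ the dual; (ET4) if $\delta\in\mathbb{E}(D,A)$ and $\delta'\in\mathbb{E}(F,B)$ are realized by $A\xrightarrow{f}B\xrightarrow{f'}D$ and $B\xrightarrow{g}C\xrightarrow{g'}F$, then there are an object $E$, morphisms $d\colon D\to E$, $e\colon E\to F$, $h=gf$, $h'\colon C\to E$ with $h'g=df'$, $eh'=g'$, and $\delta''\in\mathbb{E}(E,A)$ realized by $A\xrightarrow{h}C\xrightarrow{h'}E$, such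 that $D\xrightarrow{d}E\xrightarrow{e}F$ realizes $f'_*\delta'$, $d^*\delta''=\delta$ and $f_*\delta''=e^*\delta'$; (ET4)$^{\mathrm{op}}$ the dual. If $\mathfrak{s}(\delta)=[A\xrightarrow{x}B\xrightarrow{y}C]$ one writes $A\xrightarrow{x}B\xrightarrow{y}C\overset{\delta}{\dashrightarrow}$ and calls it an $\mathfrak{s}$-triangle; $x$ is an inflation, $y$ a deflation, $A\to B\to C$ a conflation. A morphism $f$ is projective if $\mathbb{E}(f,-)=0$ and injective if $\mathbb{E}(-,f)=0$; $\mathcal{P}$ and $\mathcal{I}$ denote the ideals of $\mathcal{C}$ of projective, resp. injective morphisms. An object $P$ is projective if $\mathbb{E}(P,-)=0$, and $I$ is injective if $\mathbb{E}(-,I)=0$. There are enough projective (resp. injective) objects if every object $C$ admits a deflation $P\to C$ with $P$ projective (resp. every object $A$ admits an inflation $A\to I$ with $I$ injective). An extension $\vartheta\in\mathbb{E}(C,F)$ is dominant if it is realized by an $\mathfrak{s}$-triangle $F\to G\xrightarrow{g}C\overset{\vartheta}{\dashrightarrow}$ with $g$ a projective morphism, equivalently if $\mathcal{C}(F,-)\to\mathbb{E}(C,-)$, $f\mapsto f_*\vartheta$, is an epimorphism; $\iota\in\mathbb{E}(C,A)$ is codominant if $\mathcal{C}(-,C)\to\mathbb{E}(-,A)$, $f\mapsto f^*\iota$, is an epimorphism. $\mathrm{Mod}\,\mathcal{C}$ (resp. $\mathcal{C}\,\mathrm{Mod}$) is the category of $R$-linear functors $\mathcal{C}^{\mathrm{op}}\to\mathrm{Mod}\,R$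 (resp. $\mathcal{C}\to\mathrm{Mod}\,R$). For $\mathcal{C}$ small, positive extensions are defined by $\mathbb{E}^0=\mathcal{C}(-,-)$, $\mathbb{E}^1=\mathbb{E}$ and inductively by the coend $\mathbb{E}^n(X,Y)=\int^{M\in\mathcal{C}}\mathbb{E}^{n-1}(M,Y)\otimes_R\mathbb{E}(X,M)$; there are natural isomorphisms $\mathbb{E}^{s+t}(X,Y)\cong\int^{M}\mathbb{E}^s(M,Y)\otimes_R\mathbb{E}^t(X,M)$. Write $\rho\cup\lambda\in\mathbb{E}^{s+t}(X,Y)$ for the class of $\rho\otimes\lambda$, $\rho\in\mathbb{E}^s(M,Y)$, $\lambda\in\mathbb{E}^t(X,M)$. For $\delta\in\mathbb{E}(C,A)$ and $n\ge0$, $\delta_\sharp\colon\mathbb{E}^n(-,C)\to\mathbb{E}^{n+1}(-,A)$ is $\lambda\mapsto\delta\cup\lambda$ and $\delta^\sharp\colon\mathbb{E}^n(A,-)\to\mathbb{E}^{n+1}(C,-)$ is $\lambda\mapsto\lambda\cup\delta$; for $n=0$ these are $f\mapsto f^*\delta$ and $f\mapsto f_*\delta$. Negative extensions: for $n\ge0$ put $\mathbb{E}_{\mathrm{I}}^{-n}(C,A)=(\mathcal{C}\,\mathrm{Mod})(\mathbb{E}^n(A,-),\mathcal{C}(C,-))$ and $\mathbb{E}_{\mathrm{II}}^{-n}(C,A)=(\mathrm{Mod}\,\mathcal{C})(\mathbb{E}^n(-,C),\mathcal{C}(-,A))$, $R$-bilinear functors of $(C,A)$ (both equal to $\mathcal{C}(-,-)$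 for $n=0$ by Yoneda), and $\mathbb{E}_{\mathrm{I}}^{n}=\mathbb{E}_{\mathrm{II}}^n=\mathbb{E}^n$ for $n>0$. For $\delta\in\mathbb{E}(C,A)$ and $n\ge0$, $\delta_\sharp\colon\mathbb{E}_{\mathrm{I}}^{-(n+1)}(-,C)\to\mathbb{E}_{\mathrm{I}}^{-n}(-,A)$ is precomposition with $\delta^\sharp\colon\mathbb{E}^n(A,-)\to\mathbb{E}^{n+1}(C,-)$, and $\delta^\sharp\colon\mathbb{E}_{\mathrm{II}}^{-(n+1)}(A,-)\to\mathbb{E}_{\mathrm{II}}^{-n}(C,-)$ is precomposition with $\delta_\sharp\colon\mathbb{E}^n(-,C)\to\mathbb{E}^{n+1}(-,A)$. In non-negative degrees $\delta_\sharp$ on $\mathbb{E}_{\mathrm{I}}$ and $\delta^\sharp$ on $\mathbb{E}_{\mathrm{II}}$ are those of $\mathbb{E}^n$. *)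

theory Defs
  imports "HOL-Algebra.Module" "HOL-Library.FuncSet"
begin

section \<open>Linear categories and bilinear functors\<close>

text \<open>
  Hom-modules may overlap as sets, so every operation on morphisms carries the objects involved:
  \<open>Cmp C X Y Z g f\<close> is the composite of \<open>f : X \<rightarrow> Y\<close> and \<open>g : Y \<rightarrow> Z\<close>.
  Modules are records of HOL-Algebra, whose fields \<open>mult\<close> and \<open>one\<close> play no role.
\<close>

record ('r, 'o, 'm) lincat =
  Ob :: "'o set"
  Hom :: "'o \<Rightarrow> 'o \<Rightarrow> ('r, 'm) module"
  Idm :: "'o \<Rightarrow> 'm"
  Cmp :: "'o \<Rightarrow> 'o \<Rightarrow> 'o \<Rightarrow> 'm \<Rightarrow> 'm \<Rightarrow> 'm"

abbreviation mor :: "('r, 'o, 'm) lincat \<Rightarrow> 'o \<Rightarrow> 'o \<Rightarrow> 'm set" where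
  "mor C X Y \<equiv> carrier (Hom C X Y)"

definition lin_maps :: "'r ring \<Rightarrow> ('r, 'a) module \<Rightarrow> ('r, 'b) module \<Rightarrow> ('a \<Rightarrow> 'b) set" where
  "lin_maps R M N = {h \<in> carrier M \<rightarrow> carrier N.
     (\<forall>u\<in>carrier M. \<forall>v\<in>carrier M. h (u \<oplus>\<^bsub>M\<^esub> v) = h u \<oplus>\<^bsub>N\<^esub> h v) \<and>
     (\<forall>r\<in>carrier R. \<forall>u\<in>carrier M. h (r \<odot>\<^bsub>M\<^esub> u) = r \<odot>\<^bsub>N\<^esub> h u)}"

locale linear_category = R?: cring R
  for R :: "'r ring" +
  fixes C :: "('r, 'o, 'm) lincat"
  assumes hom_module: "\<lbrakk>X \<in> Ob C; Y \<in> Ob C\<rbrakk> \<Longrightarrow> module R (Hom C X Y)"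
    and id_mor: "X \<in> Ob C \<Longrightarrow> Idm C X \<in> mor C X X"
    and comp_linear_right: "\<lbrakk>X \<in> Ob C; Y \<in> Ob C; Z \<in> Ob C; g \<in> mor C Y Z\<rbrakk>
      \<Longrightarrow> (\<lambda>f. Cmp C X Y Z g f) \<in> lin_maps R (Hom C X Y) (Hom C X Z)"
    and comp_linear_left: "\<lbrakk>X \<in> Ob C; Y \<in> Ob C; Z \<in> Ob C; f \<in> mor C X Y\<rbrakk>
      \<Longrightarrow> (\<lambda>g. Cmp C X Y Z g f) \<in> lin_maps R (Hom C Y Z) (Hom C X Z)"
    and comp_assoc: "\<lbrakk>W \<in> Ob C; X \<in> Ob C; Y \<in> Ob C; Z \<in> Ob C;
        f \<in> mor C W X; g \<in> mor C X Y; h \<in> mor C Y Z\<rbrakk>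
      \<Longrightarrow> Cmp C W Y Z h (Cmp C W X Y g f) = Cmp C W X Z (Cmp C X Y Z h g) f"
    and id_left: "\<lbrakk>X \<in> Ob C; Y \<in> Ob C; f \<in> mor C X Y\<rbrakk> \<Longrightarrow> Cmp C X Y Y (Idm C Y) f = f"
    and id_right: "\<lbrakk>X \<in> Ob C; Y \<in> Ob C; f \<in> mor C X Y\<rbrakk> \<Longrightarrow> Cmp C X X Y f (Idm C X) = f"

definition is_iso :: "('r, 'o, 'm) lincat \<Rightarrow> 'o \<Rightarrow> 'o \<Rightarrow> 'm \<Rightarrow> bool" where
  "is_iso C X Y f \<longleftrightarrow> f \<in> mor C X Y \<and>
     (\<exists>g\<in>mor C Y X. Cmp C X Y X g f = Idm C X \<and> Cmp C Y X Y f g = Idm C Y)"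

definition biproduct ::
    "('r, 'o, 'm) lincat \<Rightarrow> 'o \<Rightarrow> 'o \<Rightarrow> 'o \<Rightarrow> 'm \<Rightarrow> 'm \<Rightarrow> 'm \<Rightarrow> 'm \<Rightarrow> bool" where
  "biproduct C A1 A2 S i1 i2 p1 p2 \<longleftrightarrow> S \<in> Ob C \<and>
     i1 \<in> mor C A1 S \<and> i2 \<in> mor C A2 S \<and> p1 \<in> mor C S A1 \<and> p2 \<in> mor C S A2 \<and>
     Cmp C A1 S A1 p1 i1 = Idm C A1 \<and> Cmp C A2 S A2 p2 i2 = Idm C A2 \<and>
     Cmp C A2 S A1 p1 i2 = \<zero>\<^bsub>Hom C A2 A1\<^esub> \<and> Cmp C A1 S A2 p2 i1 = \<zero>\<^bsub>Hom C A1 A2\<^esub> \<and>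
     Cmp C S A1 S i1 p1 \<oplus>\<^bsub>Hom C S S\<^esub> Cmp C S A2 S i2 p2 = Idm C S"

locale additive_category = linear_category R C
  for R :: "'r ring" and C :: "('r, 'o, 'm) lincat" +
  assumes zero_object: "\<exists>Z\<in>Ob C. \<forall>X\<in>Ob C.
      mor C Z X = {\<zero>\<^bsub>Hom C Z X\<^esub>} \<and> mor C X Z = {\<zero>\<^bsub>Hom C X Z\<^esub>}"
    and biproducts: "\<lbrakk>A1 \<in> Ob C; A2 \<in> Ob C\<rbrakk>
      \<Longrightarrow> \<exists>S i1 i2 p1 p2. biproduct C A1 A2 S i1 i2 p1 p2"

text \<open>
  A functor \<open>F\<close> of two variables, contravariant in the first one, with values in modules:
  \<open>Push F X Y Y' a\<close> is \<open>a\<^sub>* : F(X, Y) \<rightarrow> F(X, Y')\<close> for \<open>a : Y \<rightarrow> Y'\<close>, and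
  \<open>Pull F X' X Y c\<close> is \<open>c\<^sup>* : F(X, Y) \<rightarrow> F(X', Y)\<close> for \<open>c : X' \<rightarrow> X\<close>.
\<close>

record ('r, 'o, 'm, 'x) bifunctor =
  Val :: "'o \<Rightarrow> 'o \<Rightarrow> ('r, 'x) module"
  Push :: "'o \<Rightarrow> 'o \<Rightarrow> 'o \<Rightarrow> 'm \<Rightarrow> 'x \<Rightarrow> 'x"
  Pull :: "'o \<Rightarrow> 'o \<Rightarrow> 'o \<Rightarrow> 'm \<Rightarrow> 'x \<Rightarrow> 'x"

abbreviation el :: "('r, 'o, 'm, 'x) bifunctor \<Rightarrow> 'o \<Rightarrow> 'o \<Rightarrow> 'x set" where
  "el F X Y \<equiv> carrier (Val F X Y)"

locale bilinear_functor = linear_category R C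
  for R :: "'r ring" and C :: "('r, 'o, 'm) lincat" +
  fixes F :: "('r, 'o, 'm, 'x) bifunctor"
  assumes val_module: "\<lbrakk>X \<in> Ob C; Y \<in> Ob C\<rbrakk> \<Longrightarrow> module R (Val F X Y)"
    and push_linear: "\<lbrakk>X \<in> Ob C; Y \<in> Ob C; Y' \<in> Ob C; a \<in> mor C Y Y'\<rbrakk>
      \<Longrightarrow> Push F X Y Y' a \<in> lin_maps R (Val F X Y) (Val F X Y')"
    and pull_linear: "\<lbrakk>X' \<in> Ob C; X \<in> Ob C; Y \<in> Ob C; c \<in> mor C X' X\<rbrakk>
      \<Longrightarrow> Pull F X' X Y c \<in> lin_maps R (Val F X Y) (Val F X' Y)"
    and push_linear_mor: "\<lbrakk>X \<in> Ob C; Y \<in> Ob C; Y' \<in> Ob C; u \<in> el F X Y\<rbrakk>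
      \<Longrightarrow> (\<lambda>a. Push F X Y Y' a u) \<in> lin_maps R (Hom C Y Y') (Val F X Y')"
    and pull_linear_mor: "\<lbrakk>X' \<in> Ob C; X \<in> Ob C; Y \<in> Ob C; u \<in> el F X Y\<rbrakk>
      \<Longrightarrow> (\<lambda>c. Pull F X' X Y c u) \<in> lin_maps R (Hom C X' X) (Val F X' Y)"
    and push_id: "\<lbrakk>X \<in> Ob C; Y \<in> Ob C; u \<in> el F X Y\<rbrakk> \<Longrightarrow> Push F X Y Y (Idm C Y) u = u"
    and pull_id: "\<lbrakk>X \<in> Ob C; Y \<in> Ob C; u \<in> el F X Y\<rbrakk> \<Longrightarrow> Pull F X X Y (Idm C X) u = u"
    and push_comp: "\<lbrakk>X \<in> Ob C; Y \<in> Ob C; Y' \<in> Ob C; Y'' \<in> Ob C;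
        a \<in> mor C Y Y'; a' \<in> mor C Y' Y''; u \<in> el F X Y\<rbrakk>
      \<Longrightarrow> Push F X Y Y'' (Cmp C Y Y' Y'' a' a) u = Push F X Y' Y'' a' (Push F X Y Y' a u)"
    and pull_comp: "\<lbrakk>X'' \<in> Ob C; X' \<in> Ob C; X \<in> Ob C; Y \<in> Ob C;
        c' \<in> mor C X'' X'; c \<in> mor C X' X; u \<in> el F X Y\<rbrakk>
      \<Longrightarrow> Pull F X'' X Y (Cmp C X'' X' X c c') u = Pull F X'' X' Y c' (Pull F X' X Y c u)"
    and push_pull: "\<lbrakk>X' \<in> Ob C; X \<in> Ob C; Y \<in> Ob C; Y' \<in> Ob C;
        c \<in> mor C X' X; a \<in> mor C Y Y'; u \<in> el F X Y\<rbrakk>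
      \<Longrightarrow> Push F X' Y Y' a (Pull F X' X Y c u) = Pull F X' X Y' c (Push F X Y Y' a u)"

definition hom_bifunctor :: "('r, 'o, 'm) lincat \<Rightarrow> ('r, 'o, 'm, 'm) bifunctor" where
  "hom_bifunctor C = \<lparr>Val = Hom C,
     Push = (\<lambda>X Y Y' a f. Cmp C X Y Y' a f),
     Pull = (\<lambda>X' X Y c f. Cmp C X' X Y f c)\<rparr>"

section \<open>Extriangulated categories\<close>

text \<open>
  A sequence \<open>A \<rightarrow> B \<rightarrow> D\<close> with ends \<open>A\<close> and \<open>D\<close> is the triple \<open>(B, x, y)\<close> of its middle
  term and its two morphisms.
\<close>

definition seqs :: "('r, 'o, 'm) lincat \<Rightarrow> 'o \<Rightarrow> 'o \<Rightarrow> ('o \<times> 'm \<times> 'm) set" where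
  "seqs C A D = {(B, x, y). B \<in> Ob C \<and> x \<in> mor C A B \<and> y \<in> mor C B D}"

definition seq_class ::
    "('r, 'o, 'm) lincat \<Rightarrow> 'o \<Rightarrow> 'o \<Rightarrow> 'o \<times> 'm \<times> 'm \<Rightarrow> ('o \<times> 'm \<times> 'm) set" where
  "seq_class C A D = (\<lambda>(B, x, y). {(B', x', y') \<in> seqs C A D.
     \<exists>b. is_iso C B B' b \<and> Cmp C A B B' b x = x' \<and> Cmp C B B' D y' b = y})"

text \<open>\<open>dsum_ext\<close>: the extension \<open>\<epsilon>\<close> in \<open>E(D1 \<oplus> D2, A1 \<oplus> A2)\<close> is the direct sum of \<open>\<delta>1\<close> and \<open>\<delta>2\<close>.\<close>

definition dsum_ext ::
    "('r, 'o, 'm, 'e) bifunctor \<Rightarrow> 'o \<Rightarrow> 'o \<Rightarrow> 'o \<Rightarrow> 'm \<Rightarrow> 'm \<Rightarrow> 'o \<Rightarrow> 'o \<Rightarrow> 'o \<Rightarrow> 'm \<Rightarrow> 'm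
      \<Rightarrow> 'e \<Rightarrow> 'e \<Rightarrow> 'e \<Rightarrow> bool" where
  "dsum_ext E D1 D2 D i1 i2 A1 A2 A p1 p2 \<delta>1 \<delta>2 \<epsilon> \<longleftrightarrow> \<epsilon> \<in> el E D A \<and>
     Push E D1 A A1 p1 (Pull E D1 D A i1 \<epsilon>) = \<delta>1 \<and>
     Push E D2 A A2 p2 (Pull E D2 D A i2 \<epsilon>) = \<delta>2 \<and>
     Push E D2 A A1 p1 (Pull E D2 D A i2 \<epsilon>) = \<zero>\<^bsub>Val E D2 A1\<^esub> \<and>
     Push E D1 A A2 p2 (Pull E D1 D A i1 \<epsilon>) = \<zero>\<^bsub>Val E D1 A2\<^esub>"

text \<open>\<open>s D A \<delta>\<close> is the class realizing \<open>\<delta>\<close> in \<open>E(D, A)\<close>.\<close>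

type_synonym ('o, 'm, 'e) realization = "'o \<Rightarrow> 'o \<Rightarrow> 'e \<Rightarrow> ('o \<times> 'm \<times> 'm) set"

locale additive_realization = additive_category R C + bilinear_functor R C E
  for R :: "'r ring" and C :: "('r, 'o, 'm) lincat" and E :: "('r, 'o, 'm, 'e) bifunctor" +
  fixes s :: "('o, 'm, 'e) realization"
  assumes realization_class: "\<lbrakk>D \<in> Ob C; A \<in> Ob C; \<delta> \<in> el E D A\<rbrakk>
      \<Longrightarrow> \<exists>q\<in>seqs C A D. s D A \<delta> = seq_class C A D q"
    and realization_mor: "\<lbrakk>D \<in> Ob C; A \<in> Ob C; D' \<in> Ob C; A' \<in> Ob C;
        \<delta> \<in> el E D A; \<delta>' \<in> el E D' A'; a \<in> mor C A A'; c \<in> mor C D D';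
        Push E D A A' a \<delta> = Pull E D D' A' c \<delta>';
        (B, x, y) \<in> s D A \<delta>; (B', x', y') \<in> s D' A' \<delta>'\<rbrakk>
      \<Longrightarrow> \<exists>b\<in>mor C B B'. Cmp C A B B' b x = Cmp C A A' B' x' a \<and>
            Cmp C B B' D' y' b = Cmp C B D D' c y"
    and realization_zero: "\<lbrakk>D \<in> Ob C; A \<in> Ob C; biproduct C A D S i1 i2 p1 p2\<rbrakk>
      \<Longrightarrow> (S, i1, p2) \<in> s D A \<zero>\<^bsub>Val E D A\<^esub>"
    and realization_dsum: "\<lbrakk>D1 \<in> Ob C; A1 \<in> Ob C; D2 \<in> Ob C; A2 \<in> Ob C;
        \<delta>1 \<in> el E D1 A1; \<delta>2 \<in> el E D2 A2; (B1, x1, y1) \<in> s D1 A1 \<delta>1; (B2, x2, y2) \<in> s D2 A2 \<delta>2;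
        biproduct C A1 A2 A i1 i2 p1 p2; biproduct C B1 B2 B j1 j2 q1 q2;
        biproduct C D1 D2 D k1 k2 r1 r2;
        dsum_ext E D1 D2 D k1 k2 A1 A2 A p1 p2 \<delta>1 \<delta>2 \<epsilon>\<rbrakk>
      \<Longrightarrow> (B, Cmp C A B1 B j1 (Cmp C A A1 B1 x1 p1) \<oplus>\<^bsub>Hom C A B\<^esub>
                 Cmp C A B2 B j2 (Cmp C A A2 B2 x2 p2),
              Cmp C B D1 D k1 (Cmp C B B1 D1 y1 q1) \<oplus>\<^bsub>Hom C B D\<^esub>
                 Cmp C B D2 D k2 (Cmp C B B2 D2 y2 q2)) \<in> s D A \<epsilon>"

locale extriangulated_category = additive_realization R C E s
  for R :: "'r ring" and C :: "('r, 'o, 'm) lincat" and E :: "('r, 'o, 'm, 'e) bifunctor"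
    and s :: "('o, 'm, 'e) realization" +
  assumes ET3: "\<lbrakk>D \<in> Ob C; A \<in> Ob C; D' \<in> Ob C; A' \<in> Ob C;
        \<delta> \<in> el E D A; \<delta>' \<in> el E D' A'; (B, x, y) \<in> s D A \<delta>; (B', x', y') \<in> s D' A' \<delta>';
        a \<in> mor C A A'; b \<in> mor C B B'; Cmp C A B B' b x = Cmp C A A' B' x' a\<rbrakk>
      \<Longrightarrow> \<exists>c\<in>mor C D D'. Cmp C B D D' c y = Cmp C B B' D' y' b \<and>
            Push E D A A' a \<delta> = Pull E D D' A' c \<delta>'"
    and ET3_op: "\<lbrakk>D \<in> Ob C; A \<in> Ob C; D' \<in> Ob C; A' \<in> Ob C;
        \<delta> \<in> el E D A; \<delta>' \<in> el E D' A'; (B, x, y) \<in> s D A \<delta>; (B', x', y') \<in> s D' A' \<delta>';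
        b \<in> mor C B B'; c \<in> mor C D D'; Cmp C B D D' c y = Cmp C B B' D' y' b\<rbrakk>
      \<Longrightarrow> \<exists>a\<in>mor C A A'. Cmp C A B B' b x = Cmp C A A' B' x' a \<and>
            Push E D A A' a \<delta> = Pull E D D' A' c \<delta>'"
    and ET4: "\<lbrakk>A \<in> Ob C; B \<in> Ob C; K \<in> Ob C; D \<in> Ob C; F \<in> Ob C;
        \<delta> \<in> el E D A; \<delta>' \<in> el E F B; (B, f, f') \<in> s D A \<delta>; (K, g, g') \<in> s F B \<delta>'\<rbrakk>
      \<Longrightarrow> \<exists>M\<in>Ob C. \<exists>d\<in>mor C D M. \<exists>e\<in>mor C M F. \<exists>h'\<in>mor C K M. \<exists>\<delta>''\<in>el E M A.
            Cmp C B K M h' g = Cmp C B D M d f' \<and>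
            Cmp C K M F e h' = g' \<and>
            (K, Cmp C A B K g f, h') \<in> s M A \<delta>'' \<and>
            (M, d, e) \<in> s F D (Push E F B D f' \<delta>') \<and>
            Pull E D M A d \<delta>'' = \<delta> \<and>
            Push E M A B f \<delta>'' = Pull E M F B e \<delta>'"
    and ET4_op: "\<lbrakk>A \<in> Ob C; B \<in> Ob C; K \<in> Ob C; D \<in> Ob C; F \<in> Ob C;
        \<delta> \<in> el E A D; \<delta>' \<in> el E B F; (B, f', f) \<in> s A D \<delta>; (K, g', g) \<in> s B F \<delta>'\<rbrakk>
      \<Longrightarrow> \<exists>M\<in>Ob C. \<exists>d\<in>mor C M D. \<exists>e\<in>mor C F M. \<exists>h'\<in>mor C M K. \<exists>\<delta>''\<in>el E A M.
            Cmp C M K B g h' = Cmp C M D B f' d \<and>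
            Cmp C F M K h' e = g' \<and>
            (K, h', Cmp C K B A f g) \<in> s A M \<delta>'' \<and>
            (M, e, d) \<in> s D F (Pull E D B F f' \<delta>') \<and>
            Push E A M D d \<delta>'' = \<delta> \<and>
            Pull E B A M f \<delta>'' = Push E B F M e \<delta>'"

definition proj_mors ::
    "('r, 'o, 'm) lincat \<Rightarrow> ('r, 'o, 'm, 'e) bifunctor \<Rightarrow> 'o \<Rightarrow> 'o \<Rightarrow> 'm set" where
  "proj_mors C E X Y = {f \<in> mor C X Y.
     \<forall>A\<in>Ob C. \<forall>\<delta>\<in>el E Y A. Pull E X Y A f \<delta> = \<zero>\<^bsub>Val E X A\<^esub>}"

definition inj_mors ::
    "('r, 'o, 'm) lincat \<Rightarrow> ('r, 'o, 'm, 'e) bifunctor \<Rightarrow> 'o \<Rightarrow> 'o \<Rightarrow> 'm set" where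
  "inj_mors C E X Y = {f \<in> mor C X Y.
     \<forall>D\<in>Ob C. \<forall>\<delta>\<in>el E D X. Push E D X Y f \<delta> = \<zero>\<^bsub>Val E D Y\<^esub>}"

definition proj_object :: "('r, 'o, 'm) lincat \<Rightarrow> ('r, 'o, 'm, 'e) bifunctor \<Rightarrow> 'o \<Rightarrow> bool" where
  "proj_object C E P \<longleftrightarrow> P \<in> Ob C \<and> (\<forall>A\<in>Ob C. el E P A = {\<zero>\<^bsub>Val E P A\<^esub>})"

definition inj_object :: "('r, 'o, 'm) lincat \<Rightarrow> ('r, 'o, 'm, 'e) bifunctor \<Rightarrow> 'o \<Rightarrow> bool" where
  "inj_object C E I \<longleftrightarrow> I \<in> Ob C \<and> (\<forall>D\<in>Ob C. el E D I = {\<zero>\<^bsub>Val E D I\<^esub>})"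

definition is_deflation :: "('r, 'o, 'm) lincat \<Rightarrow> ('r, 'o, 'm, 'e) bifunctor \<Rightarrow>
    ('o, 'm, 'e) realization \<Rightarrow> 'o \<Rightarrow> 'o \<Rightarrow> 'm \<Rightarrow> bool" where
  "is_deflation C E s B D y \<longleftrightarrow> (\<exists>A\<in>Ob C. \<exists>\<delta>\<in>el E D A. \<exists>x. (B, x, y) \<in> s D A \<delta>)"

definition is_inflation :: "('r, 'o, 'm) lincat \<Rightarrow> ('r, 'o, 'm, 'e) bifunctor \<Rightarrow>
    ('o, 'm, 'e) realization \<Rightarrow> 'o \<Rightarrow> 'o \<Rightarrow> 'm \<Rightarrow> bool" where
  "is_inflation C E s A B x \<longleftrightarrow> (\<exists>D\<in>Ob C. \<exists>\<delta>\<in>el E D A. \<exists>y. (B, x, y) \<in> s D A \<delta>)"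

definition enough_projectives :: "('r, 'o, 'm) lincat \<Rightarrow> ('r, 'o, 'm, 'e) bifunctor \<Rightarrow>
    ('o, 'm, 'e) realization \<Rightarrow> bool" where
  "enough_projectives C E s \<longleftrightarrow>
     (\<forall>D\<in>Ob C. \<exists>P g. proj_object C E P \<and> is_deflation C E s P D g)"

definition enough_injectives :: "('r, 'o, 'm) lincat \<Rightarrow> ('r, 'o, 'm, 'e) bifunctor \<Rightarrow>
    ('o, 'm, 'e) realization \<Rightarrow> bool" where
  "enough_injectives C E s \<longleftrightarrow>
     (\<forall>A\<in>Ob C. \<exists>I f. inj_object C E I \<and> is_inflation C E s A I f)"

definition dominant :: "('r, 'o, 'm) lincat \<Rightarrow> ('r, 'o, 'm, 'e) bifunctor \<Rightarrow>
    ('o, 'm, 'e) realization \<Rightarrow> 'o \<Rightarrow> 'o \<Rightarrow> 'e \<Rightarrow> bool" where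
  "dominant C E s D F \<theta> \<longleftrightarrow> \<theta> \<in> el E D F \<and>
     (\<exists>G f g. (G, f, g) \<in> s D F \<theta> \<and> g \<in> proj_mors C E G D)"

text \<open>Epimorphisms of functors into modules are the pointwise surjective transformations.\<close>

definition codominant :: "('r, 'o, 'm) lincat \<Rightarrow> ('r, 'o, 'm, 'e) bifunctor \<Rightarrow>
    'o \<Rightarrow> 'o \<Rightarrow> 'e \<Rightarrow> bool" where
  "codominant C E D A \<iota> \<longleftrightarrow> \<iota> \<in> el E D A \<and>
     (\<forall>X\<in>Ob C. (\<lambda>f. Pull E X D A f \<iota>) ` mor C X D = el E X A)"

section \<open>Positive extensions\<close>

text \<open>
  The coend over \<open>M\<close> of \<open>F(M, Y) \<otimes> E(X, M)\<close>. A list of quadruples \<open>(r, M, \<rho>, \<mu>)\<close> is the formal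
  sum of the terms \<open>r (\<rho> \<otimes> \<mu>)\<close>; two formal sums are identified by the smallest congruence that makes
  them a module, makes \<open>\<otimes>\<close> bilinear over \<open>R\<close> and identifies \<open>m\<^sup>*\<rho> \<otimes> \<lambda>\<close> with \<open>\<rho> \<otimes> m\<^sub>*\<lambda>\<close>.
  To keep the construction iterable inside one type, a class is not the set of its members but
  one representative of it, chosen by \<open>coend_rep\<close>.
\<close>

type_synonym ('r, 'o, 'x, 'e) formal_sum = "('r \<times> 'o \<times> 'x \<times> 'e) list"

definition formal_sums :: "'r ring \<Rightarrow> ('r, 'o, 'm) lincat \<Rightarrow> ('r, 'o, 'm, 'x) bifunctor \<Rightarrow>
    ('r, 'o, 'm, 'e) bifunctor \<Rightarrow> 'o \<Rightarrow> 'o \<Rightarrow> ('r, 'o, 'x, 'e) formal_sum set" where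
  "formal_sums R C F E X Y = lists {(r, M, \<rho>, \<mu>).
     r \<in> carrier R \<and> M \<in> Ob C \<and> \<rho> \<in> el F M Y \<and> \<mu> \<in> el E X M}"

inductive coend_eq :: "'r ring \<Rightarrow> ('r, 'o, 'm) lincat \<Rightarrow> ('r, 'o, 'm, 'x) bifunctor \<Rightarrow>
    ('r, 'o, 'm, 'e) bifunctor \<Rightarrow> 'o \<Rightarrow> 'o \<Rightarrow>
    ('r, 'o, 'x, 'e) formal_sum \<Rightarrow> ('r, 'o, 'x, 'e) formal_sum \<Rightarrow> bool"
  for R :: "'r ring" and C :: "('r, 'o, 'm) lincat" and F :: "('r, 'o, 'm, 'x) bifunctor"
    and E :: "('r, 'o, 'm, 'e) bifunctor" and X Y :: 'o
where
  refl: "xs \<in> formal_sums R C F E X Y \<Longrightarrow> coend_eq R C F E X Y xs xs"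
| sym: "coend_eq R C F E X Y xs ys \<Longrightarrow> coend_eq R C F E X Y ys xs"
| trans: "\<lbrakk>coend_eq R C F E X Y xs ys; coend_eq R C F E X Y ys zs\<rbrakk>
    \<Longrightarrow> coend_eq R C F E X Y xs zs"
| append: "\<lbrakk>coend_eq R C F E X Y xs xs'; coend_eq R C F E X Y ys ys'\<rbrakk>
    \<Longrightarrow> coend_eq R C F E X Y (xs @ ys) (xs' @ ys')"
| comm: "\<lbrakk>xs \<in> formal_sums R C F E X Y; ys \<in> formal_sums R C F E X Y\<rbrakk>
    \<Longrightarrow> coend_eq R C F E X Y (xs @ ys) (ys @ xs)"
| coeff_zero: "\<lbrakk>M \<in> Ob C; \<rho> \<in> el F M Y; \<mu> \<in> el E X M\<rbrakk>
    \<Longrightarrow> coend_eq R C F E X Y [(\<zero>\<^bsub>R\<^esub>, M, \<rho>, \<mu>)] []"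
| coeff_add: "\<lbrakk>r \<in> carrier R; r' \<in> carrier R; M \<in> Ob C; \<rho> \<in> el F M Y; \<mu> \<in> el E X M\<rbrakk>
    \<Longrightarrow> coend_eq R C F E X Y [(r \<oplus>\<^bsub>R\<^esub> r', M, \<rho>, \<mu>)] [(r, M, \<rho>, \<mu>), (r', M, \<rho>, \<mu>)]"
| left_add: "\<lbrakk>r \<in> carrier R; M \<in> Ob C; \<rho> \<in> el F M Y; \<rho>' \<in> el F M Y; \<mu> \<in> el E X M\<rbrakk>
    \<Longrightarrow> coend_eq R C F E X Y [(r, M, \<rho> \<oplus>\<^bsub>Val F M Y\<^esub> \<rho>', \<mu>)] [(r, M, \<rho>, \<mu>), (r, M, \<rho>', \<mu>)]"
| right_add: "\<lbrakk>r \<in> carrier R; M \<in> Ob C; \<rho> \<in> el F M Y; \<mu> \<in> el E X M; \<mu>' \<in> el E X M\<rbrakk>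
    \<Longrightarrow> coend_eq R C F E X Y [(r, M, \<rho>, \<mu> \<oplus>\<^bsub>Val E X M\<^esub> \<mu>')] [(r, M, \<rho>, \<mu>), (r, M, \<rho>, \<mu>')]"
| left_smult: "\<lbrakk>r \<in> carrier R; t \<in> carrier R; M \<in> Ob C; \<rho> \<in> el F M Y; \<mu> \<in> el E X M\<rbrakk>
    \<Longrightarrow> coend_eq R C F E X Y [(r, M, t \<odot>\<^bsub>Val F M Y\<^esub> \<rho>, \<mu>)] [(r \<otimes>\<^bsub>R\<^esub> t, M, \<rho>, \<mu>)]"
| right_smult: "\<lbrakk>r \<in> carrier R; t \<in> carrier R; M \<in> Ob C; \<rho> \<in> el F M Y; \<mu> \<in> el E X M\<rbrakk>
    \<Longrightarrow> coend_eq R C F E X Y [(r, M, \<rho>, t \<odot>\<^bsub>Val E X M\<^esub> \<mu>)] [(r \<otimes>\<^bsub>R\<^esub> t, M, \<rho>, \<mu>)]"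
| dinatural: "\<lbrakk>r \<in> carrier R; M \<in> Ob C; N \<in> Ob C; m \<in> mor C M N; \<rho> \<in> el F N Y; \<mu> \<in> el E X M\<rbrakk>
    \<Longrightarrow> coend_eq R C F E X Y [(r, M, Pull F M N Y m \<rho>, \<mu>)] [(r, N, \<rho>, Push E X M N m \<mu>)]"

definition coend_rep :: "'r ring \<Rightarrow> ('r, 'o, 'm) lincat \<Rightarrow> ('r, 'o, 'm, 'x) bifunctor \<Rightarrow>
    ('r, 'o, 'm, 'e) bifunctor \<Rightarrow> 'o \<Rightarrow> 'o \<Rightarrow>
    ('r, 'o, 'x, 'e) formal_sum \<Rightarrow> ('r, 'o, 'x, 'e) formal_sum" where
  "coend_rep R C F E X Y xs = (SOME ys. coend_eq R C F E X Y xs ys)"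

definition coend :: "'r ring \<Rightarrow> ('r, 'o, 'm) lincat \<Rightarrow> ('r, 'o, 'm, 'x) bifunctor \<Rightarrow>
    ('r, 'o, 'm, 'e) bifunctor \<Rightarrow> ('r, 'o, 'm, ('r, 'o, 'x, 'e) formal_sum) bifunctor" where
  "coend R C F E =
    \<lparr>Val = (\<lambda>X Y.
       \<lparr>carrier = coend_rep R C F E X Y ` formal_sums R C F E X Y,
        mult = undefined, one = undefined,
        zero = coend_rep R C F E X Y [],
        add = (\<lambda>xs ys. coend_rep R C F E X Y (xs @ ys)),
        smult = (\<lambda>t xs. coend_rep R C F E X Y
                    (map (\<lambda>(r, M, \<rho>, \<mu>). (t \<otimes>\<^bsub>R\<^esub> r, M, \<rho>, \<mu>)) xs))\<rparr>),
     Push = (\<lambda>X Y Y' a xs. coend_rep R C F E X Y'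
                    (map (\<lambda>(r, M, \<rho>, \<mu>). (r, M, Push F M Y Y' a \<rho>, \<mu>)) xs)),
     Pull = (\<lambda>X' X Y c xs. coend_rep R C F E X' Y
                    (map (\<lambda>(r, M, \<rho>, \<mu>). (r, M, \<rho>, Pull E X' X M c \<mu>)) xs))\<rparr>"

text \<open>Transport of structure along an injection \<open>i\<close> with left inverse \<open>j\<close>.\<close>

definition transport_module :: "('x \<Rightarrow> 'y) \<Rightarrow> ('y \<Rightarrow> 'x) \<Rightarrow> ('r, 'x) module \<Rightarrow> ('r, 'y) module" where
  "transport_module i j M =
    \<lparr>carrier = i ` carrier M, mult = undefined, one = undefined,
     zero = i \<zero>\<^bsub>M\<^esub>, add = (\<lambda>u v. i (j u \<oplus>\<^bsub>M\<^esub> j v)), smult = (\<lambda>r u. i (r \<odot>\<^bsub>M\<^esub> j u))\<rparr>"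

definition transport ::
    "('x \<Rightarrow> 'y) \<Rightarrow> ('y \<Rightarrow> 'x) \<Rightarrow> ('r, 'o, 'm, 'x) bifunctor \<Rightarrow> ('r, 'o, 'm, 'y) bifunctor" where
  "transport i j F =
    \<lparr>Val = (\<lambda>X Y. transport_module i j (Val F X Y)),
     Push = (\<lambda>X Y Y' a u. i (Push F X Y Y' a (j u))),
     Pull = (\<lambda>X' X Y c u. i (Pull F X' X Y c (j u)))\<rparr>"

text \<open>A single type for the elements of all positive extension modules.\<close>

datatype ('r, 'o, 'm, 'e) pext =
    Mor (the_mor: 'm)
  | Ext (the_ext: 'e)
  | Cls (the_cls: "('r \<times> 'o \<times> ('r, 'o, 'm, 'e) pext \<times> 'e) list")

fun Epos :: "'r ring \<Rightarrow> ('r, 'o, 'm) lincat \<Rightarrow> ('r, 'o, 'm, 'e) bifunctor \<Rightarrow> nat \<Rightarrow>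
    ('r, 'o, 'm, ('r, 'o, 'm, 'e) pext) bifunctor" where
  "Epos R C E 0 = transport Mor the_mor (hom_bifunctor C)"
| "Epos R C E (Suc 0) = transport Ext the_ext E"
| "Epos R C E (Suc (Suc n)) = transport Cls the_cls (coend R C (Epos R C E (Suc n)) E)"

text \<open>
  For \<open>\<delta>\<close> in \<open>E(D, A)\<close>: \<open>cup_right n D A Y \<delta>\<close> is \<open>\<mu> \<mapsto> \<mu> \<union> \<delta>\<close> from \<open>E\<^sup>n(A, Y)\<close> to \<open>E\<^sup>n\<^sup>+\<^sup>1(D, Y)\<close>, and
  \<open>cup_left n X D A \<delta>\<close> is \<open>\<mu> \<mapsto> \<delta> \<union> \<mu>\<close> from \<open>E\<^sup>n(X, D)\<close> to \<open>E\<^sup>n\<^sup>+\<^sup>1(X, A)\<close>. The last clause of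
  \<open>cup_left\<close> is the associativity \<open>\<delta> \<union> (\<rho> \<union> \<mu>) = (\<delta> \<union> \<rho>) \<union> \<mu>\<close>.
\<close>

fun cup_right :: "'r ring \<Rightarrow> ('r, 'o, 'm) lincat \<Rightarrow> ('r, 'o, 'm, 'e) bifunctor \<Rightarrow> nat \<Rightarrow>
    'o \<Rightarrow> 'o \<Rightarrow> 'o \<Rightarrow> 'e \<Rightarrow> ('r, 'o, 'm, 'e) pext \<Rightarrow> ('r, 'o, 'm, 'e) pext" where
  "cup_right R C E 0 D A Y \<delta> u = Ext (Push E D A Y (the_mor u) \<delta>)"
| "cup_right R C E (Suc n) D A Y \<delta> u =
     Cls (coend_rep R C (Epos R C E (Suc n)) E D Y [(\<one>\<^bsub>R\<^esub>, A, u, \<delta>)])"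

fun cup_left :: "'r ring \<Rightarrow> ('r, 'o, 'm) lincat \<Rightarrow> ('r, 'o, 'm, 'e) bifunctor \<Rightarrow> nat \<Rightarrow>
    'o \<Rightarrow> 'o \<Rightarrow> 'o \<Rightarrow> 'e \<Rightarrow> ('r, 'o, 'm, 'e) pext \<Rightarrow> ('r, 'o, 'm, 'e) pext" where
  "cup_left R C E 0 X D A \<delta> u = Ext (Pull E X D A (the_mor u) \<delta>)"
| "cup_left R C E (Suc 0) X D A \<delta> u =
     Cls (coend_rep R C (Epos R C E (Suc 0)) E X A [(\<one>\<^bsub>R\<^esub>, D, Ext \<delta>, the_ext u)])"
| "cup_left R C E (Suc (Suc n)) X D A \<delta> u =
     Cls (coend_rep R C (Epos R C E (Suc (Suc n))) E X A
       (map (\<lambda>(r, M, \<rho>, \<mu>). (r, M, cup_left R C E (Suc n) M D A \<delta> \<rho>, \<mu>)) (the_cls u)))"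

section \<open>Negative extensions\<close>

text \<open>
  Families of functions are extensional, so that equality of transformations is equality of
  their components on elements.
\<close>

definition nat_trans_cov :: "'r ring \<Rightarrow> ('r, 'o, 'm) lincat \<Rightarrow>
    ('r, 'o, 'm, 'x) bifunctor \<Rightarrow> 'o \<Rightarrow> ('r, 'o, 'm, 'y) bifunctor \<Rightarrow> 'o \<Rightarrow> ('o \<Rightarrow> 'x \<Rightarrow> 'y) set" where
  "nat_trans_cov R C F A G D = {\<phi> \<in> (\<Pi>\<^sub>E Y\<in>Ob C. el F A Y \<rightarrow>\<^sub>E el G D Y).
     (\<forall>Y\<in>Ob C. \<phi> Y \<in> lin_maps R (Val F A Y) (Val G D Y)) \<and>
     (\<forall>Y\<in>Ob C. \<forall>Y'\<in>Ob C. \<forall>a\<in>mor C Y Y'. \<forall>u\<in>el F A Y.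
        \<phi> Y' (Push F A Y Y' a u) = Push G D Y Y' a (\<phi> Y u))}"

definition nat_trans_contra :: "'r ring \<Rightarrow> ('r, 'o, 'm) lincat \<Rightarrow>
    ('r, 'o, 'm, 'x) bifunctor \<Rightarrow> 'o \<Rightarrow> ('r, 'o, 'm, 'y) bifunctor \<Rightarrow> 'o \<Rightarrow> ('o \<Rightarrow> 'x \<Rightarrow> 'y) set" where
  "nat_trans_contra R C F D G A = {\<phi> \<in> (\<Pi>\<^sub>E X\<in>Ob C. el F X D \<rightarrow>\<^sub>E el G X A).
     (\<forall>X\<in>Ob C. \<phi> X \<in> lin_maps R (Val F X D) (Val G X A)) \<and>
     (\<forall>X'\<in>Ob C. \<forall>X\<in>Ob C. \<forall>c\<in>mor C X' X. \<forall>u\<in>el F X D.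
        \<phi> X' (Pull F X' X D c u) = Pull G X' X A c (\<phi> X u))}"

text \<open>\<open>neg_I R C F G\<close> at \<open>(D, A)\<close> is the module of transformations from \<open>F(A, -)\<close> to \<open>G(D, -)\<close>.\<close>

definition neg_I :: "'r ring \<Rightarrow> ('r, 'o, 'm) lincat \<Rightarrow> ('r, 'o, 'm, 'x) bifunctor \<Rightarrow>
    ('r, 'o, 'm, 'y) bifunctor \<Rightarrow> ('r, 'o, 'm, 'o \<Rightarrow> 'x \<Rightarrow> 'y) bifunctor" where
  "neg_I R C F G =
    \<lparr>Val = (\<lambda>D A.
       \<lparr>carrier = nat_trans_cov R C F A G D,
        mult = undefined, one = undefined,
        zero = (\<lambda>Y\<in>Ob C. \<lambda>u\<in>el F A Y. \<zero>\<^bsub>Val G D Y\<^esub>),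
        add = (\<lambda>\<phi> \<chi>. \<lambda>Y\<in>Ob C. \<lambda>u\<in>el F A Y. \<phi> Y u \<oplus>\<^bsub>Val G D Y\<^esub> \<chi> Y u),
        smult = (\<lambda>r \<phi>. \<lambda>Y\<in>Ob C. \<lambda>u\<in>el F A Y. r \<odot>\<^bsub>Val G D Y\<^esub> \<phi> Y u)\<rparr>),
     Push = (\<lambda>D A A' a \<phi>. \<lambda>Y\<in>Ob C. \<lambda>u\<in>el F A' Y. \<phi> Y (Pull F A A' Y a u)),
     Pull = (\<lambda>D' D A c \<phi>. \<lambda>Y\<in>Ob C. \<lambda>u\<in>el F A Y. Pull G D' D Y c (\<phi> Y u))\<rparr>"

text \<open>\<open>neg_II R C F G\<close> at \<open>(D, A)\<close> is the module of transformations from \<open>F(-, D)\<close> to \<open>G(-, A)\<close>.\<close>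

definition neg_II :: "'r ring \<Rightarrow> ('r, 'o, 'm) lincat \<Rightarrow> ('r, 'o, 'm, 'x) bifunctor \<Rightarrow>
    ('r, 'o, 'm, 'y) bifunctor \<Rightarrow> ('r, 'o, 'm, 'o \<Rightarrow> 'x \<Rightarrow> 'y) bifunctor" where
  "neg_II R C F G =
    \<lparr>Val = (\<lambda>D A.
       \<lparr>carrier = nat_trans_contra R C F D G A,
        mult = undefined, one = undefined,
        zero = (\<lambda>X\<in>Ob C. \<lambda>u\<in>el F X D. \<zero>\<^bsub>Val G X A\<^esub>),
        add = (\<lambda>\<phi> \<chi>. \<lambda>X\<in>Ob C. \<lambda>u\<in>el F X D. \<phi> X u \<oplus>\<^bsub>Val G X A\<^esub> \<chi> X u),
        smult = (\<lambda>r \<phi>. \<lambda>X\<in>Ob C. \<lambda>u\<in>el F X D. r \<odot>\<^bsub>Val G X A\<^esub> \<phi> X u)\<rparr>),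
     Push = (\<lambda>D A A' a \<phi>. \<lambda>X\<in>Ob C. \<lambda>u\<in>el F X D. Push G X A A' a (\<phi> X u)),
     Pull = (\<lambda>D' D A c \<phi>. \<lambda>X\<in>Ob C. \<lambda>u\<in>el F X D'. \<phi> X (Push F X D' D c u))\<rparr>"

datatype ('r, 'o, 'm, 'e) zext =
    NonNeg (the_nonneg: "('r, 'o, 'm, 'e) pext")
  | Neg (the_neg: "'o \<Rightarrow> ('r, 'o, 'm, 'e) pext \<Rightarrow> ('r, 'o, 'm, 'e) pext")

text \<open>In degree \<open>0\<close> both functors are the Hom functor itself, as provided by Yoneda.\<close>

definition EI :: "'r ring \<Rightarrow> ('r, 'o, 'm) lincat \<Rightarrow> ('r, 'o, 'm, 'e) bifunctor \<Rightarrow> int \<Rightarrow>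
    ('r, 'o, 'm, ('r, 'o, 'm, 'e) zext) bifunctor" where
  "EI R C E n = (if n \<ge> 0 then transport NonNeg the_nonneg (Epos R C E (nat n))
     else transport Neg the_neg (neg_I R C (Epos R C E (nat (- n))) (Epos R C E 0)))"

definition EII :: "'r ring \<Rightarrow> ('r, 'o, 'm) lincat \<Rightarrow> ('r, 'o, 'm, 'e) bifunctor \<Rightarrow> int \<Rightarrow>
    ('r, 'o, 'm, ('r, 'o, 'm, 'e) zext) bifunctor" where
  "EII R C E n = (if n \<ge> 0 then transport NonNeg the_nonneg (Epos R C E (nat n))
     else transport Neg the_neg (neg_II R C (Epos R C E (nat (- n))) (Epos R C E 0)))"

text \<open>
  For \<open>\<delta>\<close> in \<open>E(D, A)\<close>: \<open>sharp_I n X D A \<delta>\<close> is \<open>\<delta>\<^sub>\<sharp>\<close> from \<open>EI n\<close> at \<open>(X, D)\<close> to \<open>EI (n + 1)\<close> at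
  \<open>(X, A)\<close>, and \<open>sharp_II n D A Y \<delta>\<close> is \<open>\<delta>\<^sup>\<sharp>\<close> from \<open>EII n\<close> at \<open>(A, Y)\<close> to \<open>EII (n + 1)\<close> at \<open>(D, Y)\<close>.
  For \<open>n = -1\<close> the composite is a transformation between representable functors, and the Yoneda
  bijection sends it to its value at the identity.
\<close>

definition sharp_I :: "'r ring \<Rightarrow> ('r, 'o, 'm) lincat \<Rightarrow> ('r, 'o, 'm, 'e) bifunctor \<Rightarrow> int \<Rightarrow>
    'o \<Rightarrow> 'o \<Rightarrow> 'o \<Rightarrow> 'e \<Rightarrow> ('r, 'o, 'm, 'e) zext \<Rightarrow> ('r, 'o, 'm, 'e) zext" where
  "sharp_I R C E n X D A \<delta> z =
    (if n \<ge> 0 then NonNeg (cup_left R C E (nat n) X D A \<delta> (the_nonneg z))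
     else if n = - 1 then NonNeg (the_neg z A (cup_right R C E 0 D A A \<delta> (Mor (Idm C A))))
     else Neg (\<lambda>Y\<in>Ob C. \<lambda>u\<in>el (Epos R C E (nat (- (n + 1)))) A Y.
            the_neg z Y (cup_right R C E (nat (- (n + 1))) D A Y \<delta> u)))"

definition sharp_II :: "'r ring \<Rightarrow> ('r, 'o, 'm) lincat \<Rightarrow> ('r, 'o, 'm, 'e) bifunctor \<Rightarrow> int \<Rightarrow>
    'o \<Rightarrow> 'o \<Rightarrow> 'o \<Rightarrow> 'e \<Rightarrow> ('r, 'o, 'm, 'e) zext \<Rightarrow> ('r, 'o, 'm, 'e) zext" where
  "sharp_II R C E n D A Y \<delta> z =
    (if n \<ge> 0 then NonNeg (cup_right R C E (nat n) D A Y \<delta> (the_nonneg z))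
     else if n = - 1 then NonNeg (the_neg z D (cup_left R C E 0 D D A \<delta> (Mor (Idm C D))))
     else Neg (\<lambda>X\<in>Ob C. \<lambda>u\<in>el (Epos R C E (nat (- (n + 1)))) X D.
            the_neg z X (cup_left R C E (nat (- (n + 1))) X D A \<delta> u)))"

definition nat_isos :: "'r ring \<Rightarrow> ('r, 'o, 'm) lincat \<Rightarrow> ('r, 'o, 'm, 'x) bifunctor \<Rightarrow>
    ('r, 'o, 'm, 'y) bifunctor \<Rightarrow> ('o \<Rightarrow> 'o \<Rightarrow> 'x \<Rightarrow> 'y) set" where
  "nat_isos R C F G = {\<psi> \<in> (\<Pi>\<^sub>E X\<in>Ob C. \<Pi>\<^sub>E Y\<in>Ob C. el F X Y \<rightarrow>\<^sub>E el G X Y).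
     (\<forall>X\<in>Ob C. \<forall>Y\<in>Ob C. \<psi> X Y \<in> lin_maps R (Val F X Y) (Val G X Y) \<and>
        bij_betw (\<psi> X Y) (el F X Y) (el G X Y)) \<and>
     (\<forall>X\<in>Ob C. \<forall>Y\<in>Ob C. \<forall>Y'\<in>Ob C. \<forall>a\<in>mor C Y Y'. \<forall>u\<in>el F X Y.
        \<psi> X Y' (Push F X Y Y' a u) = Push G X Y Y' a (\<psi> X Y u)) \<and>
     (\<forall>X'\<in>Ob C. \<forall>X\<in>Ob C. \<forall>Y\<in>Ob C. \<forall>c\<in>mor C X' X. \<forall>u\<in>el F X Y.
        \<psi> X' Y (Pull F X' X Y c u) = Pull G X' X Y c (\<psi> X Y u))}"

definition NI_plus :: "'r ring \<Rightarrow> ('r, 'o, 'm) lincat \<Rightarrow> ('r, 'o, 'm, 'e) bifunctor \<Rightarrow>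
    ('o, 'm, 'e) realization \<Rightarrow> bool" where
  "NI_plus R C E s \<longleftrightarrow> (\<forall>X\<in>Ob C. \<forall>Y\<in>Ob C. \<forall>Q\<in>Ob C. \<forall>\<omega>. dominant C E s Y Q \<omega> \<longrightarrow>
     {z \<in> el (EI R C E (- 1)) X Y.
        sharp_I R C E (- 1) X Y Q \<omega> z \<in> (\<lambda>f. NonNeg (Mor f)) ` inj_mors C E X Q}
     = {\<zero>\<^bsub>Val (EI R C E (- 1)) X Y\<^esub>})"

definition NII_plus :: "'r ring \<Rightarrow> ('r, 'o, 'm) lincat \<Rightarrow> ('r, 'o, 'm, 'e) bifunctor \<Rightarrow> bool" where
  "NII_plus R C E \<longleftrightarrow> (\<forall>X\<in>Ob C. \<forall>Y\<in>Ob C. \<forall>J\<in>Ob C. \<forall>\<iota>. codominant C E J X \<iota> \<longrightarrow>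
     {z \<in> el (EII R C E (- 1)) X Y.
        sharp_II R C E (- 1) J X Y \<iota> z \<in> (\<lambda>f. NonNeg (Mor f)) ` proj_mors C E J Y}
     = {\<zero>\<^bsub>Val (EII R C E (- 1)) X Y\<^esub>})"

end

theory Submission
  imports Defs
begin

text \<open>
  In degree \<open>n < 0\<close> the required compatibility is, once \<open>\<psi>\<^sup>(\<^sup>n\<^sup>+\<^sup>1\<^sup>)\<close> and \<open>\<psi>\<^sup>(\<^sup>n\<^sup>+\<^sup>2\<^sup>)\<close> are known, a family of equations
  \<open>lhs z = rhs w\<close> between an element \<open>z\<close> of \<open>E\<^sub>I\<^sup>n(X, Y)\<close> and its image \<open>w\<close> in \<open>E\<^sub>I\<^sub>I\<^sup>n(X, Y)\<close>, one for each pair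
  of extensions \<open>\<delta>\<close> in \<open>E(W, X)\<close> and \<open>\<rho>\<close> in \<open>E(Y, Z)\<close>. Choose s-triangles \<open>Q \<rightarrow> G \<rightarrow> Y\<close> with extension \<open>\<omega>\<close> and
  \<open>X \<rightarrow> I \<rightarrow> J\<close> with extension \<open>\<iota>\<close>, where \<open>G\<close> is projective and \<open>I\<close> is injective. Every \<open>\<delta>\<close> is a pullback of
  \<open>\<iota>\<close> and every \<open>\<rho>\<close> is a pushout of \<open>\<omega>\<close>, so by naturality the single equation for \<open>(\<iota>, \<omega>)\<close> implies all
  others (\<open>compatible_iff\<close>). For this pair both sides are injective functions, of \<open>z\<close> and of \<open>w\<close>, with the same
  image (\<open>lhs_rhs_common_image\<close>). Compatibility is therefore a bijective relation; it is linear and natural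
  because it is stated without any choice, hence it is the graph of exactly one natural isomorphism
  (\<open>relation_nat_iso\<close>). Descending from the identities in degrees \<open>0\<close> and \<open>1\<close> gives existence and uniqueness
  together. In degrees \<open>n \<ge> 0\<close> compatibility is the associativity of cup products (\<open>cup_assoc\<close>).

  The two injections with a common image come from dimension shifting. The functor \<open>E(Y, -)\<close> is the cokernel
  of \<open>C(G, -) \<rightarrow> C(Q, -)\<close> and \<open>E\<^sup>n(G, -) = 0\<close> for \<open>n \<ge> 1\<close>, so \<open>\<mu> \<mapsto> \<mu> \<union> \<omega>\<close> is a bijection from \<open>E\<^sup>n(Q, -)\<close> to
  \<open>E\<^sup>n\<^sup>+\<^sup>1(Y, -)\<close> for \<open>n \<ge> 1\<close> (\<open>cup_omega_bij\<close>). Dually \<open>\<lambda> \<mapsto> \<iota> \<union> \<lambda>\<close> is a bijection from \<open>E\<^sup>n(-, J)\<close> to \<open>E\<^sup>n\<^sup>+\<^sup>1(-, X)\<close>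
  (\<open>cup_iota_bij\<close>). Hence \<open>\<omega>\<^sub>\<sharp>\<close> and \<open>\<iota>\<^sup>\<sharp>\<close> are bijective on negative extensions of degree at most \<open>-2\<close>. On degree
  \<open>-1\<close> they are injective; the image of \<open>\<omega>\<^sub>\<sharp>\<close> consists of the morphisms into \<open>Q\<close> that vanish in \<open>G\<close>, and that of
  \<open>\<iota>\<^sup>\<sharp>\<close> of the morphisms out of \<open>J\<close> that vanish on \<open>I\<close>. For \<open>n \<le> -3\<close> both sides are then bijective. For \<open>n = -2\<close>
  the images are two subgroups of \<open>C(J, Q)\<close>, which agree by (NI+) and (NII+): if \<open>f : J \<rightarrow> Q\<close> vanishes in \<open>G\<close>,
  then its restriction to \<open>I\<close> is an injective morphism in the image of \<open>\<omega>\<^sub>\<sharp>\<close>, hence zero (\<open>kernels_agree\<close>). For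
  \<open>n = -1\<close> the sides are \<open>f\<^sub>*\<iota>\<close> and \<open>h\<^sup>*\<omega>\<close> with \<open>f : X \<rightarrow> Q\<close> and \<open>h : J \<rightarrow> Y\<close>; a morphism of triangles turns \<open>f\<close> into
  \<open>h\<close> and conversely (\<open>transfer_left\<close>, \<open>transfer_right\<close>), while (NI+) and (NII+) give injectivity.
\<close>

section \<open>Linear maps and bilinear functors\<close>

lemma lin_mapsI:
  assumes "\<And>u. u \<in> carrier M \<Longrightarrow> h u \<in> carrier N"
    and "\<And>u v. \<lbrakk>u \<in> carrier M; v \<in> carrier M\<rbrakk> \<Longrightarrow> h (u \<oplus>\<^bsub>M\<^esub> v) = h u \<oplus>\<^bsub>N\<^esub> h v"
    and "\<And>r u. \<lbrakk>r \<in> carrier R; u \<in> carrier M\<rbrakk> \<Longrightarrow> h (r \<odot>\<^bsub>M\<^esub> u) = r \<odot>\<^bsub>N\<^esub> h u"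
  shows "h \<in> lin_maps R M N"
  using assms by (auto simp: lin_maps_def)

lemma lin_maps_closed: "\<lbrakk>h \<in> lin_maps R M N; u \<in> carrier M\<rbrakk> \<Longrightarrow> h u \<in> carrier N"
  by (auto simp: lin_maps_def)

lemma lin_maps_add:
  "\<lbrakk>h \<in> lin_maps R M N; u \<in> carrier M; v \<in> carrier M\<rbrakk> \<Longrightarrow> h (u \<oplus>\<^bsub>M\<^esub> v) = h u \<oplus>\<^bsub>N\<^esub> h v"
  by (auto simp: lin_maps_def)

lemma lin_maps_smult:
  "\<lbrakk>h \<in> lin_maps R M N; r \<in> carrier R; u \<in> carrier M\<rbrakk> \<Longrightarrow> h (r \<odot>\<^bsub>M\<^esub> u) = r \<odot>\<^bsub>N\<^esub> h u"
  by (auto simp: lin_maps_def)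

lemma module_add_closed:
  "\<lbrakk>module R M; u \<in> carrier M; v \<in> carrier M\<rbrakk> \<Longrightarrow> u \<oplus>\<^bsub>M\<^esub> v \<in> carrier M"
  by (meson abelian_group.axioms(1) abelian_monoid.a_closed module_def)

lemma module_smult_closed:
  "\<lbrakk>module R M; r \<in> carrier R; u \<in> carrier M\<rbrakk> \<Longrightarrow> r \<odot>\<^bsub>M\<^esub> u \<in> carrier M"
  by (rule module.smult_closed)

lemma module_zero_closed: "module R M \<Longrightarrow> \<zero>\<^bsub>M\<^esub> \<in> carrier M"
  by (meson abelian_group.axioms(1) abelian_monoid.zero_closed module_def)

lemma module_minus_eq_zero:
  assumes "module R M" "u \<in> carrier M" "v \<in> carrier M" "u \<ominus>\<^bsub>M\<^esub> v = \<zero>\<^bsub>M\<^esub>"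
  shows "u = v"
proof -
  interpret M: module R M by fact
  have "u = (u \<ominus>\<^bsub>M\<^esub> v) \<oplus>\<^bsub>M\<^esub> v"
    using assms(2,3) by (simp add: a_minus_def M.M.a_assoc M.M.l_neg)
  then show ?thesis using assms(2-4) by simp
qed

lemma module_minus_zero:
  assumes "module R M" "u \<in> carrier M"
  shows "u \<ominus>\<^bsub>M\<^esub> \<zero>\<^bsub>M\<^esub> = u"
proof -
  interpret M: module R M by fact
  show ?thesis using assms(2) by (simp add: a_minus_def)
qed

lemma lin_maps_zero:
  assumes "module R M" "module R N" "h \<in> lin_maps R M N"
  shows "h \<zero>\<^bsub>M\<^esub> = \<zero>\<^bsub>N\<^esub>"
proof -
  interpret M: module R M by fact
  interpret N: module R N by fact
  have c: "h \<zero>\<^bsub>M\<^esub> \<in> carrier N" using assms(3) by (simp add: lin_maps_closed)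
  have "h \<zero>\<^bsub>M\<^esub> = h (\<zero>\<^bsub>R\<^esub> \<odot>\<^bsub>M\<^esub> \<zero>\<^bsub>M\<^esub>)" by simp
  also have "\<dots> = \<zero>\<^bsub>R\<^esub> \<odot>\<^bsub>N\<^esub> h \<zero>\<^bsub>M\<^esub>"
    by (rule lin_maps_smult[OF assms(3)]) auto
  finally show ?thesis using c by simp
qed

lemma lin_maps_minus:
  assumes "module R M" "module R N" "h \<in> lin_maps R M N" "u \<in> carrier M" "v \<in> carrier M"
  shows "h (u \<ominus>\<^bsub>M\<^esub> v) = h u \<ominus>\<^bsub>N\<^esub> h v"
proof -
  interpret M: module R M by fact
  interpret N: module R N by fact
  have c: "h u \<in> carrier N" "h v \<in> carrier N" using assms by (auto simp: lin_maps_closed)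
  have d: "u \<ominus>\<^bsub>M\<^esub> v \<in> carrier M" using assms by simp
  have "h (u \<ominus>\<^bsub>M\<^esub> v) \<oplus>\<^bsub>N\<^esub> h v = h ((u \<ominus>\<^bsub>M\<^esub> v) \<oplus>\<^bsub>M\<^esub> v)"
    using lin_maps_add[OF assms(3) d assms(5)] by simp
  also have "(u \<ominus>\<^bsub>M\<^esub> v) \<oplus>\<^bsub>M\<^esub> v = u"
    using assms by (simp add: a_minus_def M.add.m_assoc M.l_neg)
  finally have e: "h (u \<ominus>\<^bsub>M\<^esub> v) \<oplus>\<^bsub>N\<^esub> h v = h u" .
  have "h (u \<ominus>\<^bsub>M\<^esub> v) \<in> carrier N" using d assms(3) by (simp add: lin_maps_closed)
  then show ?thesis using e c
    by (metis N.M.add.inv_solve_right a_minus_def)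
qed

lemma lin_maps_comp:
  "\<lbrakk>h \<in> lin_maps R M N; k \<in> lin_maps R N L\<rbrakk> \<Longrightarrow> (\<lambda>u. k (h u)) \<in> lin_maps R M L"
  by (rule lin_mapsI) (auto simp: lin_maps_closed lin_maps_add lin_maps_smult)

lemma lin_maps_id: "(\<lambda>u. u) \<in> lin_maps R M M"
  by (rule lin_mapsI) auto

lemma lin_maps_cong:
  assumes "module R M" "h \<in> lin_maps R M N" "\<And>u. u \<in> carrier M \<Longrightarrow> h u = k u"
  shows "k \<in> lin_maps R M N"
  using assms by (auto simp: lin_maps_def module_add_closed module_smult_closed Pi_iff)

lemma lin_maps_inv_into:
  assumes M: "module R M" and h: "h \<in> lin_maps R M N" and b: "bij_betw h (carrier M) (carrier N)"
  shows "inv_into (carrier M) h \<in> lin_maps R N M"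
proof (rule lin_mapsI)
  note c = bij_betw_imp_surj_on[OF b] bij_betw_imp_inj_on[OF b]
  have k: "inv_into (carrier M) h u \<in> carrier M" "h (inv_into (carrier M) h u) = u"
    if "u \<in> carrier N" for u
    using that c by (auto simp: inv_into_into f_inv_into_f)
  show "inv_into (carrier M) h u \<in> carrier M" if "u \<in> carrier N" for u by (rule k(1)[OF that])
  show "inv_into (carrier M) h (u \<oplus>\<^bsub>N\<^esub> v) = inv_into (carrier M) h u \<oplus>\<^bsub>M\<^esub> inv_into (carrier M) h v"
    if "u \<in> carrier N" "v \<in> carrier N" for u v
    by (rule inv_into_f_eq[OF c(2)]) (use that k M h in \<open>auto simp: module_add_closed lin_maps_add\<close>)
  show "inv_into (carrier M) h (r \<odot>\<^bsub>N\<^esub> u) = r \<odot>\<^bsub>M\<^esub> inv_into (carrier M) h u"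
    if "r \<in> carrier R" "u \<in> carrier N" for r u
    by (rule inv_into_f_eq[OF c(2)]) (use that k M h in \<open>auto simp: module_smult_closed lin_maps_smult\<close>)
qed

context linear_category
begin

lemma comp_closed:
  "\<lbrakk>X \<in> Ob C; Y \<in> Ob C; Z \<in> Ob C; f \<in> mor C X Y; g \<in> mor C Y Z\<rbrakk> \<Longrightarrow> Cmp C X Y Z g f \<in> mor C X Z"
  by (rule lin_maps_closed[OF comp_linear_right])

lemma comp_zero_right:
  "\<lbrakk>X \<in> Ob C; Y \<in> Ob C; Z \<in> Ob C; g \<in> mor C Y Z\<rbrakk>
    \<Longrightarrow> Cmp C X Y Z g \<zero>\<^bsub>Hom C X Y\<^esub> = \<zero>\<^bsub>Hom C X Z\<^esub>"
  by (rule lin_maps_zero[OF hom_module hom_module comp_linear_right]) auto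

lemma comp_zero_left:
  "\<lbrakk>X \<in> Ob C; Y \<in> Ob C; Z \<in> Ob C; f \<in> mor C X Y\<rbrakk>
    \<Longrightarrow> Cmp C X Y Z \<zero>\<^bsub>Hom C Y Z\<^esub> f = \<zero>\<^bsub>Hom C X Z\<^esub>"
  by (rule lin_maps_zero[OF hom_module hom_module comp_linear_left]) auto

lemma comp_minus_right:
  "\<lbrakk>X \<in> Ob C; Y \<in> Ob C; Z \<in> Ob C; g \<in> mor C Y Z; f \<in> mor C X Y; f' \<in> mor C X Y\<rbrakk>
    \<Longrightarrow> Cmp C X Y Z g (f \<ominus>\<^bsub>Hom C X Y\<^esub> f') = Cmp C X Y Z g f \<ominus>\<^bsub>Hom C X Z\<^esub> Cmp C X Y Z g f'"
  by (rule lin_maps_minus[OF hom_module hom_module comp_linear_right]) auto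

lemma comp_minus_left:
  "\<lbrakk>X \<in> Ob C; Y \<in> Ob C; Z \<in> Ob C; f \<in> mor C X Y; g \<in> mor C Y Z; g' \<in> mor C Y Z\<rbrakk>
    \<Longrightarrow> Cmp C X Y Z (g \<ominus>\<^bsub>Hom C Y Z\<^esub> g') f = Cmp C X Y Z g f \<ominus>\<^bsub>Hom C X Z\<^esub> Cmp C X Y Z g' f"
  by (rule lin_maps_minus[OF hom_module hom_module comp_linear_left]) auto

lemma mor_zero_closed: "\<lbrakk>X \<in> Ob C; Y \<in> Ob C\<rbrakk> \<Longrightarrow> \<zero>\<^bsub>Hom C X Y\<^esub> \<in> mor C X Y"
  using hom_module module_zero_closed by blast

lemma mor_minus_closed:
  "\<lbrakk>X \<in> Ob C; Y \<in> Ob C; f \<in> mor C X Y; g \<in> mor C X Y\<rbrakk> \<Longrightarrow> f \<ominus>\<^bsub>Hom C X Y\<^esub> g \<in> mor C X Y"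
  by (meson abelian_group.minus_closed hom_module module_def)

lemma mor_minus_self: "\<lbrakk>X \<in> Ob C; Y \<in> Ob C; f \<in> mor C X Y\<rbrakk> \<Longrightarrow> f \<ominus>\<^bsub>Hom C X Y\<^esub> f = \<zero>\<^bsub>Hom C X Y\<^esub>"
  by (metis a_minus_def abelian_group.r_neg hom_module module_def)

lemma hom_bifunctor_simps [simp]:
  "Val (hom_bifunctor C) = Hom C"
  "Push (hom_bifunctor C) X Y Y' a f = Cmp C X Y Y' a f"
  "Pull (hom_bifunctor C) X' X Y c f = Cmp C X' X Y f c"
  by (simp_all add: hom_bifunctor_def)

lemma bilinear_functor_hom: "bilinear_functor R C (hom_bifunctor C)"
proof (intro bilinear_functor.intro bilinear_functor_axioms.intro linear_category_axioms)
  fix X Y Y' a assume "X \<in> Ob C" "Y \<in> Ob C" "Y' \<in> Ob C" "a \<in> mor C Y Y'"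
  then show "Push (hom_bifunctor C) X Y Y' a
      \<in> lin_maps R (Val (hom_bifunctor C) X Y) (Val (hom_bifunctor C) X Y')"
    using comp_linear_right by (simp add: hom_bifunctor_def)
next
  fix X' X Y c assume "X' \<in> Ob C" "X \<in> Ob C" "Y \<in> Ob C" "c \<in> mor C X' X"
  then show "Pull (hom_bifunctor C) X' X Y c
      \<in> lin_maps R (Val (hom_bifunctor C) X Y) (Val (hom_bifunctor C) X' Y)"
    using comp_linear_left by (simp add: hom_bifunctor_def)
qed (simp_all add: comp_assoc id_left id_right hom_module comp_linear_left comp_linear_right)

end

context bilinear_functor
begin

lemmas val_add_closed = module_add_closed[OF val_module]
lemmas val_smult_closed = module_smult_closed[OF val_module]
lemmas val_zero_closed = module_zero_closed[OF val_module]

lemma push_closed: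
  "\<lbrakk>X \<in> Ob C; Y \<in> Ob C; Y' \<in> Ob C; a \<in> mor C Y Y'; u \<in> el F X Y\<rbrakk> \<Longrightarrow> Push F X Y Y' a u \<in> el F X Y'"
  by (rule lin_maps_closed[OF push_linear])

lemma pull_closed:
  "\<lbrakk>X' \<in> Ob C; X \<in> Ob C; Y \<in> Ob C; c \<in> mor C X' X; u \<in> el F X Y\<rbrakk> \<Longrightarrow> Pull F X' X Y c u \<in> el F X' Y"
  by (rule lin_maps_closed[OF pull_linear])

lemmas push_add = lin_maps_add[OF push_linear]
lemmas push_smult = lin_maps_smult[OF push_linear]
lemmas pull_add = lin_maps_add[OF pull_linear]
lemmas pull_smult = lin_maps_smult[OF pull_linear]
lemmas push_mor_add = lin_maps_add[OF push_linear_mor]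
lemmas push_mor_smult = lin_maps_smult[OF push_linear_mor]
lemmas pull_mor_add = lin_maps_add[OF pull_linear_mor]
lemmas pull_mor_smult = lin_maps_smult[OF pull_linear_mor]

lemma push_zero:
  "\<lbrakk>X \<in> Ob C; Y \<in> Ob C; Y' \<in> Ob C; a \<in> mor C Y Y'\<rbrakk>
    \<Longrightarrow> Push F X Y Y' a \<zero>\<^bsub>Val F X Y\<^esub> = \<zero>\<^bsub>Val F X Y'\<^esub>"
  by (rule lin_maps_zero[OF val_module val_module push_linear]) auto

lemma pull_zero:
  "\<lbrakk>X' \<in> Ob C; X \<in> Ob C; Y \<in> Ob C; c \<in> mor C X' X\<rbrakk>
    \<Longrightarrow> Pull F X' X Y c \<zero>\<^bsub>Val F X Y\<^esub> = \<zero>\<^bsub>Val F X' Y\<^esub>"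
  by (rule lin_maps_zero[OF val_module val_module pull_linear]) auto

lemma push_zero_mor:
  "\<lbrakk>X \<in> Ob C; Y \<in> Ob C; Y' \<in> Ob C; u \<in> el F X Y\<rbrakk>
    \<Longrightarrow> Push F X Y Y' \<zero>\<^bsub>Hom C Y Y'\<^esub> u = \<zero>\<^bsub>Val F X Y'\<^esub>"
  by (rule lin_maps_zero[OF hom_module val_module push_linear_mor]) auto

lemma pull_zero_mor:
  "\<lbrakk>X' \<in> Ob C; X \<in> Ob C; Y \<in> Ob C; u \<in> el F X Y\<rbrakk>
    \<Longrightarrow> Pull F X' X Y \<zero>\<^bsub>Hom C X' X\<^esub> u = \<zero>\<^bsub>Val F X' Y\<^esub>"
  by (rule lin_maps_zero[OF hom_module val_module pull_linear_mor]) auto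

lemma push_mor_minus:
  "\<lbrakk>X \<in> Ob C; Y \<in> Ob C; Y' \<in> Ob C; u \<in> el F X Y; a \<in> mor C Y Y'; b \<in> mor C Y Y'\<rbrakk>
    \<Longrightarrow> Push F X Y Y' (a \<ominus>\<^bsub>Hom C Y Y'\<^esub> b) u = Push F X Y Y' a u \<ominus>\<^bsub>Val F X Y'\<^esub> Push F X Y Y' b u"
  by (rule lin_maps_minus[OF hom_module val_module push_linear_mor]) auto

lemma pull_mor_minus:
  "\<lbrakk>X' \<in> Ob C; X \<in> Ob C; Y \<in> Ob C; u \<in> el F X Y; a \<in> mor C X' X; b \<in> mor C X' X\<rbrakk>
    \<Longrightarrow> Pull F X' X Y (a \<ominus>\<^bsub>Hom C X' X\<^esub> b) u = Pull F X' X Y a u \<ominus>\<^bsub>Val F X' Y\<^esub> Pull F X' X Y b u"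
  by (rule lin_maps_minus[OF hom_module val_module pull_linear_mor]) auto

lemma val_minus_self: "\<lbrakk>X \<in> Ob C; Y \<in> Ob C; u \<in> el F X Y\<rbrakk> \<Longrightarrow> u \<ominus>\<^bsub>Val F X Y\<^esub> u = \<zero>\<^bsub>Val F X Y\<^esub>"
  by (metis a_minus_def abelian_group.r_neg val_module module_def)

end

section \<open>Transport of structure\<close>

lemma transport_module_simps [simp]:
  "carrier (transport_module i j M) = i ` carrier M"
  "\<zero>\<^bsub>transport_module i j M\<^esub> = i \<zero>\<^bsub>M\<^esub>"
  "u \<oplus>\<^bsub>transport_module i j M\<^esub> v = i (j u \<oplus>\<^bsub>M\<^esub> j v)"
  "r \<odot>\<^bsub>transport_module i j M\<^esub> u = i (r \<odot>\<^bsub>M\<^esub> j u)"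
  by (simp_all add: transport_module_def)

lemma transport_simps [simp]:
  "Val (transport i j F) X Y = transport_module i j (Val F X Y)"
  "Push (transport i j F) X Y Y' a u = i (Push F X Y Y' a (j u))"
  "Pull (transport i j F) X' X Y c u = i (Pull F X' X Y c (j u))"
  by (simp_all add: transport_def)

lemma module_transport:
  assumes M: "module R M" and ji: "\<And>u. j (i u) = u"
  shows "module R (transport_module i j M)"
proof -
  interpret M: module R M by fact
  show ?thesis
  proof (rule moduleI)
    show "cring R" ..
    show "abelian_group (transport_module i j M)"
    proof (rule abelian_groupI)
      fix u assume "u \<in> carrier (transport_module i j M)"
      then obtain v where v: "v \<in> carrier M" "u = i v" by auto
      then show "\<exists>y\<in>carrier (transport_module i j M). y \<oplus>\<^bsub>transport_module i j M\<^esub> u = \<zero>\<^bsub>transport_module i j M\<^esub>"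
        by (intro bexI[of _ "i (\<ominus>\<^bsub>M\<^esub> v)"]) (auto simp: ji M.M.l_neg)
    qed (auto simp: ji M.M.a_ac)
  qed (auto simp: ji M.smult_l_distr M.smult_r_distr M.smult_assoc1)
qed

text \<open>
  A type of elements shared by functors of all degrees is reached by tagging. The following lemmas
  carry linearity and functoriality through the tags.
\<close>

lemma lin_maps_transport:
  assumes "h \<in> lin_maps R M N" and "\<And>u. j (i u) = u" "\<And>u. j' (i' u) = u"
  shows "(\<lambda>u. i' (h (j u))) \<in> lin_maps R (transport_module i j M) (transport_module i' j' N)"
  using assms by (intro lin_mapsI) (auto simp: lin_maps_closed lin_maps_add lin_maps_smult)

lemma lin_maps_transport_right:
  assumes "h \<in> lin_maps R M N" and "\<And>u. j' (i' u) = u"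
  shows "(\<lambda>u. i' (h u)) \<in> lin_maps R M (transport_module i' j' N)"
  using assms by (intro lin_mapsI) (auto simp: lin_maps_closed lin_maps_add lin_maps_smult)

lemma bilinear_functor_transport:
  assumes F: "bilinear_functor R C F" and ji: "\<And>u. j (i u) = u"
  shows "bilinear_functor R C (transport i j F)"
proof -
  interpret bilinear_functor R C F by fact
  show ?thesis
  proof (intro bilinear_functor.intro bilinear_functor_axioms.intro linear_category_axioms)
    fix X Y Y' a assume "X \<in> Ob C" "Y \<in> Ob C" "Y' \<in> Ob C" "a \<in> mor C Y Y'"
    then show "Push (transport i j F) X Y Y' a
        \<in> lin_maps R (Val (transport i j F) X Y) (Val (transport i j F) X Y')"
      using lin_maps_transport[where j=j and i=i and j'=j and i'=i, OF push_linear ji ji] by (simp add: transport_def)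
  next
    fix X' X Y c assume "X' \<in> Ob C" "X \<in> Ob C" "Y \<in> Ob C" "c \<in> mor C X' X"
    then show "Pull (transport i j F) X' X Y c
        \<in> lin_maps R (Val (transport i j F) X Y) (Val (transport i j F) X' Y)"
      using lin_maps_transport[where j=j and i=i and j'=j and i'=i, OF pull_linear ji ji] by (simp add: transport_def)
  next
    fix X Y Y' u assume "X \<in> Ob C" "Y \<in> Ob C" "Y' \<in> Ob C" "u \<in> el (transport i j F) X Y"
    then show "(\<lambda>a. Push (transport i j F) X Y Y' a u)
        \<in> lin_maps R (Hom C Y Y') (Val (transport i j F) X Y')"
      using lin_maps_transport_right[where j'=j and i'=i, OF push_linear_mor ji] by (auto simp: ji)
  next
    fix X' X Y u assume "X' \<in> Ob C" "X \<in> Ob C" "Y \<in> Ob C" "u \<in> el (transport i j F) X Y"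
    then show "(\<lambda>c. Pull (transport i j F) X' X Y c u)
        \<in> lin_maps R (Hom C X' X) (Val (transport i j F) X' Y)"
      using lin_maps_transport_right[where j'=j and i'=i, OF pull_linear_mor ji] by (auto simp: ji)
  qed (auto simp: ji push_id pull_id push_comp pull_comp push_pull val_module module_transport)
qed

section \<open>The coend of two bilinear functors\<close>

text \<open>
  The coefficients, the left factors and the right factors of a formal sum are changed separately; the
  middle object of each term stays.
\<close>

definition fsum_map ::
    "('r \<Rightarrow> 'r) \<Rightarrow> ('o \<Rightarrow> 'x \<Rightarrow> 'y) \<Rightarrow> ('o \<Rightarrow> 'e \<Rightarrow> 'f)
      \<Rightarrow> ('r, 'o, 'x, 'e) formal_sum \<Rightarrow> ('r, 'o, 'y, 'f) formal_sum" where
  "fsum_map sc \<alpha> \<beta> = map (\<lambda>(r, M, \<rho>, \<mu>). (sc r, M, \<alpha> M \<rho>, \<beta> M \<mu>))"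

lemma fsum_map_simps [simp]:
  "fsum_map sc \<alpha> \<beta> [] = []"
  "fsum_map sc \<alpha> \<beta> ((r, M, \<rho>, \<mu>) # xs) = (sc r, M, \<alpha> M \<rho>, \<beta> M \<mu>) # fsum_map sc \<alpha> \<beta> xs"
  "fsum_map sc \<alpha> \<beta> (xs @ ys) = fsum_map sc \<alpha> \<beta> xs @ fsum_map sc \<alpha> \<beta> ys"
  by (simp_all add: fsum_map_def)

lemma fsum_map_fsum_map:
  "fsum_map sc \<alpha> \<beta> (fsum_map sc' \<alpha>' \<beta>' xs)
    = fsum_map (\<lambda>r. sc (sc' r)) (\<lambda>M \<rho>. \<alpha> M (\<alpha>' M \<rho>)) (\<lambda>M \<mu>. \<beta> M (\<beta>' M \<mu>)) xs"
  by (simp add: fsum_map_def case_prod_unfold)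

locale coend_data = F: bilinear_functor R C F + E: bilinear_functor R C E
  for R :: "'r ring" and C :: "('r, 'o, 'm) lincat" and F :: "('r, 'o, 'm, 'x) bifunctor"
    and E :: "('r, 'o, 'm, 'e) bifunctor"
begin

abbreviation FS where "FS \<equiv> formal_sums R C F E"
abbreviation eqv where "eqv \<equiv> coend_eq R C F E"
abbreviation rep where "rep \<equiv> coend_rep R C F E"
abbreviation T where "T \<equiv> coend R C F E"

lemma FS_simps [simp]:
  "[] \<in> FS X Y"
  "(r, M, \<rho>, \<mu>) # xs \<in> FS X Y \<longleftrightarrow>
    r \<in> carrier R \<and> M \<in> Ob C \<and> \<rho> \<in> el F M Y \<and> \<mu> \<in> el E X M \<and> xs \<in> FS X Y"
  "xs @ ys \<in> FS X Y \<longleftrightarrow> xs \<in> FS X Y \<and> ys \<in> FS X Y"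
  by (auto simp: formal_sums_def)

lemma FS_induct [consumes 1, case_names Nil Cons]:
  assumes "xs \<in> FS X Y" "P []"
    and "\<And>r M \<rho> \<mu> xs. \<lbrakk>r \<in> carrier R; M \<in> Ob C; \<rho> \<in> el F M Y; \<mu> \<in> el E X M; xs \<in> FS X Y; P xs\<rbrakk>
      \<Longrightarrow> P ((r, M, \<rho>, \<mu>) # xs)"
  shows "P xs"
  using assms(1)
proof (induction xs)
  case Nil
  show ?case by (rule assms(2))
next
  case (Cons e xs)
  then show ?case using assms(3) by (cases e) auto
qed

lemma eqv_formal:
  assumes "eqv X Y xs ys" "X \<in> Ob C" "Y \<in> Ob C"
  shows "xs \<in> FS X Y \<and> ys \<in> FS X Y"
  using assms(1)
  by induction
    (use assms(2,3) in \<open>simp_all add: F.val_add_closed F.val_smult_closed E.val_add_closed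
      E.val_smult_closed F.pull_closed E.push_closed\<close>)

lemmas eqv_trans [trans] = coend_eq.trans[of R C F E X Y for X Y]
lemmas eqv_refl = coend_eq.refl[of _ R C F E X Y for X Y]
lemmas eqv_sym = coend_eq.sym[of R C F E X Y for X Y]
lemmas eqv_append = coend_eq.append[of R C F E X Y for X Y]

lemma rep_eqv: "xs \<in> FS X Y \<Longrightarrow> eqv X Y (rep X Y xs) xs"
  unfolding coend_rep_def by (rule eqv_sym, rule someI, erule eqv_refl)

lemma rep_cong: "eqv X Y xs ys \<Longrightarrow> rep X Y xs = rep X Y ys"
proof -
  assume "eqv X Y xs ys"
  then have "eqv X Y xs = eqv X Y ys" by (blast intro: eqv_sym eqv_trans)
  then show ?thesis by (simp add: coend_rep_def)
qed

lemma rep_eqD: "\<lbrakk>rep X Y xs = rep X Y ys; xs \<in> FS X Y; ys \<in> FS X Y\<rbrakk> \<Longrightarrow> eqv X Y xs ys"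
  by (metis eqv_sym eqv_trans rep_eqv)

lemma coend_carrier: "el T X Y = rep X Y ` FS X Y"
  by (simp add: coend_def)

lemma coend_zero: "\<zero>\<^bsub>Val T X Y\<^esub> = rep X Y []"
  by (simp add: coend_def)

lemma coend_add:
  "\<lbrakk>xs \<in> FS X Y; ys \<in> FS X Y\<rbrakk>
    \<Longrightarrow> rep X Y xs \<oplus>\<^bsub>Val T X Y\<^esub> rep X Y ys = rep X Y (xs @ ys)"
  by (simp add: coend_def) (intro rep_cong eqv_append rep_eqv)

lemma eqv_commute_middle:
  assumes "xs \<in> FS X Y" "ys \<in> FS X Y" "zs \<in> FS X Y" "ws \<in> FS X Y"
  shows "eqv X Y ((xs @ ys) @ (zs @ ws)) ((xs @ zs) @ (ys @ ws))"
proof -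
  have "eqv X Y (xs @ ((ys @ zs) @ ws)) (xs @ ((zs @ ys) @ ws))"
    using assms by (intro eqv_append coend_eq.comm eqv_refl)
  then show ?thesis by simp
qed

text \<open>
  Additivity of an operation on formal sums has to be checked on single terms only, since the order
  of the terms does not matter up to equivalence.
\<close>

lemma eqv_map_distrib:
  assumes "xs \<in> FS X Y" "X' \<in> Ob C" "Y' \<in> Ob C"
    and "\<And>r M \<rho> \<mu>. \<lbrakk>r \<in> carrier R; M \<in> Ob C; \<rho> \<in> el F M Y; \<mu> \<in> el E X M\<rbrakk>
      \<Longrightarrow> eqv X' Y' [h (r, M, \<rho>, \<mu>)] [f (r, M, \<rho>, \<mu>), g (r, M, \<rho>, \<mu>)]"
  shows "eqv X' Y' (map h xs) (map f xs @ map g xs)"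
  using assms(1)
proof (induction rule: FS_induct)
  case Nil
  show ?case by (simp add: eqv_refl)
next
  case (Cons r M \<rho> \<mu> xs)
  let ?e = "(r, M, \<rho>, \<mu>)"
  have e: "eqv X' Y' [h ?e] [f ?e, g ?e]" using Cons assms(4) by blast
  then have m: "[f ?e] \<in> FS X' Y'" "[g ?e] \<in> FS X' Y'" "map f xs \<in> FS X' Y'" "map g xs \<in> FS X' Y'"
    using eqv_formal[OF Cons.IH] eqv_formal[OF e] assms(2,3)
    by (cases "f ?e"; cases "g ?e"; auto)+
  have "eqv X' Y' ([h ?e] @ map h xs) (([f ?e] @ [g ?e]) @ (map f xs @ map g xs))"
    using eqv_append[OF e Cons.IH] by simp
  also have "eqv X' Y' \<dots> (([f ?e] @ map f xs) @ ([g ?e] @ map g xs))"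
    by (rule eqv_commute_middle[OF m])
  finally show ?case by simp
qed

lemma eqv_map_cong:
  assumes "xs \<in> FS X Y"
    and "\<And>r M \<rho> \<mu>. \<lbrakk>r \<in> carrier R; M \<in> Ob C; \<rho> \<in> el F M Y; \<mu> \<in> el E X M\<rbrakk>
      \<Longrightarrow> eqv X' Y' [h (r, M, \<rho>, \<mu>)] [f (r, M, \<rho>, \<mu>)]"
  shows "eqv X' Y' (map h xs) (map f xs)"
  using assms(1)
proof (induction rule: FS_induct)
  case Nil
  show ?case by (simp add: eqv_refl)
next
  case (Cons r M \<rho> \<mu> xs)
  then have "eqv X' Y' ([h (r, M, \<rho>, \<mu>)] @ map h xs) ([f (r, M, \<rho>, \<mu>)] @ map f xs)"
    by (intro eqv_append assms(2))
  then show ?case by simp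
qed

lemma FS_map_cong:
  assumes "xs \<in> FS X Y"
    and "\<And>r M \<rho> \<mu>. \<lbrakk>r \<in> carrier R; M \<in> Ob C; \<rho> \<in> el F M Y; \<mu> \<in> el E X M\<rbrakk>
      \<Longrightarrow> sc r = sc' r \<and> \<alpha> M \<rho> = \<alpha>' M \<rho> \<and> \<beta> M \<mu> = \<beta>' M \<mu>"
  shows "fsum_map sc \<alpha> \<beta> xs = fsum_map sc' \<alpha>' \<beta>' xs"
  using assms(1) by (induction rule: FS_induct) (use assms(2) in auto)

lemma fsum_map_ident: "fsum_map (\<lambda>r. r) (\<lambda>M \<rho>. \<rho>) (\<lambda>M \<mu>. \<mu>) xs = xs"
  by (simp add: fsum_map_def)

end

text \<open>
  A scalar action on coefficients together with a map natural in the middle object on each tensor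
  factor acts on formal sums and descends to the coend. Scalar multiplication, the two functorial
  actions of a coend and the left cup products from degree two on are of this form, so the relations of the coend are
  checked against it only once.
\<close>

locale coend_map = A: coend_data R C F E + B: coend_data R C F' E'
  for R :: "'r ring" and C :: "('r, 'o, 'm) lincat"
    and F :: "('r, 'o, 'm, 'x) bifunctor" and E :: "('r, 'o, 'm, 'e) bifunctor"
    and F' :: "('r, 'o, 'm, 'y) bifunctor" and E' :: "('r, 'o, 'm, 'f) bifunctor" +
  fixes X Y X' Y' :: 'o and sc :: "'r \<Rightarrow> 'r" and \<alpha> :: "'o \<Rightarrow> 'x \<Rightarrow> 'y" and \<beta> :: "'o \<Rightarrow> 'e \<Rightarrow> 'f"
  assumes objects: "X \<in> Ob C" "Y \<in> Ob C" "X' \<in> Ob C" "Y' \<in> Ob C"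
    and sc_closed: "\<And>r. r \<in> carrier R \<Longrightarrow> sc r \<in> carrier R"
    and sc_add: "\<And>r r'. \<lbrakk>r \<in> carrier R; r' \<in> carrier R\<rbrakk> \<Longrightarrow> sc (r \<oplus>\<^bsub>R\<^esub> r') = sc r \<oplus>\<^bsub>R\<^esub> sc r'"
    and sc_mult: "\<And>r t. \<lbrakk>r \<in> carrier R; t \<in> carrier R\<rbrakk> \<Longrightarrow> sc (t \<otimes>\<^bsub>R\<^esub> r) = t \<otimes>\<^bsub>R\<^esub> sc r"
    and \<alpha>_linear: "\<And>M. M \<in> Ob C \<Longrightarrow> \<alpha> M \<in> lin_maps R (Val F M Y) (Val F' M Y')"
    and \<alpha>_natural: "\<And>M N m \<rho>. \<lbrakk>M \<in> Ob C; N \<in> Ob C; m \<in> mor C M N; \<rho> \<in> el F N Y\<rbrakk>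
      \<Longrightarrow> \<alpha> M (Pull F M N Y m \<rho>) = Pull F' M N Y' m (\<alpha> N \<rho>)"
    and \<beta>_linear: "\<And>M. M \<in> Ob C \<Longrightarrow> \<beta> M \<in> lin_maps R (Val E X M) (Val E' X' M)"
    and \<beta>_natural: "\<And>M N m \<mu>. \<lbrakk>M \<in> Ob C; N \<in> Ob C; m \<in> mor C M N; \<mu> \<in> el E X M\<rbrakk>
      \<Longrightarrow> \<beta> N (Push E X M N m \<mu>) = Push E' X' M N m (\<beta> M \<mu>)"
begin

abbreviation "fm \<equiv> fsum_map sc \<alpha> \<beta>"

lemmas \<alpha>_closed = lin_maps_closed[OF \<alpha>_linear]
lemmas \<beta>_closed = lin_maps_closed[OF \<beta>_linear]

lemma sc_zero: "sc \<zero>\<^bsub>R\<^esub> = \<zero>\<^bsub>R\<^esub>"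
  using sc_mult[of "\<zero>\<^bsub>R\<^esub>" "\<zero>\<^bsub>R\<^esub>"] sc_closed by simp

lemma sc_mult_right: "\<lbrakk>r \<in> carrier R; t \<in> carrier R\<rbrakk> \<Longrightarrow> sc (r \<otimes>\<^bsub>R\<^esub> t) = sc r \<otimes>\<^bsub>R\<^esub> t"
  by (metis A.F.m_comm sc_closed sc_mult)

lemma fm_closed: "xs \<in> A.FS X Y \<Longrightarrow> fm xs \<in> B.FS X' Y'"
  by (induction rule: A.FS_induct) (simp_all add: sc_closed \<alpha>_closed \<beta>_closed)

lemma fm_eqv:
  assumes "A.eqv X Y xs ys"
  shows "B.eqv X' Y' (fm xs) (fm ys)"
  using assms
proof induction
  case (refl xs)
  then show ?case by (intro B.eqv_refl fm_closed)
next
  case (sym xs ys)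
  from sym.IH show ?case by (rule B.eqv_sym)
next
  case (trans xs ys zs)
  from trans.IH show ?case by (rule B.eqv_trans)
next
  case (append xs xs' ys ys')
  then show ?case by (simp add: B.eqv_append)
next
  case (comm xs ys)
  then show ?case by (simp add: coend_eq.comm fm_closed)
next
  case (coeff_zero M \<rho> \<mu>)
  then show ?case by (simp add: sc_zero coend_eq.coeff_zero \<alpha>_closed \<beta>_closed)
next
  case (coeff_add r r' M \<rho> \<mu>)
  then show ?case by (simp add: sc_add coend_eq.coeff_add \<alpha>_closed \<beta>_closed sc_closed)
next
  case (left_add r M \<rho> \<rho>' \<mu>)
  then show ?case
    by (simp add: lin_maps_add[OF \<alpha>_linear] coend_eq.left_add \<alpha>_closed \<beta>_closed sc_closed)
next
  case (right_add r M \<rho> \<mu> \<mu>')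
  then show ?case
    by (simp add: lin_maps_add[OF \<beta>_linear] coend_eq.right_add \<alpha>_closed \<beta>_closed sc_closed)
next
  case (left_smult r t M \<rho> \<mu>)
  then show ?case
    by (simp add: lin_maps_smult[OF \<alpha>_linear] coend_eq.left_smult \<alpha>_closed \<beta>_closed sc_closed
        sc_mult_right)
next
  case (right_smult r t M \<rho> \<mu>)
  then show ?case
    by (simp add: lin_maps_smult[OF \<beta>_linear] coend_eq.right_smult \<alpha>_closed \<beta>_closed sc_closed
        sc_mult_right)
next
  case (dinatural r M N m \<rho> \<mu>)
  then show ?case
    by (simp add: \<alpha>_natural \<beta>_natural coend_eq.dinatural \<alpha>_closed \<beta>_closed sc_closed)
qed

lemma rep_fm_rep: "xs \<in> A.FS X Y \<Longrightarrow> B.rep X' Y' (fm (A.rep X Y xs)) = B.rep X' Y' (fm xs)"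
  by (intro B.rep_cong fm_eqv A.rep_eqv)

end

context coend_data
begin

abbreviation "smul t \<equiv> fsum_map (\<lambda>r. t \<otimes>\<^bsub>R\<^esub> r) (\<lambda>M \<rho>. \<rho>) (\<lambda>M \<mu>. \<mu>)"

lemma coend_map_smul:
  assumes "X \<in> Ob C" "Y \<in> Ob C" "t \<in> carrier R"
  shows "coend_map R C F E F E X Y X Y (\<lambda>r. t \<otimes>\<^bsub>R\<^esub> r) (\<lambda>M \<rho>. \<rho>) (\<lambda>M \<mu>. \<mu>)"
  by (intro coend_map.intro coend_map_axioms.intro coend_data_axioms)
    (use assms in \<open>simp_all add: lin_maps_id F.r_distr F.m_lcomm\<close>)

lemmas smul_closed = coend_map.fm_closed[OF coend_map_smul]

lemma coend_smult:
  assumes "X \<in> Ob C" "Y \<in> Ob C" "t \<in> carrier R" "xs \<in> FS X Y"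
  shows "t \<odot>\<^bsub>Val T X Y\<^esub> rep X Y xs = rep X Y (smul t xs)"
proof -
  interpret coend_map R C F E F E X Y X Y "\<lambda>r. t \<otimes>\<^bsub>R\<^esub> r" "\<lambda>M \<rho>. \<rho>" "\<lambda>M \<mu>. \<mu>"
    using assms by (intro coend_map_smul)
  show ?thesis using rep_fm_rep[OF assms(4)] by (simp add: coend_def fsum_map_def)
qed

text \<open>
  Multiplication by \<open>0\<close> and additivity in the scalar yield additive inverses: \<open>(-1) xs + xs = 0\<close>.
\<close>

lemma smul_zero: "xs \<in> FS X Y \<Longrightarrow> eqv X Y (smul \<zero>\<^bsub>R\<^esub> xs) []"
proof (induction rule: FS_induct)
  case (Cons r M \<rho> \<mu> xs)
  then have "eqv X Y ([(\<zero>\<^bsub>R\<^esub>, M, \<rho>, \<mu>)] @ smul \<zero>\<^bsub>R\<^esub> xs) ([] @ [])"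
    by (intro eqv_append coend_eq.coeff_zero)
  then show ?case using Cons by simp
qed (simp add: eqv_refl)

lemma smul_add:
  assumes "X \<in> Ob C" "Y \<in> Ob C" "a \<in> carrier R" "b \<in> carrier R" "xs \<in> FS X Y"
  shows "eqv X Y (smul (a \<oplus>\<^bsub>R\<^esub> b) xs) (smul a xs @ smul b xs)"
  unfolding fsum_map_def
  by (rule eqv_map_distrib[OF assms(5) assms(1,2)])
    (use assms in \<open>simp add: F.l_distr coend_eq.coeff_add\<close>)

lemma smul_one: "xs \<in> FS X Y \<Longrightarrow> smul \<one>\<^bsub>R\<^esub> xs = xs"
  by (induction rule: FS_induct) simp_all

lemma coend_module:
  assumes X: "X \<in> Ob C" and Y: "Y \<in> Ob C"
  shows "module R (Val T X Y)"
proof (rule moduleI)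
  show "cring R" ..
  show "abelian_group (Val T X Y)"
  proof (rule abelian_groupI)
    show "u \<oplus>\<^bsub>Val T X Y\<^esub> v \<in> el T X Y" if "u \<in> el T X Y" "v \<in> el T X Y" for u v
      using that by (auto simp: coend_carrier coend_add)
    show "\<zero>\<^bsub>Val T X Y\<^esub> \<in> el T X Y" by (simp add: coend_carrier coend_zero)
    show "u \<oplus>\<^bsub>Val T X Y\<^esub> v \<oplus>\<^bsub>Val T X Y\<^esub> w = u \<oplus>\<^bsub>Val T X Y\<^esub> (v \<oplus>\<^bsub>Val T X Y\<^esub> w)"
      if "u \<in> el T X Y" "v \<in> el T X Y" "w \<in> el T X Y" for u v w
      using that by (auto simp: coend_carrier coend_add)
    show "u \<oplus>\<^bsub>Val T X Y\<^esub> v = v \<oplus>\<^bsub>Val T X Y\<^esub> u" if "u \<in> el T X Y" "v \<in> el T X Y" for u v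
      using that by (auto simp: coend_carrier coend_add intro!: rep_cong coend_eq.comm)
    show "\<zero>\<^bsub>Val T X Y\<^esub> \<oplus>\<^bsub>Val T X Y\<^esub> u = u" if "u \<in> el T X Y" for u
      using that by (auto simp: coend_carrier coend_add coend_zero)
    show "\<exists>v\<in>el T X Y. v \<oplus>\<^bsub>Val T X Y\<^esub> u = \<zero>\<^bsub>Val T X Y\<^esub>" if u: "u \<in> el T X Y" for u
    proof -
      obtain xs where xs: "xs \<in> FS X Y" "u = rep X Y xs" using u by (auto simp: coend_carrier)
      let ?n = "\<ominus>\<^bsub>R\<^esub> \<one>\<^bsub>R\<^esub>"
      have n: "smul ?n xs \<in> FS X Y" using X Y xs by (intro smul_closed) auto
      have "eqv X Y (smul (?n \<oplus>\<^bsub>R\<^esub> \<one>\<^bsub>R\<^esub>) xs) (smul ?n xs @ smul \<one>\<^bsub>R\<^esub> xs)"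
        using X Y xs by (intro smul_add) auto
      then have "eqv X Y (smul \<zero>\<^bsub>R\<^esub> xs) (smul ?n xs @ xs)" by (simp add: smul_one[OF xs(1)] F.l_neg)
      then have "eqv X Y (smul ?n xs @ xs) []" by (rule eqv_trans[OF eqv_sym smul_zero[OF xs(1)]])
      then show ?thesis using n xs
        by (intro bexI[of _ "rep X Y (smul ?n xs)"]) (auto simp: coend_add coend_zero coend_carrier rep_cong)
    qed
  qed
  show "t \<odot>\<^bsub>Val T X Y\<^esub> u \<in> el T X Y" if "t \<in> carrier R" "u \<in> el T X Y" for t u
    using that X Y by (auto simp: coend_carrier coend_smult smul_closed)
  show "(a \<oplus>\<^bsub>R\<^esub> b) \<odot>\<^bsub>Val T X Y\<^esub> u = a \<odot>\<^bsub>Val T X Y\<^esub> u \<oplus>\<^bsub>Val T X Y\<^esub> b \<odot>\<^bsub>Val T X Y\<^esub> u"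
    if "a \<in> carrier R" "b \<in> carrier R" "u \<in> el T X Y" for a b u
    using that X Y by (auto simp: coend_carrier coend_smult coend_add smul_closed intro!: rep_cong smul_add)
  show "t \<odot>\<^bsub>Val T X Y\<^esub> (u \<oplus>\<^bsub>Val T X Y\<^esub> v) = t \<odot>\<^bsub>Val T X Y\<^esub> u \<oplus>\<^bsub>Val T X Y\<^esub> t \<odot>\<^bsub>Val T X Y\<^esub> v"
    if "t \<in> carrier R" "u \<in> el T X Y" "v \<in> el T X Y" for t u v
    using that X Y by (auto simp: coend_carrier coend_smult coend_add smul_closed)
  show "(a \<otimes>\<^bsub>R\<^esub> b) \<odot>\<^bsub>Val T X Y\<^esub> u = a \<odot>\<^bsub>Val T X Y\<^esub> (b \<odot>\<^bsub>Val T X Y\<^esub> u)"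
    if ab: "a \<in> carrier R" "b \<in> carrier R" "u \<in> el T X Y" for a b u
  proof -
    obtain xs where xs: "xs \<in> FS X Y" "u = rep X Y xs" using ab by (auto simp: coend_carrier)
    have "smul (a \<otimes>\<^bsub>R\<^esub> b) xs = smul a (smul b xs)"
      unfolding fsum_map_fsum_map by (rule FS_map_cong[OF xs(1)]) (use ab in \<open>simp add: F.m_assoc\<close>)
    then show ?thesis using ab X Y xs by (simp add: coend_smult smul_closed)
  qed
  show "\<one>\<^bsub>R\<^esub> \<odot>\<^bsub>Val T X Y\<^esub> u = u" if "u \<in> el T X Y" for u
    using that X Y by (auto simp: coend_carrier coend_smult smul_one)
qed

end

context coend_map
begin

lemma fm_linear: "(\<lambda>xs. B.rep X' Y' (fm xs)) \<in> lin_maps R (Val A.T X Y) (Val B.T X' Y')"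
proof (rule lin_mapsI)
  fix u assume "u \<in> el A.T X Y"
  then show "B.rep X' Y' (fm u) \<in> el B.T X' Y'"
    by (auto simp: A.coend_carrier B.coend_carrier rep_fm_rep fm_closed)
next
  fix u v assume "u \<in> el A.T X Y" "v \<in> el A.T X Y"
  then show "B.rep X' Y' (fm (u \<oplus>\<^bsub>Val A.T X Y\<^esub> v)) = B.rep X' Y' (fm u) \<oplus>\<^bsub>Val B.T X' Y'\<^esub> B.rep X' Y' (fm v)"
    by (auto simp: A.coend_carrier rep_fm_rep A.coend_add B.coend_add fm_closed)
next
  fix t u assume t: "t \<in> carrier R" and "u \<in> el A.T X Y"
  then obtain xs where xs: "xs \<in> A.FS X Y" "u = A.rep X Y xs" by (auto simp: A.coend_carrier)
  have "fm (A.smul t xs) = B.smul t (fm xs)"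
    unfolding fsum_map_fsum_map by (rule A.FS_map_cong[OF xs(1)]) (use t in \<open>simp add: sc_mult\<close>)
  then show "B.rep X' Y' (fm (t \<odot>\<^bsub>Val A.T X Y\<^esub> u)) = t \<odot>\<^bsub>Val B.T X' Y'\<^esub> B.rep X' Y' (fm u)"
    using t xs objects by (simp add: A.coend_smult B.coend_smult rep_fm_rep A.smul_closed fm_closed)
qed

end

context coend_data
begin

lemma coend_map_push:
  assumes "X \<in> Ob C" "Y \<in> Ob C" "Y' \<in> Ob C" "a \<in> mor C Y Y'"
  shows "coend_map R C F E F E X Y X Y' (\<lambda>r. r) (\<lambda>M \<rho>. Push F M Y Y' a \<rho>) (\<lambda>M \<mu>. \<mu>)"
  by (intro coend_map.intro coend_map_axioms.intro coend_data_axioms)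
    (use assms in \<open>simp_all add: lin_maps_id F.push_linear F.push_pull\<close>)

lemma coend_map_pull:
  assumes "X' \<in> Ob C" "X \<in> Ob C" "Y \<in> Ob C" "c \<in> mor C X' X"
  shows "coend_map R C F E F E X Y X' Y (\<lambda>r. r) (\<lambda>M \<rho>. \<rho>) (\<lambda>M \<mu>. Pull E X' X M c \<mu>)"
  by (intro coend_map.intro coend_map_axioms.intro coend_data_axioms)
    (use assms in \<open>simp_all add: lin_maps_id E.pull_linear E.push_pull\<close>)

lemma coend_push: "Push T X Y Y' a xs = rep X Y' (fsum_map (\<lambda>r. r) (\<lambda>M \<rho>. Push F M Y Y' a \<rho>) (\<lambda>M \<mu>. \<mu>) xs)"
  by (simp add: coend_def fsum_map_def)

lemma coend_pull: "Pull T X' X Y c xs = rep X' Y (fsum_map (\<lambda>r. r) (\<lambda>M \<rho>. \<rho>) (\<lambda>M \<mu>. Pull E X' X M c \<mu>) xs)"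
  by (simp add: coend_def fsum_map_def)

lemmas push_fm_closed = coend_map.fm_closed[OF coend_map_push]
lemmas pull_fm_closed = coend_map.fm_closed[OF coend_map_pull]

lemma coend_push_rep:
  assumes "X \<in> Ob C" "Y \<in> Ob C" "Y' \<in> Ob C" "a \<in> mor C Y Y'" "xs \<in> FS X Y"
  shows "Push T X Y Y' a (rep X Y xs) = rep X Y' (fsum_map (\<lambda>r. r) (\<lambda>M \<rho>. Push F M Y Y' a \<rho>) (\<lambda>M \<mu>. \<mu>) xs)"
  unfolding coend_push using assms by (intro coend_map.rep_fm_rep[OF coend_map_push])

lemma coend_pull_rep:
  assumes "X' \<in> Ob C" "X \<in> Ob C" "Y \<in> Ob C" "c \<in> mor C X' X" "xs \<in> FS X Y"
  shows "Pull T X' X Y c (rep X Y xs) = rep X' Y (fsum_map (\<lambda>r. r) (\<lambda>M \<rho>. \<rho>) (\<lambda>M \<mu>. Pull E X' X M c \<mu>) xs)"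
  unfolding coend_pull using assms by (intro coend_map.rep_fm_rep[OF coend_map_pull])

theorem bilinear_functor_coend: "bilinear_functor R C T"
proof (intro bilinear_functor.intro bilinear_functor_axioms.intro F.linear_category_axioms coend_module)
  fix X Y Y' a assume "X \<in> Ob C" "Y \<in> Ob C" "Y' \<in> Ob C" "a \<in> mor C Y Y'"
  then show "Push T X Y Y' a \<in> lin_maps R (Val T X Y) (Val T X Y')"
    unfolding coend_push[abs_def] by (intro coend_map.fm_linear[OF coend_map_push])
next
  fix X' X Y c assume "X' \<in> Ob C" "X \<in> Ob C" "Y \<in> Ob C" "c \<in> mor C X' X"
  then show "Pull T X' X Y c \<in> lin_maps R (Val T X Y) (Val T X' Y)"
    unfolding coend_pull[abs_def] by (intro coend_map.fm_linear[OF coend_map_pull])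
next
  fix X Y Y' u assume ob: "X \<in> Ob C" "Y \<in> Ob C" "Y' \<in> Ob C" and "u \<in> el T X Y"
  then obtain xs where xs: "xs \<in> FS X Y" "u = rep X Y xs" by (auto simp: coend_carrier)
  let ?p = "\<lambda>a. fsum_map (\<lambda>r. r) (\<lambda>M \<rho>. Push F M Y Y' a \<rho>) (\<lambda>M \<mu>. \<mu>) xs"
  show "(\<lambda>a. Push T X Y Y' a u) \<in> lin_maps R (Hom C Y Y') (Val T X Y')"
  proof (rule lin_mapsI)
    show "Push T X Y Y' a u \<in> el T X Y'" if "a \<in> mor C Y Y'" for a
      using that ob xs by (auto simp: coend_push_rep coend_carrier push_fm_closed)
    show "Push T X Y Y' (a \<oplus>\<^bsub>Hom C Y Y'\<^esub> b) u = Push T X Y Y' a u \<oplus>\<^bsub>Val T X Y'\<^esub> Push T X Y Y' b u"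
      if ab: "a \<in> mor C Y Y'" "b \<in> mor C Y Y'" for a b
    proof -
      have "eqv X Y' (?p (a \<oplus>\<^bsub>Hom C Y Y'\<^esub> b)) (?p a @ ?p b)"
        unfolding fsum_map_def
        by (rule eqv_map_distrib[OF xs(1) ob(1,3)])
          (use ob ab in \<open>simp add: F.push_mor_add coend_eq.left_add F.push_closed\<close>)
      then show ?thesis using ab ob xs
        by (simp add: coend_push_rep coend_add push_fm_closed rep_cong module_add_closed[OF F.hom_module])
    qed
    show "Push T X Y Y' (t \<odot>\<^bsub>Hom C Y Y'\<^esub> a) u = t \<odot>\<^bsub>Val T X Y'\<^esub> Push T X Y Y' a u"
      if ta: "t \<in> carrier R" "a \<in> mor C Y Y'" for t a
    proof -
      have "eqv X Y' (?p (t \<odot>\<^bsub>Hom C Y Y'\<^esub> a)) (smul t (?p a))"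
        unfolding fsum_map_fsum_map unfolding fsum_map_def
        by (rule eqv_map_cong[OF xs(1)])
          (use ob ta in \<open>simp add: F.push_mor_smult F.m_comm[of t] coend_eq.left_smult F.push_closed\<close>)
      then show ?thesis using ta ob xs
        by (simp add: coend_push_rep coend_smult push_fm_closed rep_cong module_smult_closed[OF F.hom_module])
    qed
  qed
next
  fix X' X Y u assume ob: "X' \<in> Ob C" "X \<in> Ob C" "Y \<in> Ob C" and "u \<in> el T X Y"
  then obtain xs where xs: "xs \<in> FS X Y" "u = rep X Y xs" by (auto simp: coend_carrier)
  let ?p = "\<lambda>c. fsum_map (\<lambda>r. r) (\<lambda>M \<rho>. \<rho>) (\<lambda>M \<mu>. Pull E X' X M c \<mu>) xs"
  show "(\<lambda>c. Pull T X' X Y c u) \<in> lin_maps R (Hom C X' X) (Val T X' Y)"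
  proof (rule lin_mapsI)
    show "Pull T X' X Y a u \<in> el T X' Y" if "a \<in> mor C X' X" for a
      using that ob xs by (auto simp: coend_pull_rep coend_carrier pull_fm_closed)
    show "Pull T X' X Y (a \<oplus>\<^bsub>Hom C X' X\<^esub> b) u = Pull T X' X Y a u \<oplus>\<^bsub>Val T X' Y\<^esub> Pull T X' X Y b u"
      if ab: "a \<in> mor C X' X" "b \<in> mor C X' X" for a b
    proof -
      have "eqv X' Y (?p (a \<oplus>\<^bsub>Hom C X' X\<^esub> b)) (?p a @ ?p b)"
        unfolding fsum_map_def
        by (rule eqv_map_distrib[OF xs(1) ob(1,3)])
          (use ob ab in \<open>simp add: E.pull_mor_add coend_eq.right_add E.pull_closed\<close>)
      then show ?thesis using ab ob xs
        by (simp add: coend_pull_rep coend_add pull_fm_closed rep_cong module_add_closed[OF F.hom_module])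
    qed
    show "Pull T X' X Y (t \<odot>\<^bsub>Hom C X' X\<^esub> a) u = t \<odot>\<^bsub>Val T X' Y\<^esub> Pull T X' X Y a u"
      if ta: "t \<in> carrier R" "a \<in> mor C X' X" for t a
    proof -
      have "eqv X' Y (?p (t \<odot>\<^bsub>Hom C X' X\<^esub> a)) (smul t (?p a))"
        unfolding fsum_map_fsum_map unfolding fsum_map_def
        by (rule eqv_map_cong[OF xs(1)])
          (use ob ta in \<open>simp add: E.pull_mor_smult F.m_comm[of t] coend_eq.right_smult E.pull_closed\<close>)
      then show ?thesis using ta ob xs
        by (simp add: coend_pull_rep coend_smult pull_fm_closed rep_cong module_smult_closed[OF F.hom_module])
    qed
  qed
next
  fix X Y u assume ob: "X \<in> Ob C" "Y \<in> Ob C" and "u \<in> el T X Y"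
  then obtain xs where xs: "xs \<in> FS X Y" "u = rep X Y xs" by (auto simp: coend_carrier)
  have "fsum_map (\<lambda>r. r) (\<lambda>M \<rho>. Push F M Y Y (Idm C Y) \<rho>) (\<lambda>M \<mu>. \<mu>) xs
      = fsum_map (\<lambda>r. r) (\<lambda>M \<rho>. \<rho>) (\<lambda>M \<mu>. \<mu>) xs"
    by (rule FS_map_cong[OF xs(1)]) (use ob in \<open>simp add: F.push_id\<close>)
  then show "Push T X Y Y (Idm C Y) u = u"
    using ob xs by (simp add: coend_push_rep F.id_mor fsum_map_ident)
  have "fsum_map (\<lambda>r. r) (\<lambda>M \<rho>. \<rho>) (\<lambda>M \<mu>. Pull E X X M (Idm C X) \<mu>) xs
      = fsum_map (\<lambda>r. r) (\<lambda>M \<rho>. \<rho>) (\<lambda>M \<mu>. \<mu>) xs"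
    by (rule FS_map_cong[OF xs(1)]) (use ob in \<open>simp add: E.pull_id\<close>)
  then show "Pull T X X Y (Idm C X) u = u"
    using ob xs by (simp add: coend_pull_rep F.id_mor fsum_map_ident)
next
  fix X Y Y' Y'' a a' u
  assume ob: "X \<in> Ob C" "Y \<in> Ob C" "Y' \<in> Ob C" "Y'' \<in> Ob C"
    and a: "a \<in> mor C Y Y'" "a' \<in> mor C Y' Y''" and "u \<in> el T X Y"
  then obtain xs where xs: "xs \<in> FS X Y" "u = rep X Y xs" by (auto simp: coend_carrier)
  have "fsum_map (\<lambda>r. r) (\<lambda>M \<rho>. Push F M Y Y'' (Cmp C Y Y' Y'' a' a) \<rho>) (\<lambda>M \<mu>. \<mu>) xs
      = fsum_map (\<lambda>r. r) (\<lambda>M \<rho>. Push F M Y' Y'' a' (Push F M Y Y' a \<rho>)) (\<lambda>M \<mu>. \<mu>) xs"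
    by (rule FS_map_cong[OF xs(1)]) (use ob a in \<open>simp add: F.push_comp\<close>)
  then show "Push T X Y Y'' (Cmp C Y Y' Y'' a' a) u = Push T X Y' Y'' a' (Push T X Y Y' a u)"
    using ob xs a by (simp add: coend_push_rep F.comp_closed push_fm_closed fsum_map_fsum_map)
next
  fix X'' X' X Y c' c u
  assume ob: "X'' \<in> Ob C" "X' \<in> Ob C" "X \<in> Ob C" "Y \<in> Ob C"
    and a: "c' \<in> mor C X'' X'" "c \<in> mor C X' X" and "u \<in> el T X Y"
  then obtain xs where xs: "xs \<in> FS X Y" "u = rep X Y xs" by (auto simp: coend_carrier)
  have "fsum_map (\<lambda>r. r) (\<lambda>M \<rho>. \<rho>) (\<lambda>M \<mu>. Pull E X'' X M (Cmp C X'' X' X c c') \<mu>) xs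
      = fsum_map (\<lambda>r. r) (\<lambda>M \<rho>. \<rho>) (\<lambda>M \<mu>. Pull E X'' X' M c' (Pull E X' X M c \<mu>)) xs"
    by (rule FS_map_cong[OF xs(1)]) (use ob a in \<open>simp add: E.pull_comp\<close>)
  then show "Pull T X'' X Y (Cmp C X'' X' X c c') u = Pull T X'' X' Y c' (Pull T X' X Y c u)"
    using ob xs a by (simp add: coend_pull_rep F.comp_closed pull_fm_closed fsum_map_fsum_map)
next
  fix X' X Y Y' c a u
  assume ob: "X' \<in> Ob C" "X \<in> Ob C" "Y \<in> Ob C" "Y' \<in> Ob C"
    and a: "c \<in> mor C X' X" "a \<in> mor C Y Y'" and "u \<in> el T X Y"
  then obtain xs where xs: "xs \<in> FS X Y" "u = rep X Y xs" by (auto simp: coend_carrier)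
  show "Push T X' Y Y' a (Pull T X' X Y c u) = Pull T X' X Y' c (Push T X Y Y' a u)"
    using ob xs a
    by (simp add: coend_push_rep coend_pull_rep push_fm_closed pull_fm_closed fsum_map_fsum_map)
qed

end

section \<open>The universal property of the coend\<close>

definition coend_eval ::
    "('r, 'y) module \<Rightarrow> ('o \<Rightarrow> 'x \<Rightarrow> 'e \<Rightarrow> 'y) \<Rightarrow> ('r, 'o, 'x, 'e) formal_sum \<Rightarrow> 'y" where
  "coend_eval N h xs = foldr (\<lambda>(r, M, \<rho>, \<mu>) u. r \<odot>\<^bsub>N\<^esub> h M \<rho> \<mu> \<oplus>\<^bsub>N\<^esub> u) xs \<zero>\<^bsub>N\<^esub>"

lemma coend_eval_simps [simp]:
  "coend_eval N h [] = \<zero>\<^bsub>N\<^esub>"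
  "coend_eval N h ((r, M, \<rho>, \<mu>) # xs) = r \<odot>\<^bsub>N\<^esub> h M \<rho> \<mu> \<oplus>\<^bsub>N\<^esub> coend_eval N h xs"
  by (simp_all add: coend_eval_def)

context coend_data
begin

text \<open>
  A bilinear dinatural family into a module factors through the coend. It is the tool by which formal
  sums are shown to be inequivalent.
\<close>

lemma coend_eval_eqv:
  assumes N: "module R N" and ob: "X \<in> Ob C" "Y \<in> Ob C"
    and left: "\<And>M \<mu>. \<lbrakk>M \<in> Ob C; \<mu> \<in> el E X M\<rbrakk> \<Longrightarrow> (\<lambda>\<rho>. h M \<rho> \<mu>) \<in> lin_maps R (Val F M Y) N"
    and right: "\<And>M \<rho>. \<lbrakk>M \<in> Ob C; \<rho> \<in> el F M Y\<rbrakk> \<Longrightarrow> h M \<rho> \<in> lin_maps R (Val E X M) N"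
    and dinat: "\<And>M M' m \<rho> \<mu>. \<lbrakk>M \<in> Ob C; M' \<in> Ob C; m \<in> mor C M M'; \<rho> \<in> el F M' Y; \<mu> \<in> el E X M\<rbrakk>
      \<Longrightarrow> h M (Pull F M M' Y m \<rho>) \<mu> = h M' \<rho> (Push E X M M' m \<mu>)"
    and eq: "eqv X Y xs ys"
  shows "coend_eval N h xs = coend_eval N h ys"
proof -
  interpret N: module R N by fact
  have h: "h M \<rho> \<mu> \<in> carrier N" if "M \<in> Ob C" "\<rho> \<in> el F M Y" "\<mu> \<in> el E X M" for M \<rho> \<mu>
    using right that lin_maps_closed by metis
  have cl: "coend_eval N h xs \<in> carrier N" if "xs \<in> FS X Y" for xs
    using that by (induction rule: FS_induct) (simp_all add: h)
  have app: "coend_eval N h (xs @ ys) = coend_eval N h xs \<oplus>\<^bsub>N\<^esub> coend_eval N h ys"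
    if "xs \<in> FS X Y" "ys \<in> FS X Y" for xs ys
    using that by (induction rule: FS_induct) (simp_all add: h cl N.M.a_assoc)
  show ?thesis using eq
  proof induction
    case (append xs xs' ys ys')
    then show ?case using app eqv_formal ob by metis
  next
    case (comm xs ys)
    then show ?case using app cl N.M.a_comm by metis
  next
    case (coeff_add r r' M \<rho> \<mu>)
    then show ?case by (simp add: h N.smult_l_distr N.M.a_assoc)
  next
    case (left_add r M \<rho> \<rho>' \<mu>)
    then show ?case
      by (simp add: h lin_maps_add[OF left] F.val_add_closed ob N.smult_r_distr N.M.a_assoc)
  next
    case (right_add r M \<rho> \<mu> \<mu>')
    then show ?case
      by (simp add: h lin_maps_add[OF right] E.val_add_closed ob N.smult_r_distr N.M.a_assoc)
  next
    case (left_smult r t M \<rho> \<mu>)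
    then show ?case by (simp add: h lin_maps_smult[OF left] N.smult_assoc1)
  next
    case (right_smult r t M \<rho> \<mu>)
    then show ?case by (simp add: h lin_maps_smult[OF right] N.smult_assoc1)
  next
    case (dinatural r M N m \<rho> \<mu>)
    then show ?case by (simp add: dinat)
  qed (simp_all add: h)
qed

end

section \<open>Positive extensions and cup products\<close>

locale ext_data = E: bilinear_functor R C E
  for R :: "'r ring" and C :: "('r, 'o, 'm) lincat" and E :: "('r, 'o, 'm, 'e) bifunctor"
begin

abbreviation EE where "EE \<equiv> Epos R C E"

text \<open>
  Iterating the coend stays within bilinear functors, so every general law applies to all degrees.
\<close>

lemma bilinear_functor_Epos: "bilinear_functor R C (EE n)"
proof (induction n)
  case 0
  show ?case by (simp add: bilinear_functor_transport E.bilinear_functor_hom)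
next
  case (Suc n)
  then interpret coend_data R C "EE n" E
    by (intro coend_data.intro E.bilinear_functor_axioms)
  show ?case
    using bilinear_functor_coend
    by (cases n) (simp_all add: bilinear_functor_transport E.bilinear_functor_axioms)
qed

end

sublocale ext_data \<subseteq> P: bilinear_functor R C "Epos R C E n" for n
  by (rule bilinear_functor_Epos)

sublocale ext_data \<subseteq> Q: coend_data R C "Epos R C E n" E for n
  by (intro coend_data.intro bilinear_functor_Epos E.bilinear_functor_axioms)

context ext_data
begin

abbreviation cls where "cls n X Y xs \<equiv> Cls (coend_rep R C (Epos R C E n) E X Y xs)"

lemma el_Epos:
  "el (EE 0) X Y = Mor ` mor C X Y"
  "el (EE (Suc 0)) X Y = Ext ` el E X Y"
  "el (EE (Suc (Suc n))) X Y = cls (Suc n) X Y ` Q.FS (Suc n) X Y"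
  by (auto simp: Q.coend_carrier)

lemma Epos_push_simps [simp]:
  "Push (EE 0) X Y Y' a (Mor f) = Mor (Cmp C X Y Y' a f)"
  "Push (EE (Suc 0)) X Y Y' a (Ext \<epsilon>) = Ext (Push E X Y Y' a \<epsilon>)"
  by simp_all

lemma Epos_pull_simps [simp]:
  "Pull (EE 0) X' X Y c (Mor f) = Mor (Cmp C X' X Y f c)"
  "Pull (EE (Suc 0)) X' X Y c (Ext \<epsilon>) = Ext (Pull E X' X Y c \<epsilon>)"
  by simp_all

lemma Epos_push_QR:
  assumes "X \<in> Ob C" "Y \<in> Ob C" "Y' \<in> Ob C" "a \<in> mor C Y Y'" "xs \<in> Q.FS (Suc n) X Y"
  shows "Push (EE (Suc (Suc n))) X Y Y' a (cls (Suc n) X Y xs)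
    = cls (Suc n) X Y' (fsum_map (\<lambda>r. r) (\<lambda>M \<rho>. Push (EE (Suc n)) M Y Y' a \<rho>) (\<lambda>M \<mu>. \<mu>) xs)"
  using Q.coend_push_rep[OF assms] by simp

lemma Epos_pull_QR:
  assumes "X' \<in> Ob C" "X \<in> Ob C" "Y \<in> Ob C" "c \<in> mor C X' X" "xs \<in> Q.FS (Suc n) X Y"
  shows "Pull (EE (Suc (Suc n))) X' X Y c (cls (Suc n) X Y xs)
    = cls (Suc n) X' Y (fsum_map (\<lambda>r. r) (\<lambda>M \<rho>. \<rho>) (\<lambda>M \<mu>. Pull E X' X M c \<mu>) xs)"
  using Q.coend_pull_rep[OF assms] by simp

text \<open>
  From here on an extension functor is known through these laws; unfolding its recursion would only
  expose the coends again.
\<close>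

declare Epos.simps [simp del] cup_left.simps(3) [simp del]

lemma Epos_el_iff [simp]:
  "Mor f \<in> el (EE 0) X Y \<longleftrightarrow> f \<in> mor C X Y"
  "Ext \<epsilon> \<in> el (EE (Suc 0)) X Y \<longleftrightarrow> \<epsilon> \<in> el E X Y"
  by (auto simp: el_Epos)

lemma nat_cases_012:
  fixes n :: nat
  obtains "n = 0" | "n = Suc 0" | m where "n = Suc (Suc m)"
  by (metis old.nat.exhaust)

lemma cup_right_linear:
  assumes ob: "D \<in> Ob C" "A \<in> Ob C" "Y \<in> Ob C" and d: "\<delta> \<in> el E D A"
  shows "cup_right R C E n D A Y \<delta> \<in> lin_maps R (Val (EE n) A Y) (Val (EE (Suc n)) D Y)"
proof (cases n)
  case 0
  have "cup_right R C E 0 D A Y \<delta> = (\<lambda>u. Ext (Push E D A Y (the_mor u) \<delta>))" by auto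
  moreover have "(\<lambda>u. Ext (Push E D A Y (the_mor u) \<delta>))
      \<in> lin_maps R (transport_module Mor the_mor (Hom C A Y)) (transport_module Ext the_ext (Val E D Y))"
    by (rule lin_maps_transport[OF E.push_linear_mor]) (use ob d in auto)
  ultimately show ?thesis using 0 by (simp add: Epos.simps)
next
  case (Suc m)
  have "cup_right R C E n D A Y \<delta> = (\<lambda>u. Cls (coend_rep R C (EE n) E D Y [(\<one>\<^bsub>R\<^esub>, A, u, \<delta>)]))"
    using Suc by auto
  moreover have "(\<lambda>u. coend_rep R C (EE n) E D Y [(\<one>\<^bsub>R\<^esub>, A, u, \<delta>)])
      \<in> lin_maps R (Val (EE n) A Y) (Val (coend R C (EE n) E) D Y)"
  proof (rule lin_mapsI)
    fix u v assume uv: "u \<in> el (EE n) A Y" "v \<in> el (EE n) A Y"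
    have "coend_eq R C (EE n) E D Y [(\<one>\<^bsub>R\<^esub>, A, u \<oplus>\<^bsub>Val (EE n) A Y\<^esub> v, \<delta>)] [(\<one>\<^bsub>R\<^esub>, A, u, \<delta>), (\<one>\<^bsub>R\<^esub>, A, v, \<delta>)]"
      by (rule coend_eq.left_add) (use uv ob d in auto)
    from Q.rep_cong[OF this] show "coend_rep R C (EE n) E D Y [(\<one>\<^bsub>R\<^esub>, A, u \<oplus>\<^bsub>Val (EE n) A Y\<^esub> v, \<delta>)] =
       coend_rep R C (EE n) E D Y [(\<one>\<^bsub>R\<^esub>, A, u, \<delta>)] \<oplus>\<^bsub>Val (coend R C (EE n) E) D Y\<^esub>
       coend_rep R C (EE n) E D Y [(\<one>\<^bsub>R\<^esub>, A, v, \<delta>)]"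
      by (subst Q.coend_add) (use uv ob d in auto)
  next
    fix t u assume tu: "t \<in> carrier R" "u \<in> el (EE n) A Y"
    have "coend_eq R C (EE n) E D Y [(\<one>\<^bsub>R\<^esub>, A, t \<odot>\<^bsub>Val (EE n) A Y\<^esub> u, \<delta>)] [(\<one>\<^bsub>R\<^esub> \<otimes>\<^bsub>R\<^esub> t, A, u, \<delta>)]"
      by (rule coend_eq.left_smult) (use tu ob d in auto)
    from Q.rep_cong[OF this] show "coend_rep R C (EE n) E D Y [(\<one>\<^bsub>R\<^esub>, A, t \<odot>\<^bsub>Val (EE n) A Y\<^esub> u, \<delta>)] =
       t \<odot>\<^bsub>Val (coend R C (EE n) E) D Y\<^esub> coend_rep R C (EE n) E D Y [(\<one>\<^bsub>R\<^esub>, A, u, \<delta>)]"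
      by (subst Q.coend_smult) (use tu ob d in \<open>auto\<close>)
  qed (use ob d in \<open>auto simp: Q.coend_carrier\<close>)
  ultimately show ?thesis
    using lin_maps_transport_right[where i'=Cls and j'=the_cls] Suc by (simp add: Epos.simps)
qed

lemmas cup_right_closed = lin_maps_closed[OF cup_right_linear]

lemma cup_right_push:
  assumes ob: "D \<in> Ob C" "A \<in> Ob C" "Y \<in> Ob C" "Y' \<in> Ob C" and d: "\<delta> \<in> el E D A"
    and a: "a \<in> mor C Y Y'" and u: "u \<in> el (EE n) A Y"
  shows "cup_right R C E n D A Y' \<delta> (Push (EE n) A Y Y' a u) = Push (EE (Suc n)) D Y Y' a (cup_right R C E n D A Y \<delta> u)"
proof (cases n)
  case 0
  then show ?thesis using assms by (auto simp: el_Epos E.push_comp)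
next
  case (Suc m)
  then show ?thesis using assms by (simp add: Epos_push_QR)
qed

text \<open>
  This is the dinatural relation of the coend, read as \<open>\<mu> \<union> b\<^sub>*\<delta> = b\<^sup>*\<mu> \<union> \<delta>\<close>.
\<close>

lemma cup_right_push_ext:
  assumes ob: "D \<in> Ob C" "A \<in> Ob C" "A' \<in> Ob C" "Y \<in> Ob C" and d: "\<delta> \<in> el E D A"
    and b: "b \<in> mor C A A'" and u: "u \<in> el (EE n) A' Y"
  shows "cup_right R C E n D A' Y (Push E D A A' b \<delta>) u = cup_right R C E n D A Y \<delta> (Pull (EE n) A A' Y b u)"
proof (cases n)
  case 0
  then show ?thesis using assms by (auto simp: el_Epos E.push_comp)
next
  case (Suc m)
  have "coend_eq R C (EE n) E D Y [(\<one>\<^bsub>R\<^esub>, A, Pull (EE n) A A' Y b u, \<delta>)] [(\<one>\<^bsub>R\<^esub>, A', u, Push E D A A' b \<delta>)]"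
    by (rule coend_eq.dinatural) (use assms in auto)
  from Q.rep_cong[OF this] show ?thesis using Suc by simp
qed

lemma cup_right_pull_ext:
  assumes ob: "D' \<in> Ob C" "D \<in> Ob C" "A \<in> Ob C" "Y \<in> Ob C" and d: "\<delta> \<in> el E D A"
    and c: "c \<in> mor C D' D" and u: "u \<in> el (EE n) A Y"
  shows "cup_right R C E n D' A Y (Pull E D' D A c \<delta>) u = Pull (EE (Suc n)) D' D Y c (cup_right R C E n D A Y \<delta> u)"
proof (cases n)
  case 0
  then show ?thesis using assms by (auto simp: el_Epos E.push_pull)
next
  case (Suc m)
  then show ?thesis using assms by (simp add: Epos_pull_QR)
qed

lemma cup_left_Suc_Suc:
  "cup_left R C E (Suc (Suc n)) X D A \<delta> u =
     Cls (coend_rep R C (EE (Suc (Suc n))) E X A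
       (fsum_map (\<lambda>r. r) (\<lambda>M. cup_left R C E (Suc n) M D A \<delta>) (\<lambda>M \<mu>. \<mu>) (the_cls u)))"
  by (simp add: fsum_map_def cup_left.simps(3))

text \<open>
  From degree two on, a left cup product is the map of coends induced by the left cup product one
  degree lower; linearity and naturality must therefore be proved together.
\<close>

lemma cup_left_linear_natural:
  assumes d: "D \<in> Ob C" "A \<in> Ob C" "\<delta> \<in> el E D A"
  shows "(\<forall>X\<in>Ob C. cup_left R C E n X D A \<delta> \<in> lin_maps R (Val (EE n) X D) (Val (EE (Suc n)) X A)) \<and>
    (\<forall>X'\<in>Ob C. \<forall>X\<in>Ob C. \<forall>c\<in>mor C X' X. \<forall>u\<in>el (EE n) X D.
      cup_left R C E n X' D A \<delta> (Pull (EE n) X' X D c u)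
        = Pull (EE (Suc n)) X' X A c (cup_left R C E n X D A \<delta> u))"
proof (induction n rule: less_induct)
  case (less n)
  show ?case
  proof (cases n rule: nat_cases_012)
    case 1
    have e: "cup_left R C E 0 X D A \<delta> = (\<lambda>u. Ext (Pull E X D A (the_mor u) \<delta>))" for X by auto
    have "(\<lambda>u. Ext (Pull E X D A (the_mor u) \<delta>))
        \<in> lin_maps R (transport_module Mor the_mor (Hom C X D)) (transport_module Ext the_ext (Val E X A))"
      if "X \<in> Ob C" for X
      by (rule lin_maps_transport[OF E.pull_linear_mor]) (use that d in auto)
    then show ?thesis using 1 d by (simp add: e) (auto simp: E.pull_comp Epos.simps)
  next
    case 2
    have e: "cup_left R C E (Suc 0) X D A \<delta> = (\<lambda>u. Cls (coend_rep R C (EE (Suc 0)) E X A [(\<one>\<^bsub>R\<^esub>, D, Ext \<delta>, the_ext u)]))" for X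
      by auto
    let ?h = "\<lambda>X \<epsilon>. coend_rep R C (EE (Suc 0)) E X A [(\<one>\<^bsub>R\<^esub>, D, Ext \<delta>, \<epsilon>)]"
    have dd: "Ext \<delta> \<in> el (EE (Suc 0)) D A" using d by simp
    have l: "?h X \<in> lin_maps R (Val E X D) (Val (coend R C (EE (Suc 0)) E) X A)" if X: "X \<in> Ob C" for X
    proof (rule lin_mapsI)
      fix u v assume uv: "u \<in> el E X D" "v \<in> el E X D"
      have "coend_eq R C (EE (Suc 0)) E X A [(\<one>\<^bsub>R\<^esub>, D, Ext \<delta>, u \<oplus>\<^bsub>Val E X D\<^esub> v)] [(\<one>\<^bsub>R\<^esub>, D, Ext \<delta>, u), (\<one>\<^bsub>R\<^esub>, D, Ext \<delta>, v)]"
        by (rule coend_eq.right_add) (use uv X d in auto)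
      from Q.rep_cong[OF this] show "?h X (u \<oplus>\<^bsub>Val E X D\<^esub> v) = ?h X u \<oplus>\<^bsub>Val (coend R C (EE (Suc 0)) E) X A\<^esub> ?h X v"
        by (subst Q.coend_add) (use uv X d in auto)
    next
      fix t u assume tu: "t \<in> carrier R" "u \<in> el E X D"
      have "coend_eq R C (EE (Suc 0)) E X A [(\<one>\<^bsub>R\<^esub>, D, Ext \<delta>, t \<odot>\<^bsub>Val E X D\<^esub> u)] [(\<one>\<^bsub>R\<^esub> \<otimes>\<^bsub>R\<^esub> t, D, Ext \<delta>, u)]"
        by (rule coend_eq.right_smult) (use tu X d in auto)
      from Q.rep_cong[OF this] show "?h X (t \<odot>\<^bsub>Val E X D\<^esub> u) = t \<odot>\<^bsub>Val (coend R C (EE (Suc 0)) E) X A\<^esub> ?h X u"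
        by (subst Q.coend_smult) (use tu X d in auto)
    qed (use X d dd in \<open>auto simp: Q.coend_carrier \<close>)
    have "(\<lambda>u. Cls (?h X (the_ext u))) \<in> lin_maps R (Val (EE (Suc 0)) X D) (Val (EE (Suc (Suc 0))) X A)"
      if "X \<in> Ob C" for X
      using lin_maps_transport[where i=Ext and j=the_ext and i'=Cls and j'=the_cls, OF l[OF that]]
      by (simp add: Epos.simps)
    moreover have "cls (Suc 0) X' A [(\<one>\<^bsub>R\<^esub>, D, Ext \<delta>, Pull E X' X D c \<epsilon>)]
        = Pull (EE (Suc (Suc 0))) X' X A c (cls (Suc 0) X A [(\<one>\<^bsub>R\<^esub>, D, Ext \<delta>, \<epsilon>)])"
      if "X' \<in> Ob C" "X \<in> Ob C" "c \<in> mor C X' X" "\<epsilon> \<in> el E X D" for X' X c \<epsilon>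
      by (subst Epos_pull_QR) (use that d dd in simp_all)
    ultimately show ?thesis using 2 d by (auto simp: e el_Epos)
  next
    case (3 m)
    have IH: "cup_left R C E (Suc m) X D A \<delta> \<in> lin_maps R (Val (EE (Suc m)) X D) (Val (EE (Suc (Suc m))) X A)"
      if "X \<in> Ob C" for X using less[of "Suc m"] 3 that by blast
    have IHn: "cup_left R C E (Suc m) X' D A \<delta> (Pull (EE (Suc m)) X' X D c u)
        = Pull (EE (Suc (Suc m))) X' X A c (cup_left R C E (Suc m) X D A \<delta> u)"
      if "X' \<in> Ob C" "X \<in> Ob C" "c \<in> mor C X' X" "u \<in> el (EE (Suc m)) X D" for X' X c u
      using less[of "Suc m"] 3 that by blast
    have cm: "coend_map R C (EE (Suc m)) E (EE (Suc (Suc m))) E X D X A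
        (\<lambda>r. r) (\<lambda>M. cup_left R C E (Suc m) M D A \<delta>) (\<lambda>M \<mu>. \<mu>)" if "X \<in> Ob C" for X
      by (intro coend_map.intro coend_map_axioms.intro Q.coend_data_axioms)
        (use that d IH IHn in \<open>simp_all add: lin_maps_id\<close>)
    have "cup_left R C E (Suc (Suc m)) X D A \<delta> \<in> lin_maps R (Val (EE (Suc (Suc m))) X D) (Val (EE (Suc (Suc (Suc m)))) X A)"
      if X: "X \<in> Ob C" for X
      using lin_maps_transport[where i=Cls and j=the_cls and i'=Cls and j'=the_cls, OF coend_map.fm_linear[OF cm[OF X]]]
      unfolding cup_left_Suc_Suc[abs_def] by (simp add: Epos.simps)
    moreover have "cup_left R C E (Suc (Suc m)) X' D A \<delta> (Pull (EE (Suc (Suc m))) X' X D c u)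
        = Pull (EE (Suc (Suc (Suc m)))) X' X A c (cup_left R C E (Suc (Suc m)) X D A \<delta> u)"
      if t: "X' \<in> Ob C" "X \<in> Ob C" "c \<in> mor C X' X" "u \<in> el (EE (Suc (Suc m))) X D" for X' X c u
    proof -
      obtain xs where xs: "xs \<in> Q.FS (Suc m) X D" "u = cls (Suc m) X D xs" using t by (auto simp: el_Epos)
      note c = Q.pull_fm_closed[OF t(1,2) d(1) t(3) xs(1)]
      show ?thesis unfolding xs(2) cup_left_Suc_Suc using t d xs(1) c
        by (simp add: Epos_pull_QR coend_map.rep_fm_rep[OF cm] coend_map.fm_closed[OF cm] fsum_map_fsum_map)
    qed
    ultimately show ?thesis using 3 by blast
  qed
qed

lemma cup_left_linear:
  "\<lbrakk>X \<in> Ob C; D \<in> Ob C; A \<in> Ob C; \<delta> \<in> el E D A\<rbrakk>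
    \<Longrightarrow> cup_left R C E n X D A \<delta> \<in> lin_maps R (Val (EE n) X D) (Val (EE (Suc n)) X A)"
  using cup_left_linear_natural by blast

lemmas cup_left_closed = lin_maps_closed[OF cup_left_linear]

lemma cup_left_pull:
  "\<lbrakk>X' \<in> Ob C; X \<in> Ob C; D \<in> Ob C; A \<in> Ob C; \<delta> \<in> el E D A; c \<in> mor C X' X; u \<in> el (EE n) X D\<rbrakk>
    \<Longrightarrow> cup_left R C E n X' D A \<delta> (Pull (EE n) X' X D c u)
      = Pull (EE (Suc n)) X' X A c (cup_left R C E n X D A \<delta> u)"
  using cup_left_linear_natural by blast

lemma coend_map_cup_left:
  assumes "X \<in> Ob C" "D \<in> Ob C" "A \<in> Ob C" "\<delta> \<in> el E D A"
  shows "coend_map R C (EE n) E (EE (Suc n)) E X D X A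
    (\<lambda>r. r) (\<lambda>M. cup_left R C E n M D A \<delta>) (\<lambda>M \<mu>. \<mu>)"
  by (intro coend_map.intro coend_map_axioms.intro Q.coend_data_axioms)
    (use assms in \<open>simp_all add: lin_maps_id cup_left_linear cup_left_pull\<close>)

lemmas cup_left_fm_closed = coend_map.fm_closed[OF coend_map_cup_left]

lemma cup_left_QR:
  assumes "X \<in> Ob C" "D \<in> Ob C" "A \<in> Ob C" "\<delta> \<in> el E D A" "xs \<in> Q.FS (Suc n) X D"
  shows "cup_left R C E (Suc (Suc n)) X D A \<delta> (cls (Suc n) X D xs) =
    cls (Suc (Suc n)) X A (fsum_map (\<lambda>r. r) (\<lambda>M. cup_left R C E (Suc n) M D A \<delta>) (\<lambda>M \<mu>. \<mu>) xs)"
  unfolding cup_left_Suc_Suc using coend_map.rep_fm_rep[OF coend_map_cup_left] assms by simp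

text \<open>
  In degree one this is again dinaturality; higher degrees inherit it term by term.
\<close>

lemma cup_left_pull_ext:
  assumes "X \<in> Ob C" "D' \<in> Ob C" "D \<in> Ob C" "A \<in> Ob C" "\<delta> \<in> el E D A" "c \<in> mor C D' D" "u \<in> el (EE n) X D'"
  shows "cup_left R C E n X D' A (Pull E D' D A c \<delta>) u = cup_left R C E n X D A \<delta> (Push (EE n) X D' D c u)"
  using assms(1,7)
proof (induction n arbitrary: X u rule: less_induct)
  case (less n)
  note a = assms(2-6)
  show ?case
  proof (cases n rule: nat_cases_012)
    case 1
    then show ?thesis using less.prems a by (auto simp: el_Epos E.pull_comp)
  next
    case 2
    then obtain \<epsilon> where e: "\<epsilon> \<in> el E X D'" "u = Ext \<epsilon>" using less.prems by (auto simp: el_Epos)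
    have "coend_eq R C (EE (Suc 0)) E X A [(\<one>\<^bsub>R\<^esub>, D', Pull (EE (Suc 0)) D' D A c (Ext \<delta>), \<epsilon>)] [(\<one>\<^bsub>R\<^esub>, D, Ext \<delta>, Push E X D' D c \<epsilon>)]"
      by (rule coend_eq.dinatural) (use e a less.prems in auto)
    from Q.rep_cong[OF this] show ?thesis using 2 e by simp
  next
    case (3 m)
    then obtain xs where xs: "xs \<in> Q.FS (Suc m) X D'" "u = cls (Suc m) X D' xs"
      using less.prems by (auto simp: el_Epos)
    have "fsum_map (\<lambda>r. r) (\<lambda>M. cup_left R C E (Suc m) M D' A (Pull E D' D A c \<delta>)) (\<lambda>M \<mu>. \<mu>) xs
      = fsum_map (\<lambda>r. r) (\<lambda>M \<rho>. cup_left R C E (Suc m) M D A \<delta> (Push (EE (Suc m)) M D' D c \<rho>)) (\<lambda>M \<mu>. \<mu>) xs"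
      by (rule Q.FS_map_cong[OF xs(1)]) (use less.IH[of "Suc m"] 3 in simp)
    then show ?thesis unfolding 3 xs(2) using a less.prems(1) xs(1)
      by (simp add: cup_left_QR E.pull_closed Epos_push_QR Q.push_fm_closed fsum_map_fsum_map)
  qed
qed

lemma cup_left_push_ext:
  assumes "X \<in> Ob C" "D \<in> Ob C" "A \<in> Ob C" "A' \<in> Ob C" "\<delta> \<in> el E D A" "a \<in> mor C A A'" "u \<in> el (EE n) X D"
  shows "cup_left R C E n X D A' (Push E D A A' a \<delta>) u = Push (EE (Suc n)) X A A' a (cup_left R C E n X D A \<delta> u)"
  using assms(1,7)
proof (induction n arbitrary: X u rule: less_induct)
  case (less n)
  note a = assms(2-6)
  show ?case
  proof (cases n rule: nat_cases_012)
    case 1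
    then show ?thesis using less.prems a by (auto simp: el_Epos E.push_pull)
  next
    case 2
    then obtain \<epsilon> where e: "\<epsilon> \<in> el E X D" "u = Ext \<epsilon>" using less.prems by (auto simp: el_Epos)
    have "Push (EE (Suc (Suc 0))) X A A' a (cls (Suc 0) X A [(\<one>\<^bsub>R\<^esub>, D, Ext \<delta>, \<epsilon>)])
      = cls (Suc 0) X A' [(\<one>\<^bsub>R\<^esub>, D, Push (EE (Suc 0)) D A A' a (Ext \<delta>), \<epsilon>)]"
      by (subst Epos_push_QR) (use e a less.prems in auto)
    then show ?thesis using 2 e by simp
  next
    case (3 m)
    then obtain xs where xs: "xs \<in> Q.FS (Suc m) X D" "u = cls (Suc m) X D xs"
      using less.prems by (auto simp: el_Epos)
    have "fsum_map (\<lambda>r. r) (\<lambda>M. cup_left R C E (Suc m) M D A' (Push E D A A' a \<delta>)) (\<lambda>M \<mu>. \<mu>) xs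
      = fsum_map (\<lambda>r. r) (\<lambda>M \<rho>. Push (EE (Suc (Suc m))) M A A' a (cup_left R C E (Suc m) M D A \<delta> \<rho>)) (\<lambda>M \<mu>. \<mu>) xs"
      by (rule Q.FS_map_cong[OF xs(1)]) (use less.IH[of "Suc m"] 3 in simp)
    then show ?thesis unfolding 3 xs(2) using a less.prems(1) xs(1)
      by (simp add: cup_left_QR E.push_closed Epos_push_QR cup_left_fm_closed fsum_map_fsum_map)
  qed
qed

text \<open>
  From degree one on both sides are the class of \<open>(\<rho> \<union> u) \<otimes> \<delta>\<close> by definition. For a morphism
  \<open>u = f\<close> they are \<open>f\<^sup>*\<rho> \<otimes> \<delta>\<close> and \<open>\<rho> \<otimes> f\<^sub>*\<delta>\<close>, which dinaturality identifies.
\<close>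

theorem cup_assoc:
  assumes ob: "W \<in> Ob C" "X \<in> Ob C" "Y \<in> Ob C" "Z \<in> Ob C"
    and d: "\<delta> \<in> el E W X" "\<rho> \<in> el E Y Z" "u \<in> el (EE n) X Y"
  shows "cup_right R C E (Suc n) W X Z \<delta> (cup_left R C E n X Y Z \<rho> u)
    = cup_left R C E (Suc n) W Y Z \<rho> (cup_right R C E n W X Y \<delta> u)"
proof (cases n)
  case 0
  then obtain f where f: "f \<in> mor C X Y" "u = Mor f" using d by (auto simp: el_Epos)
  have "coend_eq R C (EE (Suc 0)) E W Z [(\<one>\<^bsub>R\<^esub>, X, Pull (EE (Suc 0)) X Y Z f (Ext \<rho>), \<delta>)] [(\<one>\<^bsub>R\<^esub>, Y, Ext \<rho>, Push E W X Y f \<delta>)]"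
    by (rule coend_eq.dinatural) (use f ob d in auto)
  from Q.rep_cong[OF this] show ?thesis using 0 f by simp
next
  case (Suc m)
  have "[(\<one>\<^bsub>R\<^esub>, X, u, \<delta>)] \<in> Q.FS (Suc m) W Y" using ob d Suc by simp
  then show ?thesis using Suc ob d by (simp add: cup_left_QR)
qed

end

section \<open>Exact sequences attached to an s-triangle\<close>

context extriangulated_category
begin

definition tri :: "'o \<Rightarrow> 'o \<Rightarrow> 'o \<Rightarrow> 'm \<Rightarrow> 'm \<Rightarrow> 'e \<Rightarrow> bool" where
  "tri A B D x y \<delta> \<longleftrightarrow> A \<in> Ob C \<and> D \<in> Ob C \<and> \<delta> \<in> el E D A \<and> (B, x, y) \<in> s D A \<delta>"

lemma triD:
  assumes "tri A B D x y \<delta>"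
  shows "A \<in> Ob C" "B \<in> Ob C" "D \<in> Ob C" "x \<in> mor C A B" "y \<in> mor C B D" "\<delta> \<in> el E D A"
    "(B, x, y) \<in> s D A \<delta>"
proof -
  show t: "A \<in> Ob C" "D \<in> Ob C" "\<delta> \<in> el E D A" "(B, x, y) \<in> s D A \<delta>" using assms by (auto simp: tri_def)
  obtain q where "q \<in> seqs C A D" "s D A \<delta> = seq_class C A D q" using realization_class t by blast
  then have "(B, x, y) \<in> seqs C A D" using t(4) by (auto simp: seq_class_def)
  then show "B \<in> Ob C" "x \<in> mor C A B" "y \<in> mor C B D" by (auto simp: seqs_def)
qed

lemma realize:
  assumes "D \<in> Ob C" "A \<in> Ob C" "\<delta> \<in> el E D A"
  obtains B x y where "tri A B D x y \<delta>"
proof -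
  obtain q where q: "q \<in> seqs C A D" "s D A \<delta> = seq_class C A D q" using realization_class assms by blast
  obtain B x y where B: "q = (B, x, y)" by (cases q)
  have b: "B \<in> Ob C" "x \<in> mor C A B" "y \<in> mor C B D" using q(1) B by (auto simp: seqs_def)
  have "is_iso C B B (Idm C B)"
    using b id_mor id_left unfolding is_iso_def by blast
  then have "q \<in> seq_class C A D q"
    using q(1) b assms unfolding B seq_class_def
    by (auto intro!: exI[of _ "Idm C B"] simp: id_left id_right)
  then show ?thesis using q(2) B assms that by (simp add: tri_def)
qed

text \<open>
  The zero extensions with one end the zero object \<open>N\<close> have isomorphisms as one of their maps. Mapping
  into or out of these triangles makes the axioms on morphisms of triangles into exactness statements.
\<close>

lemma split_triangles:
  obtains N where "N \<in> Ob C"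
    and "\<And>X. X \<in> Ob C \<Longrightarrow> tri X X N (Idm C X) \<zero>\<^bsub>Hom C X N\<^esub> \<zero>\<^bsub>Val E N X\<^esub>"
    and "\<And>X. X \<in> Ob C \<Longrightarrow> tri N X X \<zero>\<^bsub>Hom C N X\<^esub> (Idm C X) \<zero>\<^bsub>Val E X N\<^esub>"
proof -
  obtain N where N: "N \<in> Ob C"
    and z: "\<And>X. X \<in> Ob C \<Longrightarrow> mor C N X = {\<zero>\<^bsub>Hom C N X\<^esub>} \<and> mor C X N = {\<zero>\<^bsub>Hom C X N\<^esub>}"
    using zero_object by blast
  have idN: "Idm C N = \<zero>\<^bsub>Hom C N N\<^esub>" using id_mor N z by blast
  have 1: "tri X X N (Idm C X) \<zero>\<^bsub>Hom C X N\<^esub> \<zero>\<^bsub>Val E N X\<^esub>" if X: "X \<in> Ob C" for X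
  proof -
    interpret H: module R "Hom C X X" using hom_module X by blast
    have "biproduct C X N X (Idm C X) \<zero>\<^bsub>Hom C N X\<^esub> (Idm C X) \<zero>\<^bsub>Hom C X N\<^esub>"
      using X N id_mor[OF X] unfolding biproduct_def
      by (simp add: mor_zero_closed id_left id_right comp_zero_left comp_zero_right idN)
    then show ?thesis using realization_zero X N val_zero_closed by (simp add: tri_def)
  qed
  have 2: "tri N X X \<zero>\<^bsub>Hom C N X\<^esub> (Idm C X) \<zero>\<^bsub>Val E X N\<^esub>" if X: "X \<in> Ob C" for X
  proof -
    interpret H: module R "Hom C X X" using hom_module X by blast
    have "biproduct C N X X \<zero>\<^bsub>Hom C N X\<^esub> (Idm C X) \<zero>\<^bsub>Hom C X N\<^esub> (Idm C X)"
      using X N id_mor[OF X] unfolding biproduct_def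
      by (simp add: mor_zero_closed id_left id_right comp_zero_left comp_zero_right idN)
    then show ?thesis using realization_zero X N val_zero_closed by (simp add: tri_def)
  qed
  show ?thesis using that N 1 2 by blast
qed

lemma triangle_morphism:
  assumes "tri A B D x y \<delta>" "tri A' B' D' x' y' \<delta>'" "a \<in> mor C A A'" "c \<in> mor C D D'"
    and "Push E D A A' a \<delta> = Pull E D D' A' c \<delta>'"
  obtains b where "b \<in> mor C B B'" "Cmp C A B B' b x = Cmp C A A' B' x' a" "Cmp C B B' D' y' b = Cmp C B D D' c y"
  using realization_mor[OF triD(3,1)[OF assms(1)] triD(3,1)[OF assms(2)] triD(6)[OF assms(1)]
      triD(6)[OF assms(2)] assms(3-5) triD(7)[OF assms(1)] triD(7)[OF assms(2)]] by blast

lemma triangle_cone_map: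
  assumes "tri A B D x y \<delta>" "tri A' B' D' x' y' \<delta>'" "a \<in> mor C A A'" "b \<in> mor C B B'"
    and "Cmp C A B B' b x = Cmp C A A' B' x' a"
  obtains c where "c \<in> mor C D D'" "Cmp C B D D' c y = Cmp C B B' D' y' b" "Push E D A A' a \<delta> = Pull E D D' A' c \<delta>'"
  using ET3[OF triD(3,1)[OF assms(1)] triD(3,1)[OF assms(2)] triD(6)[OF assms(1)]
      triD(6)[OF assms(2)] triD(7)[OF assms(1)] triD(7)[OF assms(2)] assms(3-5)] by blast

lemma triangle_cocone_map:
  assumes "tri A B D x y \<delta>" "tri A' B' D' x' y' \<delta>'" "b \<in> mor C B B'" "c \<in> mor C D D'"
    and "Cmp C B D D' c y = Cmp C B B' D' y' b"
  obtains a where "a \<in> mor C A A'" "Cmp C A B B' b x = Cmp C A A' B' x' a" "Push E D A A' a \<delta> = Pull E D D' A' c \<delta>'"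
  using ET3_op[OF triD(3,1)[OF assms(1)] triD(3,1)[OF assms(2)] triD(6)[OF assms(1)]
      triD(6)[OF assms(2)] triD(7)[OF assms(1)] triD(7)[OF assms(2)] assms(3-5)] by blast

text \<open>
  The following statements are the exactness of the Hom--E sequences of a triangle. Each of them
  comes from a morphism between the triangle and one of the two split triangles on an object.
\<close>

lemma extend_along_inflation:
  assumes T: "tri A B D x y \<delta>" and Z: "Z \<in> Ob C" and f: "f \<in> mor C A Z" "Push E D A Z f \<delta> = \<zero>\<^bsub>Val E D Z\<^esub>"
  obtains b where "b \<in> mor C B Z" "Cmp C A B Z b x = f"
proof -
  note t = triD[OF T]
  obtain N where N: "N \<in> Ob C" "tri Z Z N (Idm C Z) \<zero>\<^bsub>Hom C Z N\<^esub> \<zero>\<^bsub>Val E N Z\<^esub>" using split_triangles Z by metis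
  show ?thesis
    by (rule triangle_morphism[OF T N(2) f(1), of "\<zero>\<^bsub>Hom C D N\<^esub>"])
      (use t N Z f that in \<open>auto simp: mor_zero_closed pull_zero_mor val_zero_closed id_left\<close>)
qed

lemma lift_along_deflation:
  assumes T: "tri A B D x y \<delta>" and Z: "Z \<in> Ob C" and h: "h \<in> mor C Z D" "Pull E Z D A h \<delta> = \<zero>\<^bsub>Val E Z A\<^esub>"
  obtains b where "b \<in> mor C Z B" "Cmp C Z B D y b = h"
proof -
  note t = triD[OF T]
  obtain N where N: "N \<in> Ob C" "tri N Z Z \<zero>\<^bsub>Hom C N Z\<^esub> (Idm C Z) \<zero>\<^bsub>Val E Z N\<^esub>" using split_triangles Z by metis
  show ?thesis
    by (rule triangle_morphism[OF N(2) T _ h(1), of "\<zero>\<^bsub>Hom C N A\<^esub>"])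
      (use t N Z h that in \<open>auto simp: mor_zero_closed push_zero_mor val_zero_closed id_right\<close>)
qed

lemma factor_through_deflation:
  assumes T: "tri A B D x y \<delta>" and Z: "Z \<in> Ob C" and g: "g \<in> mor C B Z" "Cmp C A B Z g x = \<zero>\<^bsub>Hom C A Z\<^esub>"
  obtains c where "c \<in> mor C D Z" "Cmp C B D Z c y = g"
proof -
  note t = triD[OF T]
  obtain N where N: "N \<in> Ob C" "tri N Z Z \<zero>\<^bsub>Hom C N Z\<^esub> (Idm C Z) \<zero>\<^bsub>Val E Z N\<^esub>" using split_triangles Z by metis
  show ?thesis
    by (rule triangle_cone_map[OF T N(2) _ g(1), of "\<zero>\<^bsub>Hom C A N\<^esub>"])
      (use t N Z g that in \<open>auto simp: mor_zero_closed comp_zero_left id_left\<close>)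
qed

lemma factor_through_inflation:
  assumes T: "tri A B D x y \<delta>" and Z: "Z \<in> Ob C" and g: "g \<in> mor C Z B" "Cmp C Z B D y g = \<zero>\<^bsub>Hom C Z D\<^esub>"
  obtains a where "a \<in> mor C Z A" "Cmp C Z A B x a = g"
proof -
  note t = triD[OF T]
  obtain N where N: "N \<in> Ob C" "tri Z Z N (Idm C Z) \<zero>\<^bsub>Hom C Z N\<^esub> \<zero>\<^bsub>Val E N Z\<^esub>" using split_triangles Z by metis
  show ?thesis
    by (rule triangle_cocone_map[OF N(2) T g(1), of "\<zero>\<^bsub>Hom C N D\<^esub>"])
      (use t N Z g that in \<open>auto simp: mor_zero_closed comp_zero_left id_right\<close>)
qed

lemma push_inflation_zero:
  assumes T: "tri A B D x y \<delta>"
  shows "Push E D A B x \<delta> = \<zero>\<^bsub>Val E D B\<^esub>"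
proof -
  note t = triD[OF T]
  obtain N where N: "N \<in> Ob C" "tri B B N (Idm C B) \<zero>\<^bsub>Hom C B N\<^esub> \<zero>\<^bsub>Val E N B\<^esub>" using split_triangles t(2) by metis
  show ?thesis
    by (rule triangle_cone_map[OF T N(2) t(4) id_mor[OF t(2)]])
      (use t N in \<open>auto simp: pull_zero\<close>)
qed

lemma pull_deflation_zero:
  assumes T: "tri A B D x y \<delta>"
  shows "Pull E B D A y \<delta> = \<zero>\<^bsub>Val E B A\<^esub>"
proof -
  note t = triD[OF T]
  obtain N where N: "N \<in> Ob C" "tri N B B \<zero>\<^bsub>Hom C N B\<^esub> (Idm C B) \<zero>\<^bsub>Val E B N\<^esub>" using split_triangles t(2) by metis
  show ?thesis
    by (rule triangle_cocone_map[OF N(2) T id_mor[OF t(2)] t(5)])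
      (use t N in \<open>auto simp: push_zero\<close>)
qed

text \<open>
  Realize \<open>\<epsilon>\<close> by \<open>A \<rightarrow> G \<rightarrow> W\<close>. As \<open>x\<^sub>*\<epsilon> = 0\<close>, the inflation \<open>x\<close> extends along \<open>A \<rightarrow> G\<close>; the morphism of
  triangles under \<open>A\<close> obtained in this way ends in the required \<open>h : W \<rightarrow> D\<close>.
\<close>

lemma pullback_of_triangle:
  assumes T: "tri A B D x y \<delta>" and W: "W \<in> Ob C" and e: "\<epsilon> \<in> el E W A" "Push E W A B x \<epsilon> = \<zero>\<^bsub>Val E W B\<^esub>"
  obtains h where "h \<in> mor C W D" "Pull E W D A h \<delta> = \<epsilon>"
proof -
  note t = triD[OF T]
  obtain G u v where G: "tri A G W u v \<epsilon>" using realize W t(1) e(1) by metis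
  note g = triD[OF G]
  obtain k where k: "k \<in> mor C G B" "Cmp C A G B k u = x" using extend_along_inflation[OF G t(2) t(4) e(2)] by metis
  show ?thesis
    by (rule triangle_cone_map[OF G T id_mor[OF t(1)] k(1)])
      (use t g k e that in \<open>auto simp: id_right push_id\<close>)
qed

text \<open>
  The dual argument: the deflation \<open>y\<close> lifts along the deflation of a realization of \<open>\<epsilon>\<close>.
\<close>

lemma pushout_of_triangle:
  assumes T: "tri A B D x y \<delta>" and Z: "Z \<in> Ob C" and e: "\<epsilon> \<in> el E D Z" "Pull E B D Z y \<epsilon> = \<zero>\<^bsub>Val E B Z\<^esub>"
  obtains f where "f \<in> mor C A Z" "Push E D A Z f \<delta> = \<epsilon>"
proof -
  note t = triD[OF T]
  obtain G u v where G: "tri Z G D u v \<epsilon>" using realize Z t(3) e(1) by metis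
  note g = triD[OF G]
  obtain k where k: "k \<in> mor C B G" "Cmp C B G D v k = y" using lift_along_deflation[OF G t(2) t(5) e(2)] by metis
  show ?thesis
    by (rule triangle_cocone_map[OF T G k(1) id_mor[OF t(3)]])
      (use t g k e that in \<open>auto simp: id_left pull_id\<close>)
qed

end

section \<open>Dimension shifting along projective and injective presentations\<close>

sublocale extriangulated_category \<subseteq> Pos: ext_data R C E
  by (intro ext_data.intro bilinear_functor_axioms)

text \<open>
  Here \<open>Q \<rightarrow> G \<rightarrow> Y\<close> presents \<open>Y\<close> by a projective object \<open>G\<close>, and \<open>\<omega>\<close> is its extension; \<open>push_omega_onto\<close> and
  \<open>push_omega_kernel\<close> say that \<open>C(G, Z) \<rightarrow> C(Q, Z) \<rightarrow> E(Y, Z) \<rightarrow> 0\<close> is exact.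
\<close>

locale projective_presentation = extriangulated_category R C E s
  for R :: "'r ring" and C :: "('r, 'o, 'm) lincat" and E :: "('r, 'o, 'm, 'e) bifunctor"
    and s :: "('o, 'm, 'e) realization" +
  fixes Y Q G :: 'o and p g :: 'm and \<omega> :: 'e
  assumes tri: "tri Q G Y p g \<omega>" and proj: "proj_object C E G"
begin

lemmas ob = triD(1-3)[OF tri] and p = triD(4)[OF tri] and g = triD(5)[OF tri] and \<omega> = triD(6)[OF tri]

lemma ext_from_G: "\<lbrakk>Z \<in> Ob C; \<epsilon> \<in> el E G Z\<rbrakk> \<Longrightarrow> \<epsilon> = \<zero>\<^bsub>Val E G Z\<^esub>"
  using proj by (auto simp: proj_object_def)

lemma push_omega_onto:
  assumes "Z \<in> Ob C" "\<epsilon> \<in> el E Y Z"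
  obtains b where "b \<in> mor C Q Z" "Push E Y Q Z b \<omega> = \<epsilon>"
  using pushout_of_triangle[OF tri assms] ext_from_G assms pull_closed ob g by metis

lemma push_omega_kernel:
  assumes "Z \<in> Ob C" "b \<in> mor C Q Z" "b' \<in> mor C Q Z" "Push E Y Q Z b \<omega> = Push E Y Q Z b' \<omega>"
  obtains k where "k \<in> mor C G Z" "b \<ominus>\<^bsub>Hom C Q Z\<^esub> b' = Cmp C Q G Z k p"
proof -
  have "Push E Y Q Z (b \<ominus>\<^bsub>Hom C Q Z\<^esub> b') \<omega> = \<zero>\<^bsub>Val E Y Z\<^esub>"
    using assms ob \<omega> by (simp add: push_mor_minus val_minus_self push_closed)
  then show ?thesis
    using extend_along_inflation[OF tri assms(1)] that assms ob mor_minus_closed by metis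
qed

lemma dominant: "dominant C E s Y Q \<omega>"
  unfolding dominant_def proj_mors_def
  using triD(7)[OF tri] ob g \<omega> pull_closed ext_from_G by blast

text \<open>
  A term \<open>\<rho> \<otimes> \<mu>\<close> of a class in \<open>E\<^sup>n(G, Z)\<close>, \<open>n \<ge> 2\<close>, has \<open>\<mu>\<close> in \<open>E(G, M) = 0\<close>.
\<close>

lemma Epos_from_G:
  assumes "Z \<in> Ob C" "u \<in> el (Epos R C E (Suc n)) G Z"
  shows "u = \<zero>\<^bsub>Val (Epos R C E (Suc n)) G Z\<^esub>"
proof (cases n)
  case 0
  then show ?thesis using assms ext_from_G by (auto simp: Epos.simps)
next
  case (Suc m)
  then obtain xs where xs: "xs \<in> Pos.Q.FS (Suc m) G Z" "u = Pos.cls (Suc m) G Z xs"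
    using assms by (auto simp: Pos.el_Epos)
  have "Pos.Q.eqv (Suc m) G Z xs []" using xs(1)
  proof (induction rule: Pos.Q.FS_induct)
    case Nil
    show ?case by (simp add: Pos.Q.eqv_refl)
  next
    case (Cons r M \<rho> \<mu> xs)
    interpret M: module R "Val E G M" using val_module ob Cons by blast
    have m: "\<mu> = \<zero>\<^bsub>R\<^esub> \<odot>\<^bsub>Val E G M\<^esub> \<mu>" using ext_from_G Cons by simp
    have "Pos.Q.eqv (Suc m) G Z [(r, M, \<rho>, \<zero>\<^bsub>R\<^esub> \<odot>\<^bsub>Val E G M\<^esub> \<mu>)] [(r \<otimes>\<^bsub>R\<^esub> \<zero>\<^bsub>R\<^esub>, M, \<rho>, \<mu>)]"
      using Cons by (intro coend_eq.right_smult) auto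
    then have "Pos.Q.eqv (Suc m) G Z [(r, M, \<rho>, \<mu>)] [(\<zero>\<^bsub>R\<^esub>, M, \<rho>, \<mu>)]"
      using Cons m by simp
    also have "Pos.Q.eqv (Suc m) G Z \<dots> []" using Cons by (intro coend_eq.coeff_zero)
    finally show ?case using Pos.Q.eqv_append[OF _ Cons.IH] by fastforce
  qed
  from Pos.Q.rep_cong[OF this] show ?thesis using Suc xs by (simp add: Epos.simps Pos.Q.coend_zero)
qed

lemma pull_independent:
  assumes Z: "Z \<in> Ob C" "W \<in> Ob C" and b: "b \<in> mor C Q Z" "b' \<in> mor C Q Z"
    and eq: "Push E Y Q Z b \<omega> = Push E Y Q Z b' \<omega>" and u: "u \<in> el (Epos R C E (Suc n)) Z W"
  shows "Pull (Epos R C E (Suc n)) Q Z W b u = Pull (Epos R C E (Suc n)) Q Z W b' u"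
proof -
  obtain k where k: "k \<in> mor C G Z" "b \<ominus>\<^bsub>Hom C Q Z\<^esub> b' = Cmp C Q G Z k p" using push_omega_kernel Z b eq by metis
  have "Pull (Epos R C E (Suc n)) Q Z W b u \<ominus>\<^bsub>Val (Epos R C E (Suc n)) Q W\<^esub> Pull (Epos R C E (Suc n)) Q Z W b' u
      = Pull (Epos R C E (Suc n)) Q Z W (Cmp C Q G Z k p) u"
    using Pos.P.pull_mor_minus ob Z b u k(2) by metis
  also have "\<dots> = Pull (Epos R C E (Suc n)) Q G W p (Pull (Epos R C E (Suc n)) G Z W k u)"
    using ob Z k p u by (intro Pos.P.pull_comp)
  also have "Pull (Epos R C E (Suc n)) G Z W k u = \<zero>\<^bsub>Val (Epos R C E (Suc n)) G W\<^esub>"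
    using Epos_from_G Pos.P.pull_closed ob Z k u by blast
  also have "Pull (Epos R C E (Suc n)) Q G W p \<dots> = \<zero>\<^bsub>Val (Epos R C E (Suc n)) Q W\<^esub>"
    using ob Z p by (intro Pos.P.pull_zero)
  finally show ?thesis
    using module_minus_eq_zero[OF Pos.P.val_module] Pos.P.pull_closed ob Z b u by metis
qed

text \<open>
  Since \<open>\<mu> = b\<^sub>*\<omega>\<close>, each term \<open>r (\<rho> \<otimes> \<mu>)\<close> equals \<open>r (b\<^sup>*\<rho> \<otimes> \<omega>)\<close>, and terms with the same right factor add
  up to a single one.
\<close>

lemma cup_omega_onto:
  assumes Z: "Z \<in> Ob C" and xs: "xs \<in> Pos.Q.FS (Suc n) Y Z"
  shows "\<exists>u\<in>el (Epos R C E (Suc n)) Q Z. Pos.Q.eqv (Suc n) Y Z xs [(\<one>\<^bsub>R\<^esub>, Q, u, \<omega>)]"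
  using xs
proof (induction rule: Pos.Q.FS_induct)
  case Nil
  interpret N: module R "Val (Epos R C E (Suc n)) Q Z" using Pos.P.val_module ob Z by blast
  have "Pos.Q.eqv (Suc n) Y Z [(\<one>\<^bsub>R\<^esub>, Q, \<zero>\<^bsub>R\<^esub> \<odot>\<^bsub>Val (Epos R C E (Suc n)) Q Z\<^esub> \<zero>\<^bsub>Val (Epos R C E (Suc n)) Q Z\<^esub>, \<omega>)]
      [(\<one>\<^bsub>R\<^esub> \<otimes>\<^bsub>R\<^esub> \<zero>\<^bsub>R\<^esub>, Q, \<zero>\<^bsub>Val (Epos R C E (Suc n)) Q Z\<^esub>, \<omega>)]"
    using ob \<omega> by (intro coend_eq.left_smult) auto
  also have "\<one>\<^bsub>R\<^esub> \<otimes>\<^bsub>R\<^esub> \<zero>\<^bsub>R\<^esub> = \<zero>\<^bsub>R\<^esub>" by simp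
  also have "Pos.Q.eqv (Suc n) Y Z [(\<zero>\<^bsub>R\<^esub>, Q, \<zero>\<^bsub>Val (Epos R C E (Suc n)) Q Z\<^esub>, \<omega>)] []"
    using ob \<omega> by (intro coend_eq.coeff_zero) auto
  finally show ?case using Pos.Q.eqv_sym by (metis N.smult_l_null N.M.zero_closed)
next
  case (Cons r M \<rho> \<mu> xs)
  then obtain u where u: "u \<in> el (Epos R C E (Suc n)) Q Z" "Pos.Q.eqv (Suc n) Y Z xs [(\<one>\<^bsub>R\<^esub>, Q, u, \<omega>)]" by blast
  obtain b where b: "b \<in> mor C Q M" "Push E Y Q M b \<omega> = \<mu>" using push_omega_onto Cons by metis
  let ?v = "Pull (Epos R C E (Suc n)) Q M Z b \<rho>"
  have v: "?v \<in> el (Epos R C E (Suc n)) Q Z" using Pos.P.pull_closed ob Z b Cons by blast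
  let ?w = "r \<odot>\<^bsub>Val (Epos R C E (Suc n)) Q Z\<^esub> ?v"
  have w: "?w \<in> el (Epos R C E (Suc n)) Q Z" using v Pos.P.val_smult_closed ob Z Cons by blast
  have "Pos.Q.eqv (Suc n) Y Z [(r, Q, ?v, \<omega>)] [(r, M, \<rho>, \<mu>)]"
    unfolding b(2)[symmetric] using ob Z b Cons \<omega> by (intro coend_eq.dinatural)
  moreover have "Pos.Q.eqv (Suc n) Y Z [(\<one>\<^bsub>R\<^esub>, Q, ?w, \<omega>)] [(\<one>\<^bsub>R\<^esub> \<otimes>\<^bsub>R\<^esub> r, Q, ?v, \<omega>)]"
    using ob Z v Cons \<omega> by (intro coend_eq.left_smult) auto
  ultimately have "Pos.Q.eqv (Suc n) Y Z [(r, M, \<rho>, \<mu>)] [(\<one>\<^bsub>R\<^esub>, Q, ?w, \<omega>)]"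
    using Cons by (simp) (blast intro: Pos.Q.eqv_trans Pos.Q.eqv_sym)
  from Pos.Q.eqv_append[OF this u(2)]
  have "Pos.Q.eqv (Suc n) Y Z ((r, M, \<rho>, \<mu>) # xs) [(\<one>\<^bsub>R\<^esub>, Q, ?w, \<omega>), (\<one>\<^bsub>R\<^esub>, Q, u, \<omega>)]" by simp
  also have "Pos.Q.eqv (Suc n) Y Z \<dots> [(\<one>\<^bsub>R\<^esub>, Q, ?w \<oplus>\<^bsub>Val (Epos R C E (Suc n)) Q Z\<^esub> u, \<omega>)]"
    using ob Z u w \<omega> by (intro Pos.Q.eqv_sym[OF coend_eq.left_add]) auto
  finally show ?case using Pos.P.val_add_closed u w ob Z by blast
qed

text \<open>
  The inverse of \<open>\<mu> \<mapsto> \<mu> \<union> \<omega>\<close> sends \<open>\<rho> \<otimes> b\<^sub>*\<omega>\<close> to \<open>b\<^sup>*\<rho>\<close>. The choice of \<open>b\<close> does not matter because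
  two choices differ by a morphism through the projective object \<open>G\<close>, which \<open>E\<^sup>n\<close> kills.
\<close>

theorem cup_omega_bij:
  assumes Z: "Z \<in> Ob C"
  shows "bij_betw (cup_right R C E (Suc n) Y Q Z \<omega>) (el (Epos R C E (Suc n)) Q Z) (el (Epos R C E (Suc (Suc n))) Y Z)"
proof -
  let ?E = "Epos R C E (Suc n)"
  define f where "f M \<mu> = (SOME b. b \<in> mor C Q M \<and> Push E Y Q M b \<omega> = \<mu>)" for M \<mu>
  have f: "f M \<mu> \<in> mor C Q M" "Push E Y Q M (f M \<mu>) \<omega> = \<mu>" if "M \<in> Ob C" "\<mu> \<in> el E Y M" for M \<mu>
    using someI_ex[of "\<lambda>b. b \<in> mor C Q M \<and> Push E Y Q M b \<omega> = \<mu>"] push_omega_onto[OF that]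
    unfolding f_def by blast+
  define h where "h M \<rho> \<mu> = Pull ?E Q M Z (f M \<mu>) \<rho>" for M \<rho> \<mu>
  have h: "h M \<rho> \<mu> = Pull ?E Q M Z b \<rho>"
    if "M \<in> Ob C" "\<mu> \<in> el E Y M" "\<rho> \<in> el ?E M Z" "b \<in> mor C Q M" "Push E Y Q M b \<omega> = \<mu>" for M \<rho> \<mu> b
    unfolding h_def using pull_independent f that Z by metis
  have inv: "coend_eval (Val ?E Q Z) h xs = coend_eval (Val ?E Q Z) h ys"
    if "Pos.Q.eqv (Suc n) Y Z xs ys" for xs ys
  proof (rule Pos.Q.coend_eval_eqv[OF Pos.P.val_module ob(3) Z _ _ _ that])
    show "Q \<in> Ob C" "Z \<in> Ob C" using ob Z by auto
    show "(\<lambda>\<rho>. h M \<rho> \<mu>) \<in> lin_maps R (Val ?E M Z) (Val ?E Q Z)" if "M \<in> Ob C" "\<mu> \<in> el E Y M" for M \<mu>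
      unfolding h_def using Pos.P.pull_linear f that ob Z by blast
    show "h M \<rho> \<in> lin_maps R (Val E Y M) (Val ?E Q Z)" if M: "M \<in> Ob C" "\<rho> \<in> el ?E M Z" for M \<rho>
    proof (rule lin_mapsI)
      show "h M \<rho> \<mu> \<in> el ?E Q Z" if "\<mu> \<in> el E Y M" for \<mu>
        unfolding h_def using Pos.P.pull_closed ob Z M that f by blast
      show "h M \<rho> (\<mu> \<oplus>\<^bsub>Val E Y M\<^esub> \<nu>) = h M \<rho> \<mu> \<oplus>\<^bsub>Val ?E Q Z\<^esub> h M \<rho> \<nu>"
        if mn: "\<mu> \<in> el E Y M" "\<nu> \<in> el E Y M" for \<mu> \<nu>
      proof -
        have "h M \<rho> (\<mu> \<oplus>\<^bsub>Val E Y M\<^esub> \<nu>) = Pull ?E Q M Z (f M \<mu> \<oplus>\<^bsub>Hom C Q M\<^esub> f M \<nu>) \<rho>"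
          by (rule h) (use mn M f ob \<omega> in \<open>auto simp: val_add_closed push_mor_add module_add_closed[OF hom_module]\<close>)
        then show ?thesis using Pos.P.pull_mor_add f mn M ob Z by (simp add: h_def)
      qed
      show "h M \<rho> (t \<odot>\<^bsub>Val E Y M\<^esub> \<mu>) = t \<odot>\<^bsub>Val ?E Q Z\<^esub> h M \<rho> \<mu>"
        if mn: "t \<in> carrier R" "\<mu> \<in> el E Y M" for t \<mu>
      proof -
        have "h M \<rho> (t \<odot>\<^bsub>Val E Y M\<^esub> \<mu>) = Pull ?E Q M Z (t \<odot>\<^bsub>Hom C Q M\<^esub> f M \<mu>) \<rho>"
          by (rule h) (use mn M f ob \<omega> in \<open>auto simp: val_smult_closed push_mor_smult module_smult_closed[OF hom_module]\<close>)
        then show ?thesis using Pos.P.pull_mor_smult f mn M ob Z by (simp add: h_def)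
      qed
    qed
    show "h M (Pull ?E M M' Z m \<rho>) \<mu> = h M' \<rho> (Push E Y M M' m \<mu>)"
      if M: "M \<in> Ob C" "M' \<in> Ob C" "m \<in> mor C M M'" "\<rho> \<in> el ?E M' Z" "\<mu> \<in> el E Y M" for M M' m \<rho> \<mu>
    proof -
      have "h M' \<rho> (Push E Y M M' m \<mu>) = Pull ?E Q M' Z (Cmp C Q M M' m (f M \<mu>)) \<rho>"
        by (rule h) (use M f ob \<omega> in \<open>auto simp: push_closed comp_closed push_comp\<close>)
      also have "\<dots> = h M (Pull ?E M M' Z m \<rho>) \<mu>"
        unfolding h_def using M f ob Z by (intro Pos.P.pull_comp) auto
      finally show ?thesis ..
    qed
  qed
  have ev: "coend_eval (Val ?E Q Z) h [(\<one>\<^bsub>R\<^esub>, Q, u, \<omega>)] = u" if u: "u \<in> el ?E Q Z" for u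
  proof -
    interpret N: module R "Val ?E Q Z" using Pos.P.val_module ob Z by blast
    have "h Q u \<omega> = Pull ?E Q Q Z (Idm C Q) u" by (rule h) (use u ob \<omega> in \<open>auto simp: id_mor push_id\<close>)
    then show ?thesis using u ob Z by (simp add: Pos.P.pull_id)
  qed
  have "inj_on (cup_right R C E (Suc n) Y Q Z \<omega>) (el ?E Q Z)"
  proof (rule inj_onI)
    fix u v assume uv: "u \<in> el ?E Q Z" "v \<in> el ?E Q Z"
      "cup_right R C E (Suc n) Y Q Z \<omega> u = cup_right R C E (Suc n) Y Q Z \<omega> v"
    have "Pos.Q.eqv (Suc n) Y Z [(\<one>\<^bsub>R\<^esub>, Q, u, \<omega>)] [(\<one>\<^bsub>R\<^esub>, Q, v, \<omega>)]"
      by (rule Pos.Q.rep_eqD) (use uv ob \<omega> in auto)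
    from inv[OF this] show "u = v" using ev uv by metis
  qed
  moreover have "cup_right R C E (Suc n) Y Q Z \<omega> ` el ?E Q Z = el (Epos R C E (Suc (Suc n))) Y Z"
  proof
    show "cup_right R C E (Suc n) Y Q Z \<omega> ` el ?E Q Z \<subseteq> el (Epos R C E (Suc (Suc n))) Y Z"
      using Pos.cup_right_closed ob Z \<omega> by blast
    show "el (Epos R C E (Suc (Suc n))) Y Z \<subseteq> cup_right R C E (Suc n) Y Q Z \<omega> ` el ?E Q Z"
    proof
      fix w assume "w \<in> el (Epos R C E (Suc (Suc n))) Y Z"
      then obtain xs where xs: "xs \<in> Pos.Q.FS (Suc n) Y Z" "w = Pos.cls (Suc n) Y Z xs" by (auto simp: Pos.el_Epos)
      then obtain u where u: "u \<in> el ?E Q Z" "Pos.Q.eqv (Suc n) Y Z xs [(\<one>\<^bsub>R\<^esub>, Q, u, \<omega>)]"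
        using cup_omega_onto[OF Z xs(1)] by blast
      show "w \<in> cup_right R C E (Suc n) Y Q Z \<omega> ` el ?E Q Z"
        using Pos.Q.rep_cong[OF u(2)] xs(2) u(1) by auto
    qed
  qed
  ultimately show ?thesis by (simp add: bij_betw_def)
qed

end

text \<open>Naturality of the inverse of a natural bijection makes the induced map of coends bijective.\<close>

lemma coend_map_bij:
  assumes cm: "coend_map R C F E F' E X Y X Y' (\<lambda>r. r) \<alpha> (\<lambda>M \<mu>. \<mu>)"
    and bij: "\<And>M. M \<in> Ob C \<Longrightarrow> bij_betw (\<alpha> M) (el F M Y) (el F' M Y')"
  shows "bij_betw (\<lambda>xs. coend_rep R C F' E X Y' (fsum_map (\<lambda>r. r) \<alpha> (\<lambda>M \<mu>. \<mu>) xs))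
    (el (coend R C F E) X Y) (el (coend R C F' E) X Y')"
proof -
  interpret coend_map R C F E F' E X Y X Y' "\<lambda>r. r" \<alpha> "\<lambda>M \<mu>. \<mu>" by (rule cm)
  define \<gamma> where "\<gamma> M = inv_into (el F M Y) (\<alpha> M)" for M
  have g1: "\<gamma> M (\<alpha> M \<rho>) = \<rho>" if "M \<in> Ob C" "\<rho> \<in> el F M Y" for M \<rho>
    unfolding \<gamma>_def using bij_betw_inv_into_left[OF bij] that by blast
  have g2: "\<alpha> M (\<gamma> M \<rho>) = \<rho>" "\<gamma> M \<rho> \<in> el F M Y" if "M \<in> Ob C" "\<rho> \<in> el F' M Y'" for M \<rho>
    unfolding \<gamma>_def using bij_betw_inv_into_right[OF bij] bij_betw_inv_into[OF bij] bij_betwE that by blast+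
  interpret G: coend_map R C F' E F E X Y' X Y "\<lambda>r. r" \<gamma> "\<lambda>M \<mu>. \<mu>"
  proof (intro coend_map.intro coend_map_axioms.intro A.coend_data_axioms B.coend_data_axioms)
    show "\<gamma> M \<in> lin_maps R (Val F' M Y') (Val F M Y)" if "M \<in> Ob C" for M
      unfolding \<gamma>_def using lin_maps_inv_into A.F.val_module \<alpha>_linear bij that objects by blast
    show "\<gamma> M (Pull F' M N Y' m \<rho>) = Pull F M N Y m (\<gamma> N \<rho>)"
      if "M \<in> Ob C" "N \<in> Ob C" "m \<in> mor C M N" "\<rho> \<in> el F' N Y'" for M N m \<rho>
      using that g1 g2 \<alpha>_natural A.F.pull_closed objects by metis
  qed (use objects in \<open>simp_all add: lin_maps_id\<close>)
  show ?thesis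
  proof (rule bij_betw_byWitness[where f'="\<lambda>xs. coend_rep R C F E X Y (fsum_map (\<lambda>r. r) \<gamma> (\<lambda>M \<mu>. \<mu>) xs)"])
    show "\<forall>u\<in>el A.T X Y. A.rep X Y (G.fm (B.rep X Y' (fm u))) = u"
    proof
      fix u assume "u \<in> el A.T X Y"
      then obtain xs where xs: "xs \<in> A.FS X Y" "u = A.rep X Y xs" by (auto simp: A.coend_carrier)
      have "G.fm (fm xs) = fsum_map (\<lambda>r. r) (\<lambda>M \<rho>. \<rho>) (\<lambda>M \<mu>. \<mu>) xs"
        unfolding fsum_map_fsum_map by (rule A.FS_map_cong[OF xs(1)]) (simp add: g1)
      then show "A.rep X Y (G.fm (B.rep X Y' (fm u))) = u"
        using xs by (simp add: rep_fm_rep G.rep_fm_rep fm_closed A.fsum_map_ident)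
    qed
    show "\<forall>u\<in>el B.T X Y'. B.rep X Y' (fm (A.rep X Y (G.fm u))) = u"
    proof
      fix u assume "u \<in> el B.T X Y'"
      then obtain xs where xs: "xs \<in> B.FS X Y'" "u = B.rep X Y' xs" by (auto simp: B.coend_carrier)
      have "fm (G.fm xs) = fsum_map (\<lambda>r. r) (\<lambda>M \<rho>. \<rho>) (\<lambda>M \<mu>. \<mu>) xs"
        unfolding fsum_map_fsum_map by (rule B.FS_map_cong[OF xs(1)]) (simp add: g2)
      then show "B.rep X Y' (fm (A.rep X Y (G.fm u))) = u"
        using xs by (simp add: rep_fm_rep G.rep_fm_rep G.fm_closed B.fsum_map_ident)
    qed
  qed (use fm_linear G.fm_linear lin_maps_closed in fast)+
qed

text \<open>
  Dually \<open>X \<rightarrow> I \<rightarrow> J\<close> presents \<open>X\<close> by an injective object \<open>I\<close>, and \<open>C(Z, I) \<rightarrow> C(Z, J) \<rightarrow> E(Z, X) \<rightarrow> 0\<close> is exact.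
\<close>

locale injective_presentation = extriangulated_category R C E s
  for R :: "'r ring" and C :: "('r, 'o, 'm) lincat" and E :: "('r, 'o, 'm, 'e) bifunctor"
    and s :: "('o, 'm, 'e) realization" +
  fixes X J I :: 'o and j i :: 'm and \<iota> :: 'e
  assumes tri: "tri X I J j i \<iota>" and inj: "inj_object C E I"
begin

lemmas ob = triD(1-3)[OF tri] and j = triD(4)[OF tri] and i = triD(5)[OF tri] and \<iota> = triD(6)[OF tri]

lemma ext_into_I: "\<lbrakk>Z \<in> Ob C; \<epsilon> \<in> el E Z I\<rbrakk> \<Longrightarrow> \<epsilon> = \<zero>\<^bsub>Val E Z I\<^esub>"
  using inj by (auto simp: inj_object_def)

lemma pull_iota_onto:
  assumes "Z \<in> Ob C" "\<epsilon> \<in> el E Z X"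
  obtains c where "c \<in> mor C Z J" "Pull E Z J X c \<iota> = \<epsilon>"
  using pullback_of_triangle[OF tri assms] ext_into_I assms push_closed ob j by metis

lemma pull_iota_kernel:
  assumes "Z \<in> Ob C" "c \<in> mor C Z J" "c' \<in> mor C Z J" "Pull E Z J X c \<iota> = Pull E Z J X c' \<iota>"
  obtains k where "k \<in> mor C Z I" "c \<ominus>\<^bsub>Hom C Z J\<^esub> c' = Cmp C Z I J i k"
proof -
  have "Pull E Z J X (c \<ominus>\<^bsub>Hom C Z J\<^esub> c') \<iota> = \<zero>\<^bsub>Val E Z X\<^esub>"
    using assms ob \<iota> by (simp add: pull_mor_minus val_minus_self pull_closed)
  then show ?thesis
    using lift_along_deflation[OF tri assms(1)] that assms ob mor_minus_closed by metis
qed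

lemma codominant: "codominant C E J X \<iota>"
proof -
  have "(\<lambda>f. Pull E Z J X f \<iota>) ` mor C Z J = el E Z X" if "Z \<in> Ob C" for Z
    using that pull_iota_onto pull_closed ob \<iota> by (auto simp: image_iff) metis
  then show ?thesis using \<iota> by (simp add: codominant_def)
qed

lemma push_independent:
  assumes Z: "Z \<in> Ob C" "W \<in> Ob C" and c: "c \<in> mor C Z J" "c' \<in> mor C Z J"
    and eq: "Pull E Z J X c \<iota> = Pull E Z J X c' \<iota>" and u: "u \<in> el E W Z"
  shows "Push E W Z J c u = Push E W Z J c' u"
proof -
  obtain k where k: "k \<in> mor C Z I" "c \<ominus>\<^bsub>Hom C Z J\<^esub> c' = Cmp C Z I J i k" using pull_iota_kernel Z c eq by metis
  have "Push E W Z J c u \<ominus>\<^bsub>Val E W J\<^esub> Push E W Z J c' u = Push E W Z J (Cmp C Z I J i k) u"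
    using push_mor_minus ob Z c u k(2) by metis
  also have "\<dots> = Push E W I J i (Push E W Z I k u)"
    using ob Z k i u by (intro push_comp)
  also have "Push E W Z I k u = \<zero>\<^bsub>Val E W I\<^esub>"
    using ext_into_I push_closed ob Z k u by blast
  also have "Push E W I J i \<dots> = \<zero>\<^bsub>Val E W J\<^esub>"
    using ob Z i by (intro push_zero)
  finally show ?thesis
    using module_minus_eq_zero[OF val_module] push_closed ob Z c u by metis
qed

lemma cup_iota_onto:
  assumes W: "W \<in> Ob C" and xs: "xs \<in> Pos.Q.FS (Suc 0) W X"
  shows "\<exists>u\<in>el E W J. Pos.Q.eqv (Suc 0) W X xs [(\<one>\<^bsub>R\<^esub>, J, Ext \<iota>, u)]"
  using xs
proof (induction rule: Pos.Q.FS_induct)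
  case Nil
  interpret N: module R "Val E W J" using val_module ob W by blast
  have "Pos.Q.eqv (Suc 0) W X [(\<one>\<^bsub>R\<^esub>, J, Ext \<iota>, \<zero>\<^bsub>R\<^esub> \<odot>\<^bsub>Val E W J\<^esub> \<zero>\<^bsub>Val E W J\<^esub>)]
      [(\<one>\<^bsub>R\<^esub> \<otimes>\<^bsub>R\<^esub> \<zero>\<^bsub>R\<^esub>, J, Ext \<iota>, \<zero>\<^bsub>Val E W J\<^esub>)]"
    using ob \<iota> by (intro coend_eq.right_smult) auto
  also have "\<one>\<^bsub>R\<^esub> \<otimes>\<^bsub>R\<^esub> \<zero>\<^bsub>R\<^esub> = \<zero>\<^bsub>R\<^esub>" by simp
  also have "Pos.Q.eqv (Suc 0) W X [(\<zero>\<^bsub>R\<^esub>, J, Ext \<iota>, \<zero>\<^bsub>Val E W J\<^esub>)] []"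
    using ob \<iota> by (intro coend_eq.coeff_zero) auto
  finally show ?case using Pos.Q.eqv_sym by (metis N.smult_l_null N.M.zero_closed)
next
  case (Cons r M \<rho> \<mu> xs)
  then obtain u where u: "u \<in> el E W J" "Pos.Q.eqv (Suc 0) W X xs [(\<one>\<^bsub>R\<^esub>, J, Ext \<iota>, u)]" by blast
  obtain \<epsilon> where e: "\<epsilon> \<in> el E M X" "\<rho> = Ext \<epsilon>" using Cons by (auto simp: Pos.el_Epos)
  obtain c where c: "c \<in> mor C M J" "Pull E M J X c \<iota> = \<epsilon>" using pull_iota_onto Cons e by metis
  let ?v = "Push E W M J c \<mu>"
  have v: "?v \<in> el E W J" using push_closed ob W c Cons by blast
  let ?w = "r \<odot>\<^bsub>Val E W J\<^esub> ?v"
  have w: "?w \<in> el E W J" using v val_smult_closed ob W Cons by blast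
  have "Pos.Q.eqv (Suc 0) W X [(r, M, Pull (Epos R C E (Suc 0)) M J X c (Ext \<iota>), \<mu>)] [(r, J, Ext \<iota>, ?v)]"
    using ob W c Cons \<iota> by (intro coend_eq.dinatural) auto
  moreover have "Pos.Q.eqv (Suc 0) W X [(\<one>\<^bsub>R\<^esub>, J, Ext \<iota>, ?w)] [(\<one>\<^bsub>R\<^esub> \<otimes>\<^bsub>R\<^esub> r, J, Ext \<iota>, ?v)]"
    using ob W v Cons \<iota> by (intro coend_eq.right_smult) auto
  ultimately have "Pos.Q.eqv (Suc 0) W X [(r, M, \<rho>, \<mu>)] [(\<one>\<^bsub>R\<^esub>, J, Ext \<iota>, ?w)]"
    using Cons c e by (simp) (blast intro: Pos.Q.eqv_trans Pos.Q.eqv_sym)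
  from Pos.Q.eqv_append[OF this u(2)]
  have "Pos.Q.eqv (Suc 0) W X ((r, M, \<rho>, \<mu>) # xs) [(\<one>\<^bsub>R\<^esub>, J, Ext \<iota>, ?w), (\<one>\<^bsub>R\<^esub>, J, Ext \<iota>, u)]" by simp
  also have "Pos.Q.eqv (Suc 0) W X \<dots> [(\<one>\<^bsub>R\<^esub>, J, Ext \<iota>, ?w \<oplus>\<^bsub>Val E W J\<^esub> u)]"
    using ob W u w \<iota> by (intro Pos.Q.eqv_sym[OF coend_eq.right_add]) auto
  finally show ?case using val_add_closed u w ob W by blast
qed

text \<open>
  The inverse sends \<open>c\<^sup>*\<iota> \<otimes> \<mu>\<close> to \<open>c\<^sub>*\<mu>\<close>; two choices of \<open>c\<close> differ by a morphism through \<open>I\<close>, and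
  \<open>E(W, I) = 0\<close>.
\<close>

lemma cup_iota_bij_1:
  assumes W: "W \<in> Ob C"
  shows "bij_betw (cup_left R C E (Suc 0) W J X \<iota>) (el (Epos R C E (Suc 0)) W J) (el (Epos R C E (Suc (Suc 0))) W X)"
proof -
  define f where "f M \<epsilon> = (SOME c. c \<in> mor C M J \<and> Pull E M J X c \<iota> = \<epsilon>)" for M \<epsilon>
  have f: "f M \<epsilon> \<in> mor C M J" "Pull E M J X (f M \<epsilon>) \<iota> = \<epsilon>" if "M \<in> Ob C" "\<epsilon> \<in> el E M X" for M \<epsilon>
    using someI_ex[of "\<lambda>c. c \<in> mor C M J \<and> Pull E M J X c \<iota> = \<epsilon>"] pull_iota_onto[OF that]
    unfolding f_def by blast+
  define h where "h M \<rho> \<mu> = Push E W M J (f M (the_ext \<rho>)) \<mu>"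
    for M \<mu> and \<rho> :: "('r, 'o, 'm, 'e) pext"
  have h: "h M (Ext \<epsilon>) \<mu> = Push E W M J c \<mu>"
    if "M \<in> Ob C" "\<mu> \<in> el E W M" "\<epsilon> \<in> el E M X" "c \<in> mor C M J" "Pull E M J X c \<iota> = \<epsilon>" for M \<epsilon> \<mu> c
    unfolding h_def using push_independent f that W by (metis pext.sel(2))
  have inv: "coend_eval (Val E W J) h xs = coend_eval (Val E W J) h ys"
    if "Pos.Q.eqv (Suc 0) W X xs ys" for xs ys
  proof (rule Pos.Q.coend_eval_eqv[OF val_module W ob(1) _ _ _ that])
    show "W \<in> Ob C" "J \<in> Ob C" using ob W by auto
    show "h M \<rho> \<in> lin_maps R (Val E W M) (Val E W J)" if "M \<in> Ob C" "\<rho> \<in> el (Epos R C E (Suc 0)) M X" for M \<rho>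
      unfolding h_def using push_linear f that ob W by (auto simp: Pos.el_Epos)
    show "(\<lambda>\<rho>. h M \<rho> \<mu>) \<in> lin_maps R (Val (Epos R C E (Suc 0)) M X) (Val E W J)"
      if M: "M \<in> Ob C" "\<mu> \<in> el E W M" for M \<mu>
    proof (rule lin_mapsI)
      show "h M \<rho> \<mu> \<in> el E W J" if "\<rho> \<in> el (Epos R C E (Suc 0)) M X" for \<rho>
        unfolding h_def using push_closed ob W M that f by (auto simp: Pos.el_Epos)
      show "h M (\<rho> \<oplus>\<^bsub>Val (Epos R C E (Suc 0)) M X\<^esub> \<sigma>) \<mu> = h M \<rho> \<mu> \<oplus>\<^bsub>Val E W J\<^esub> h M \<sigma> \<mu>"
        if mn: "\<rho> \<in> el (Epos R C E (Suc 0)) M X" "\<sigma> \<in> el (Epos R C E (Suc 0)) M X" for \<rho> \<sigma>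
      proof -
        obtain \<epsilon> \<eta> where e: "\<rho> = Ext \<epsilon>" "\<sigma> = Ext \<eta>" "\<epsilon> \<in> el E M X" "\<eta> \<in> el E M X"
          using mn by (auto simp: Pos.el_Epos)
        have "h M (Ext (\<epsilon> \<oplus>\<^bsub>Val E M X\<^esub> \<eta>)) \<mu> = Push E W M J (f M \<epsilon> \<oplus>\<^bsub>Hom C M J\<^esub> f M \<eta>) \<mu>"
          by (rule h) (use e M f ob \<iota> in \<open>auto simp: val_add_closed pull_mor_add module_add_closed[OF hom_module]\<close>)
        then show ?thesis using push_mor_add f e M ob W by (simp add: h_def Epos.simps)
      qed
      show "h M (t \<odot>\<^bsub>Val (Epos R C E (Suc 0)) M X\<^esub> \<rho>) \<mu> = t \<odot>\<^bsub>Val E W J\<^esub> h M \<rho> \<mu>"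
        if mn: "t \<in> carrier R" "\<rho> \<in> el (Epos R C E (Suc 0)) M X" for t \<rho>
      proof -
        obtain \<epsilon> where e: "\<rho> = Ext \<epsilon>" "\<epsilon> \<in> el E M X" using mn by (auto simp: Pos.el_Epos)
        have "h M (Ext (t \<odot>\<^bsub>Val E M X\<^esub> \<epsilon>)) \<mu> = Push E W M J (t \<odot>\<^bsub>Hom C M J\<^esub> f M \<epsilon>) \<mu>"
          by (rule h) (use mn e M f ob \<iota> in \<open>auto simp: val_smult_closed pull_mor_smult module_smult_closed[OF hom_module]\<close>)
        then show ?thesis using push_mor_smult f e mn(1) M ob W by (simp add: h_def Epos.simps)
      qed
    qed
    show "h M (Pull (Epos R C E (Suc 0)) M M' X m \<rho>) \<mu> = h M' \<rho> (Push E W M M' m \<mu>)"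
      if M: "M \<in> Ob C" "M' \<in> Ob C" "m \<in> mor C M M'" "\<rho> \<in> el (Epos R C E (Suc 0)) M' X" "\<mu> \<in> el E W M" for M M' m \<rho> \<mu>
    proof -
      obtain \<epsilon> where e: "\<rho> = Ext \<epsilon>" "\<epsilon> \<in> el E M' X" using M by (auto simp: Pos.el_Epos)
      have "h M (Ext (Pull E M M' X m \<epsilon>)) \<mu> = Push E W M J (Cmp C M M' J (f M' \<epsilon>) m) \<mu>"
        by (rule h) (use e M f ob \<iota> in \<open>auto simp: pull_closed comp_closed pull_comp\<close>)
      also have "\<dots> = h M' \<rho> (Push E W M M' m \<mu>)"
        unfolding h_def e using M e f ob W by (simp add: push_comp)
      finally show ?thesis using e by simp
    qed
  qed
  have ev: "coend_eval (Val E W J) h [(\<one>\<^bsub>R\<^esub>, J, Ext \<iota>, u)] = u" if u: "u \<in> el E W J" for u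
  proof -
    interpret N: module R "Val E W J" using val_module ob W by blast
    have "h J (Ext \<iota>) u = Push E W J J (Idm C J) u" by (rule h) (use u ob \<iota> in \<open>auto simp: id_mor pull_id\<close>)
    then show ?thesis using u ob W by (simp add: push_id)
  qed
  have "inj_on (cup_left R C E (Suc 0) W J X \<iota>) (el (Epos R C E (Suc 0)) W J)"
  proof (rule inj_onI)
    fix u v assume uv: "u \<in> el (Epos R C E (Suc 0)) W J" "v \<in> el (Epos R C E (Suc 0)) W J"
      "cup_left R C E (Suc 0) W J X \<iota> u = cup_left R C E (Suc 0) W J X \<iota> v"
    then obtain \<mu> \<nu> where e: "u = Ext \<mu>" "v = Ext \<nu>" "\<mu> \<in> el E W J" "\<nu> \<in> el E W J" by (auto simp: Pos.el_Epos)
    have "Pos.Q.eqv (Suc 0) W X [(\<one>\<^bsub>R\<^esub>, J, Ext \<iota>, \<mu>)] [(\<one>\<^bsub>R\<^esub>, J, Ext \<iota>, \<nu>)]"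
      by (rule Pos.Q.rep_eqD) (use uv e ob \<iota> in auto)
    from inv[OF this] show "u = v" using ev e by metis
  qed
  moreover have "cup_left R C E (Suc 0) W J X \<iota> ` el (Epos R C E (Suc 0)) W J = el (Epos R C E (Suc (Suc 0))) W X"
  proof
    show "cup_left R C E (Suc 0) W J X \<iota> ` el (Epos R C E (Suc 0)) W J \<subseteq> el (Epos R C E (Suc (Suc 0))) W X"
      using Pos.cup_left_closed ob W \<iota> by blast
    show "el (Epos R C E (Suc (Suc 0))) W X \<subseteq> cup_left R C E (Suc 0) W J X \<iota> ` el (Epos R C E (Suc 0)) W J"
    proof
      fix w assume "w \<in> el (Epos R C E (Suc (Suc 0))) W X"
      then obtain xs where xs: "xs \<in> Pos.Q.FS (Suc 0) W X" "w = Pos.cls (Suc 0) W X xs" by (auto simp: Pos.el_Epos)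
      then obtain u where u: "u \<in> el E W J" "Pos.Q.eqv (Suc 0) W X xs [(\<one>\<^bsub>R\<^esub>, J, Ext \<iota>, u)]"
        using cup_iota_onto[OF W xs(1)] by blast
      then have "w = cup_left R C E (Suc 0) W J X \<iota> (Ext u)" using Pos.Q.rep_cong[OF u(2)] xs(2) by simp
      then show "w \<in> cup_left R C E (Suc 0) W J X \<iota> ` el (Epos R C E (Suc 0)) W J"
        using u(1) by (intro image_eqI[of _ _ "Ext u"]) auto
    qed
  qed
  ultimately show ?thesis by (simp add: bij_betw_def)
qed

text \<open>
  The coends split off an extension on the right, so left multiplication by \<open>\<iota>\<close> in degree \<open>n + 1\<close> is the map
  induced on coends by the bijection of degree \<open>n\<close>; an induction replaces the direct argument.
\<close>

theorem cup_iota_bij: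
  assumes W: "W \<in> Ob C"
  shows "bij_betw (cup_left R C E (Suc n) W J X \<iota>) (el (Epos R C E (Suc n)) W J) (el (Epos R C E (Suc (Suc n))) W X)"
  using W
proof (induction n arbitrary: W)
  case 0
  then show ?case by (rule cup_iota_bij_1)
next
  case (Suc n)
  let ?h = "\<lambda>xs. coend_rep R C (Epos R C E (Suc (Suc n))) E W X
      (fsum_map (\<lambda>r. r) (\<lambda>M. cup_left R C E (Suc n) M J X \<iota>) (\<lambda>M \<mu>. \<mu>) xs)"
  have b: "bij_betw ?h (el (coend R C (Epos R C E (Suc n)) E) W J) (el (coend R C (Epos R C E (Suc (Suc n))) E) W X)"
    by (rule coend_map_bij[OF Pos.coend_map_cup_left]) (use Suc ob \<iota> in auto)
  have cu: "bij_betw the_cls (Cls ` A) A" and uc: "bij_betw Cls A (Cls ` A)" for A :: "('r \<times> 'o \<times> ('r, 'o, 'm, 'e) pext \<times> 'e) list set"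
    by (auto simp: bij_betw_def inj_on_def image_image)
  have "bij_betw (Cls \<circ> (?h \<circ> the_cls)) (el (Epos R C E (Suc (Suc n))) W J) (el (Epos R C E (Suc (Suc (Suc n)))) W X)"
    using bij_betw_trans[OF bij_betw_trans[OF cu b] uc] by (simp add: Epos.simps comp_def)
  moreover have "Cls \<circ> (?h \<circ> the_cls) = cup_left R C E (Suc (Suc n)) W J X \<iota>"
    by (auto simp: Pos.cup_left_Suc_Suc)
  ultimately show ?case by simp
qed

end

section \<open>Opposite categories\<close>

text \<open>
  Transformations of contravariant functors are transformations of covariant functors on the opposite
  category, and \<open>neg_II\<close> is in this way the opposite of \<open>neg_I\<close>; general facts about \<open>neg_II\<close> are
  obtained from those about \<open>neg_I\<close>.
\<close>

definition op_cat :: "('r, 'o, 'm) lincat \<Rightarrow> ('r, 'o, 'm) lincat" where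
  "op_cat C = \<lparr>Ob = Ob C, Hom = (\<lambda>X Y. Hom C Y X), Idm = Idm C,
    Cmp = (\<lambda>X Y Z g f. Cmp C Z Y X f g)\<rparr>"

definition op_bif :: "('r, 'o, 'm, 'x) bifunctor \<Rightarrow> ('r, 'o, 'm, 'x) bifunctor" where
  "op_bif F = \<lparr>Val = (\<lambda>X Y. Val F Y X), Push = (\<lambda>X Y Y' a. Pull F Y' Y X a),
    Pull = (\<lambda>X' X Y c. Push F Y X X' c)\<rparr>"

lemma op_simps [simp]:
  "Ob (op_cat C) = Ob C" "Hom (op_cat C) X Y = Hom C Y X" "Idm (op_cat C) = Idm C"
  "Cmp (op_cat C) X Y Z g f = Cmp C Z Y X f g"
  "Val (op_bif F) X Y = Val F Y X" "Push (op_bif F) X Y Y' a = Pull F Y' Y X a"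
  "Pull (op_bif F) X' X Y c = Push F Y X X' c"
  by (simp_all add: op_cat_def op_bif_def)

lemma op_op [simp]: "op_cat (op_cat C) = C" "op_bif (op_bif F) = F"
  by (simp_all add: op_cat_def op_bif_def)

lemma linear_category_op:
  assumes "linear_category R C"
  shows "linear_category R (op_cat C)"
proof -
  interpret linear_category R C by fact
  show ?thesis
    by (intro linear_category.intro linear_category_axioms.intro is_cring)
      (simp_all add: hom_module id_mor comp_linear_left comp_linear_right comp_assoc id_left id_right)
qed

lemma bilinear_functor_op:
  assumes "bilinear_functor R C F"
  shows "bilinear_functor R (op_cat C) (op_bif F)"
proof -
  interpret bilinear_functor R C F by fact
  show ?thesis
    by (intro bilinear_functor.intro bilinear_functor_axioms.intro linear_category_op linear_category_axioms)
      (simp_all add: val_module push_linear pull_linear push_linear_mor pull_linear_mor push_id pull_id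
        push_comp pull_comp push_pull)
qed

lemma nat_trans_contra_op: "nat_trans_contra R C F D G A = nat_trans_cov R (op_cat C) (op_bif F) D (op_bif G) A"
  unfolding nat_trans_contra_def nat_trans_cov_def by auto

lemma neg_II_op: "neg_II R C F G = op_bif (neg_I R (op_cat C) (op_bif F) (op_bif G))"
  by (simp add: neg_II_def neg_I_def op_bif_def nat_trans_contra_op[unfolded op_bif_def])

section \<open>Functors of natural transformations\<close>

text \<open>
  Transformations are extensional families, so every family has to be restricted to the objects and
  elements on which it is meaningful.
\<close>

definition fam :: "('r, 'o, 'm) lincat \<Rightarrow> ('r, 'o, 'm, 'x) bifunctor \<Rightarrow> 'o \<Rightarrow> ('o \<Rightarrow> 'x \<Rightarrow> 'y) \<Rightarrow> 'o \<Rightarrow> 'x \<Rightarrow> 'y" where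
  "fam C F A h = (\<lambda>Y\<in>Ob C. \<lambda>u\<in>el F A Y. h Y u)"

lemma fam_apply [simp]: "\<lbrakk>Y \<in> Ob C; u \<in> el F A Y\<rbrakk> \<Longrightarrow> fam C F A h Y u = h Y u"
  by (simp add: fam_def)

lemma fam_cong: "(\<And>Y u. \<lbrakk>Y \<in> Ob C; u \<in> el F A Y\<rbrakk> \<Longrightarrow> h Y u = k Y u) \<Longrightarrow> fam C F A h = fam C F A k"
  unfolding fam_def by (intro restrict_ext) auto

lemma neg_I_simps [simp]:
  "el (neg_I R C F G) D A = nat_trans_cov R C F A G D"
  "\<zero>\<^bsub>Val (neg_I R C F G) D A\<^esub> = fam C F A (\<lambda>Y u. \<zero>\<^bsub>Val G D Y\<^esub>)"
  "\<phi> \<oplus>\<^bsub>Val (neg_I R C F G) D A\<^esub> \<chi> = fam C F A (\<lambda>Y u. \<phi> Y u \<oplus>\<^bsub>Val G D Y\<^esub> \<chi> Y u)"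
  "r \<odot>\<^bsub>Val (neg_I R C F G) D A\<^esub> \<phi> = fam C F A (\<lambda>Y u. r \<odot>\<^bsub>Val G D Y\<^esub> \<phi> Y u)"
  "Push (neg_I R C F G) D A A' a \<phi> = fam C F A' (\<lambda>Y u. \<phi> Y (Pull F A A' Y a u))"
  "Pull (neg_I R C F G) D' D A c \<phi> = fam C F A (\<lambda>Y u. Pull G D' D Y c (\<phi> Y u))"
  by (simp_all add: neg_I_def fam_def)

locale functor_pair = F: bilinear_functor R C F + G: bilinear_functor R C G
  for R :: "'r ring" and C :: "('r, 'o, 'm) lincat" and F :: "('r, 'o, 'm, 'x) bifunctor"
    and G :: "('r, 'o, 'm, 'y) bifunctor"
begin

abbreviation NT where "NT A D \<equiv> nat_trans_cov R C F A G D"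

lemma NT_I:
  assumes "A \<in> Ob C" "D \<in> Ob C"
    and "\<And>Y. Y \<in> Ob C \<Longrightarrow> h Y \<in> lin_maps R (Val F A Y) (Val G D Y)"
    and "\<And>Y Y' a u. \<lbrakk>Y \<in> Ob C; Y' \<in> Ob C; a \<in> mor C Y Y'; u \<in> el F A Y\<rbrakk>
      \<Longrightarrow> h Y' (Push F A Y Y' a u) = Push G D Y Y' a (h Y u)"
  shows "fam C F A h \<in> NT A D"
  unfolding nat_trans_cov_def
proof (intro CollectI conjI ballI)
  show "fam C F A h \<in> (\<Pi>\<^sub>E Y\<in>Ob C. el F A Y \<rightarrow>\<^sub>E el G D Y)"
    using assms(3) lin_maps_closed unfolding fam_def by fastforce
  show "fam C F A h Y \<in> lin_maps R (Val F A Y) (Val G D Y)" if "Y \<in> Ob C" for Y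
    by (rule lin_maps_cong[OF F.val_module assms(3)]) (use assms that in auto)
  show "fam C F A h Y' (Push F A Y Y' a u) = Push G D Y Y' a (fam C F A h Y u)"
    if "Y \<in> Ob C" "Y' \<in> Ob C" "a \<in> mor C Y Y'" "u \<in> el F A Y" for Y Y' a u
    using that assms by (simp add: F.push_closed)
qed

lemma NT_linear: "\<lbrakk>\<phi> \<in> NT A D; Y \<in> Ob C\<rbrakk> \<Longrightarrow> \<phi> Y \<in> lin_maps R (Val F A Y) (Val G D Y)"
  by (simp add: nat_trans_cov_def)

lemma NT_closed: "\<lbrakk>\<phi> \<in> NT A D; Y \<in> Ob C; u \<in> el F A Y\<rbrakk> \<Longrightarrow> \<phi> Y u \<in> el G D Y"
  by (rule lin_maps_closed[OF NT_linear])

lemma NT_natural: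
  "\<lbrakk>\<phi> \<in> NT A D; Y \<in> Ob C; Y' \<in> Ob C; a \<in> mor C Y Y'; u \<in> el F A Y\<rbrakk>
    \<Longrightarrow> \<phi> Y' (Push F A Y Y' a u) = Push G D Y Y' a (\<phi> Y u)"
  by (simp add: nat_trans_cov_def)

lemma NT_fam: "\<phi> \<in> NT A D \<Longrightarrow> fam C F A \<phi> = \<phi>"
proof -
  assume "\<phi> \<in> NT A D"
  then have p: "\<phi> \<in> (\<Pi>\<^sub>E Y\<in>Ob C. el F A Y \<rightarrow>\<^sub>E el G D Y)" by (simp add: nat_trans_cov_def)
  show ?thesis
  proof
    fix Y show "fam C F A \<phi> Y = \<phi> Y"
    proof (cases "Y \<in> Ob C")
      case True
      then have "\<phi> Y \<in> el F A Y \<rightarrow>\<^sub>E el G D Y" by (rule PiE_mem[OF p])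
      from PiE_restrict[OF this] show ?thesis using True by (simp add: fam_def)
    next
      case False
      then show ?thesis using PiE_arb[OF p False] by (simp add: fam_def)
    qed
  qed
qed

lemma NT_ext:
  assumes "\<phi> \<in> NT A D" "\<chi> \<in> NT A D" "\<And>Y u. \<lbrakk>Y \<in> Ob C; u \<in> el F A Y\<rbrakk> \<Longrightarrow> \<phi> Y u = \<chi> Y u"
  shows "\<phi> = \<chi>"
proof -
  have "fam C F A \<phi> = fam C F A \<chi>" by (rule fam_cong) (rule assms(3))
  then show ?thesis using NT_fam assms by metis
qed

lemma NT_fam_eqI:
  assumes "\<phi> \<in> NT A D" "\<And>Y u. \<lbrakk>Y \<in> Ob C; u \<in> el F A Y\<rbrakk> \<Longrightarrow> h Y u = \<phi> Y u"
  shows "fam C F A h = \<phi>"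
  using fam_cong[of C F A h \<phi>] assms NT_fam by metis

lemma NT_zero: "\<lbrakk>A \<in> Ob C; D \<in> Ob C\<rbrakk> \<Longrightarrow> fam C F A (\<lambda>Y u. \<zero>\<^bsub>Val G D Y\<^esub>) \<in> NT A D"
proof (rule NT_I)
  fix Y assume o: "A \<in> Ob C" "D \<in> Ob C" "Y \<in> Ob C"
  interpret N: module R "Val G D Y" using G.val_module o by blast
  show "(\<lambda>u. \<zero>\<^bsub>Val G D Y\<^esub>) \<in> lin_maps R (Val F A Y) (Val G D Y)"
    by (rule lin_mapsI) auto
qed (simp_all add: G.push_zero)

lemma NT_add:
  assumes "A \<in> Ob C" "D \<in> Ob C" "\<phi> \<in> NT A D" "\<chi> \<in> NT A D"
  shows "fam C F A (\<lambda>Y u. \<phi> Y u \<oplus>\<^bsub>Val G D Y\<^esub> \<chi> Y u) \<in> NT A D"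
proof (rule NT_I)
  fix Y assume Y: "Y \<in> Ob C"
  interpret N: module R "Val G D Y" using G.val_module assms Y by blast
  show "(\<lambda>u. \<phi> Y u \<oplus>\<^bsub>Val G D Y\<^esub> \<chi> Y u) \<in> lin_maps R (Val F A Y) (Val G D Y)"
    by (rule lin_mapsI)
      (use assms Y in \<open>simp_all add: NT_closed lin_maps_add[OF NT_linear] lin_maps_smult[OF NT_linear]
        N.M.a_ac N.smult_r_distr\<close>)
qed (use assms in \<open>simp_all add: NT_natural G.push_add NT_closed\<close>)

lemma NT_smult:
  assumes "A \<in> Ob C" "D \<in> Ob C" "\<phi> \<in> NT A D" "r \<in> carrier R"
  shows "fam C F A (\<lambda>Y u. r \<odot>\<^bsub>Val G D Y\<^esub> \<phi> Y u) \<in> NT A D"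
proof (rule NT_I)
  fix Y assume Y: "Y \<in> Ob C"
  interpret N: module R "Val G D Y" using G.val_module assms Y by blast
  show "(\<lambda>u. r \<odot>\<^bsub>Val G D Y\<^esub> \<phi> Y u) \<in> lin_maps R (Val F A Y) (Val G D Y)"
    by (rule lin_mapsI)
      (use assms Y in \<open>simp_all add: NT_closed lin_maps_add[OF NT_linear] lin_maps_smult[OF NT_linear]
        N.smult_r_distr N.smult_assoc1[symmetric] F.m_comm\<close>)
qed (use assms in \<open>simp_all add: NT_natural G.push_smult NT_closed\<close>)

lemma NT_push:
  assumes "A \<in> Ob C" "A' \<in> Ob C" "D \<in> Ob C" "\<phi> \<in> NT A D" "a \<in> mor C A A'"
  shows "fam C F A' (\<lambda>Y u. \<phi> Y (Pull F A A' Y a u)) \<in> NT A' D"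
proof (rule NT_I)
  show "(\<lambda>u. \<phi> Y (Pull F A A' Y a u)) \<in> lin_maps R (Val F A' Y) (Val G D Y)" if "Y \<in> Ob C" for Y
    by (rule lin_maps_comp[OF F.pull_linear NT_linear]) (use assms that in auto)
qed (use assms in \<open>simp_all add: F.push_pull[symmetric] NT_natural F.pull_closed\<close>)

lemma NT_pull:
  assumes "A \<in> Ob C" "D \<in> Ob C" "D' \<in> Ob C" "\<phi> \<in> NT A D" "c \<in> mor C D' D"
  shows "fam C F A (\<lambda>Y u. Pull G D' D Y c (\<phi> Y u)) \<in> NT A D'"
proof (rule NT_I)
  show "(\<lambda>u. Pull G D' D Y c (\<phi> Y u)) \<in> lin_maps R (Val F A Y) (Val G D' Y)" if "Y \<in> Ob C" for Y
    by (rule lin_maps_comp[OF NT_linear G.pull_linear]) (use assms that in auto)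
qed (use assms in \<open>simp_all add: G.push_pull NT_natural NT_closed\<close>)

lemma module_neg_I:
  assumes ob: "D \<in> Ob C" "A \<in> Ob C"
  shows "module R (Val (neg_I R C F G) D A)"
proof -
  have N: "module R (Val G D Y)" if "Y \<in> Ob C" for Y using G.val_module ob that by blast
  note ab = module.axioms(2)[OF N] 
  note mon = abelian_group.axioms(1)[OF ab]
  show ?thesis
  proof (rule moduleI)
    show "cring R" ..
    show "abelian_group (Val (neg_I R C F G) D A)"
    proof (rule abelian_groupI)
      fix \<phi> \<chi> \<xi> assume p: "\<phi> \<in> el (neg_I R C F G) D A" "\<chi> \<in> el (neg_I R C F G) D A"
      then show "\<phi> \<oplus>\<^bsub>Val (neg_I R C F G) D A\<^esub> \<chi> \<in> el (neg_I R C F G) D A"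
        using ob by (simp add: NT_add)
      show "\<phi> \<oplus>\<^bsub>Val (neg_I R C F G) D A\<^esub> \<chi> = \<chi> \<oplus>\<^bsub>Val (neg_I R C F G) D A\<^esub> \<phi>"
        using p ob by (auto intro!: fam_cong abelian_monoid.a_comm[OF mon] NT_closed)
      assume x: "\<xi> \<in> el (neg_I R C F G) D A"
      show "\<phi> \<oplus>\<^bsub>Val (neg_I R C F G) D A\<^esub> \<chi> \<oplus>\<^bsub>Val (neg_I R C F G) D A\<^esub> \<xi>
          = \<phi> \<oplus>\<^bsub>Val (neg_I R C F G) D A\<^esub> (\<chi> \<oplus>\<^bsub>Val (neg_I R C F G) D A\<^esub> \<xi>)"
        using p x ob by (auto intro!: fam_cong abelian_monoid.a_assoc[OF mon] NT_closed)
    next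
      show "\<zero>\<^bsub>Val (neg_I R C F G) D A\<^esub> \<in> el (neg_I R C F G) D A" using ob by (simp add: NT_zero)
    next
      fix \<phi> assume p: "\<phi> \<in> el (neg_I R C F G) D A"
      then show "\<zero>\<^bsub>Val (neg_I R C F G) D A\<^esub> \<oplus>\<^bsub>Val (neg_I R C F G) D A\<^esub> \<phi> = \<phi>"
        using ob by (auto intro!: NT_fam_eqI abelian_monoid.l_zero[OF mon] NT_closed)
      have q: "fam C F A (\<lambda>Y u. (\<ominus>\<^bsub>R\<^esub> \<one>\<^bsub>R\<^esub>) \<odot>\<^bsub>Val G D Y\<^esub> \<phi> Y u) \<in> NT A D"
        using p ob by (intro NT_smult) auto
      have "(\<ominus>\<^bsub>R\<^esub> \<one>\<^bsub>R\<^esub>) \<odot>\<^bsub>Val G D Y\<^esub> v \<oplus>\<^bsub>Val G D Y\<^esub> v = \<zero>\<^bsub>Val G D Y\<^esub>" if "Y \<in> Ob C" "v \<in> el G D Y" for Y v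
      proof -
        interpret N: module R "Val G D Y" using N that by blast
        show ?thesis using that by (simp add: N.smult_l_minus N.M.l_neg)
      qed
      then show "\<exists>\<chi>\<in>el (neg_I R C F G) D A. \<chi> \<oplus>\<^bsub>Val (neg_I R C F G) D A\<^esub> \<phi> = \<zero>\<^bsub>Val (neg_I R C F G) D A\<^esub>"
        using p by (intro bexI[OF _ q[folded neg_I_simps(1)]]) (auto intro!: fam_cong simp: NT_closed)
    qed
  next
    fix a \<phi> assume "a \<in> carrier R" "\<phi> \<in> el (neg_I R C F G) D A"
    then show "a \<odot>\<^bsub>Val (neg_I R C F G) D A\<^esub> \<phi> \<in> el (neg_I R C F G) D A"
      using ob by (simp add: NT_smult)
  next
    fix a b \<phi> assume p: "a \<in> carrier R" "b \<in> carrier R" "\<phi> \<in> el (neg_I R C F G) D A"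
    show "(a \<oplus>\<^bsub>R\<^esub> b) \<odot>\<^bsub>Val (neg_I R C F G) D A\<^esub> \<phi>
        = a \<odot>\<^bsub>Val (neg_I R C F G) D A\<^esub> \<phi> \<oplus>\<^bsub>Val (neg_I R C F G) D A\<^esub> b \<odot>\<^bsub>Val (neg_I R C F G) D A\<^esub> \<phi>"
      using p ob by (auto intro!: fam_cong module.smult_l_distr[OF N] NT_closed)
    show "(a \<otimes>\<^bsub>R\<^esub> b) \<odot>\<^bsub>Val (neg_I R C F G) D A\<^esub> \<phi>
        = a \<odot>\<^bsub>Val (neg_I R C F G) D A\<^esub> (b \<odot>\<^bsub>Val (neg_I R C F G) D A\<^esub> \<phi>)"
      using p ob by (auto intro!: fam_cong module.smult_assoc1[OF N] NT_closed)
  next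
    fix a \<phi> \<chi> assume p: "a \<in> carrier R" "\<phi> \<in> el (neg_I R C F G) D A" "\<chi> \<in> el (neg_I R C F G) D A"
    show "a \<odot>\<^bsub>Val (neg_I R C F G) D A\<^esub> (\<phi> \<oplus>\<^bsub>Val (neg_I R C F G) D A\<^esub> \<chi>)
        = a \<odot>\<^bsub>Val (neg_I R C F G) D A\<^esub> \<phi> \<oplus>\<^bsub>Val (neg_I R C F G) D A\<^esub> a \<odot>\<^bsub>Val (neg_I R C F G) D A\<^esub> \<chi>"
      using p ob by (auto intro!: fam_cong module.smult_r_distr[OF N] NT_closed)
  next
    fix \<phi> assume p: "\<phi> \<in> el (neg_I R C F G) D A"
    then show "\<one>\<^bsub>R\<^esub> \<odot>\<^bsub>Val (neg_I R C F G) D A\<^esub> \<phi> = \<phi>"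
      using ob by (auto intro!: NT_fam_eqI module.smult_one[OF N] NT_closed)
  qed
qed

theorem bilinear_functor_neg_I: "bilinear_functor R C (neg_I R C F G)"
proof (intro bilinear_functor.intro bilinear_functor_axioms.intro F.linear_category_axioms module_neg_I)
  fix D A A' a assume o: "D \<in> Ob C" "A \<in> Ob C" "A' \<in> Ob C" "a \<in> mor C A A'"
  show "Push (neg_I R C F G) D A A' a \<in> lin_maps R (Val (neg_I R C F G) D A) (Val (neg_I R C F G) D A')"
    by (rule lin_mapsI) (use o in \<open>auto simp: NT_push F.pull_closed intro!: fam_cong\<close>)
next
  fix D' D A c assume o: "D' \<in> Ob C" "D \<in> Ob C" "A \<in> Ob C" "c \<in> mor C D' D"
  show "Pull (neg_I R C F G) D' D A c \<in> lin_maps R (Val (neg_I R C F G) D A) (Val (neg_I R C F G) D' A)"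
    by (rule lin_mapsI)
      (use o in \<open>auto simp: NT_pull G.pull_add G.pull_smult NT_closed intro!: fam_cong\<close>)
next
  fix D A A' \<phi> assume o: "D \<in> Ob C" "A \<in> Ob C" "A' \<in> Ob C" "\<phi> \<in> el (neg_I R C F G) D A"
  show "(\<lambda>a. Push (neg_I R C F G) D A A' a \<phi>) \<in> lin_maps R (Hom C A A') (Val (neg_I R C F G) D A')"
    by (rule lin_mapsI)
      (use o in \<open>auto simp: NT_push F.pull_mor_add F.pull_mor_smult F.pull_closed lin_maps_add[OF NT_linear]
        lin_maps_smult[OF NT_linear] intro!: fam_cong\<close>)
next
  fix D' D A \<phi> assume o: "D' \<in> Ob C" "D \<in> Ob C" "A \<in> Ob C" "\<phi> \<in> el (neg_I R C F G) D A"
  show "(\<lambda>c. Pull (neg_I R C F G) D' D A c \<phi>) \<in> lin_maps R (Hom C D' D) (Val (neg_I R C F G) D' A)"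
    by (rule lin_mapsI)
      (use o in \<open>auto simp: NT_pull G.pull_mor_add G.pull_mor_smult NT_closed intro!: fam_cong\<close>)
next
  fix D A \<phi> assume o: "D \<in> Ob C" "A \<in> Ob C" "\<phi> \<in> el (neg_I R C F G) D A"
  then show "Push (neg_I R C F G) D A A (Idm C A) \<phi> = \<phi>" "Pull (neg_I R C F G) D D A (Idm C D) \<phi> = \<phi>"
    by (auto intro!: NT_fam_eqI simp: F.pull_id G.pull_id NT_closed)
next
  fix D A A' A'' a a' \<phi>
  assume "D \<in> Ob C" "A \<in> Ob C" "A' \<in> Ob C" "A'' \<in> Ob C" "a \<in> mor C A A'" "a' \<in> mor C A' A''"
    "\<phi> \<in> el (neg_I R C F G) D A"
  then show "Push (neg_I R C F G) D A A'' (Cmp C A A' A'' a' a) \<phi>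
      = Push (neg_I R C F G) D A' A'' a' (Push (neg_I R C F G) D A A' a \<phi>)"
    by (auto intro!: fam_cong simp: F.pull_comp F.pull_closed)
next
  fix D'' D' D A c' c \<phi>
  assume "D'' \<in> Ob C" "D' \<in> Ob C" "D \<in> Ob C" "A \<in> Ob C" "c' \<in> mor C D'' D'" "c \<in> mor C D' D"
    "\<phi> \<in> el (neg_I R C F G) D A"
  then show "Pull (neg_I R C F G) D'' D A (Cmp C D'' D' D c c') \<phi>
      = Pull (neg_I R C F G) D'' D' A c' (Pull (neg_I R C F G) D' D A c \<phi>)"
    by (auto intro!: fam_cong simp: G.pull_comp NT_closed)
next
  fix D' D A A' c a \<phi>
  assume "D' \<in> Ob C" "D \<in> Ob C" "A \<in> Ob C" "A' \<in> Ob C" "c \<in> mor C D' D" "a \<in> mor C A A'"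
    "\<phi> \<in> el (neg_I R C F G) D A"
  then show "Push (neg_I R C F G) D' A A' a (Pull (neg_I R C F G) D' D A c \<phi>)
      = Pull (neg_I R C F G) D' D A' c (Push (neg_I R C F G) D A A' a \<phi>)"
    by (auto intro!: fam_cong simp: F.pull_closed)
qed

lemma functor_pair_op: "functor_pair R (op_cat C) (op_bif F) (op_bif G)"
  by (intro functor_pair.intro bilinear_functor_op F.bilinear_functor_axioms G.bilinear_functor_axioms)

theorem bilinear_functor_neg_II: "bilinear_functor R C (neg_II R C F G)"
proof -
  interpret op: functor_pair R "op_cat C" "op_bif F" "op_bif G" by (rule functor_pair_op)
  show ?thesis
    unfolding neg_II_op using bilinear_functor_op[OF op.bilinear_functor_neg_I] by simp
qed

end

text \<open>
  In negative degrees both connecting maps precompose a transformation with a cup product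
  \<open>c Y : F(A, Y) \<rightarrow> F'(D, Y)\<close>. Only the linearity and naturality of that cup product matter.
\<close>

locale precomposition = S: functor_pair R C F G + T: functor_pair R C F' G
  for R :: "'r ring" and C :: "('r, 'o, 'm) lincat" and F :: "('r, 'o, 'm, 'x) bifunctor"
    and F' :: "('r, 'o, 'm, 'z) bifunctor" and G :: "('r, 'o, 'm, 'y) bifunctor" +
  fixes A D :: 'o and c :: "'o \<Rightarrow> 'x \<Rightarrow> 'z"
  assumes objects: "A \<in> Ob C" "D \<in> Ob C"
    and c_linear: "\<And>Y. Y \<in> Ob C \<Longrightarrow> c Y \<in> lin_maps R (Val F A Y) (Val F' D Y)"
    and c_natural: "\<And>Y Y' a u. \<lbrakk>Y \<in> Ob C; Y' \<in> Ob C; a \<in> mor C Y Y'; u \<in> el F A Y\<rbrakk>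
      \<Longrightarrow> c Y' (Push F A Y Y' a u) = Push F' D Y Y' a (c Y u)"
begin

lemmas c_closed = lin_maps_closed[OF c_linear]

abbreviation pre where "pre \<phi> \<equiv> fam C F A (\<lambda>Y u. \<phi> Y (c Y u))"

lemma pre_closed: "\<lbrakk>X \<in> Ob C; \<phi> \<in> T.NT D X\<rbrakk> \<Longrightarrow> pre \<phi> \<in> S.NT A X"
proof (rule S.NT_I)
  show "(\<lambda>u. \<phi> Y (c Y u)) \<in> lin_maps R (Val F A Y) (Val G X Y)"
    if "\<phi> \<in> T.NT D X" "Y \<in> Ob C" for Y
    by (rule lin_maps_comp[OF c_linear T.NT_linear]) (use that in auto)
qed (simp_all add: objects c_natural T.NT_natural c_closed)

lemma pre_linear:
  "X \<in> Ob C \<Longrightarrow> pre \<in> lin_maps R (Val (neg_I R C F' G) X D) (Val (neg_I R C F G) X A)"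
  by (rule lin_mapsI) (auto simp: pre_closed c_closed intro!: fam_cong)

lemma pre_bij:
  assumes X: "X \<in> Ob C" and bij: "\<And>Y. Y \<in> Ob C \<Longrightarrow> bij_betw (c Y) (el F A Y) (el F' D Y)"
  shows "bij_betw pre (T.NT D X) (S.NT A X)"
proof -
  define d where "d Y = inv_into (el F A Y) (c Y)" for Y
  have d1: "d Y (c Y u) = u" if "Y \<in> Ob C" "u \<in> el F A Y" for Y u
    unfolding d_def using bij_betw_inv_into_left[OF bij] that by blast
  have d2: "c Y (d Y u) = u" "d Y u \<in> el F A Y" if "Y \<in> Ob C" "u \<in> el F' D Y" for Y u
    unfolding d_def using bij_betw_inv_into_right[OF bij] bij_betw_inv_into[OF bij] bij_betwE that by blast+
  interpret op: precomposition R C F' F G D A d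
  proof (intro precomposition.intro precomposition_axioms.intro S.functor_pair_axioms T.functor_pair_axioms)
    show "d Y \<in> lin_maps R (Val F' D Y) (Val F A Y)" if "Y \<in> Ob C" for Y
      unfolding d_def using lin_maps_inv_into S.F.val_module c_linear bij that objects by blast
    show "d Y' (Push F' D Y Y' a u) = Push F A Y Y' a (d Y u)"
      if "Y \<in> Ob C" "Y' \<in> Ob C" "a \<in> mor C Y Y'" "u \<in> el F' D Y" for Y Y' a u
      using that d1 d2 c_natural S.F.push_closed objects by metis
  qed (use objects in auto)
  show ?thesis
  proof (rule bij_betw_byWitness[where f'=op.pre])
    show "\<forall>\<phi>\<in>T.NT D X. op.pre (pre \<phi>) = \<phi>" by (auto intro!: T.NT_fam_eqI simp: d2)
    show "\<forall>\<phi>\<in>S.NT A X. pre (op.pre \<phi>) = \<phi>" by (auto intro!: S.NT_fam_eqI simp: d1 c_closed)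
  qed (use X pre_closed op.pre_closed in auto)
qed

end

section \<open>Extension functors of all integer degrees\<close>

lemma int_cases_neg:
  fixes n :: int
  obtains (nonneg) k where "n = int k" | (minus1) "n = - 1" | (neg) k where "n = - int (Suc (Suc k))"
proof -
  have "n \<ge> 0 \<or> n = - 1 \<or> n \<le> - 2" by linarith
  then show ?thesis
  proof (elim disjE)
    assume "n \<ge> 0" then show ?thesis using nonneg[of "nat n"] by simp
  next
    assume "n \<le> - 2" then show ?thesis using neg[of "nat (- n - 2)"] by simp
  qed (rule minus1)
qed

lemma bij_betw_conjugate:
  assumes "bij_betw h A B" "\<And>u. j (i u) = u" "\<And>u. j' (i' u) = u"
  shows "bij_betw (\<lambda>z. i' (h (j z))) (i ` A) (i' ` B)"
proof -
  have "inj_on (\<lambda>z. i' (h (j z))) (i ` A)"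
    using assms by (auto simp: bij_betw_def inj_on_def) metis
  moreover have "(\<lambda>z. i' (h (j z))) ` i ` A = i' ` B"
    using assms by (auto simp: bij_betw_def image_image)
  ultimately show ?thesis by (simp add: bij_betw_def)
qed

lemma fam_op: "fam (op_cat C) (op_bif F) A h = (\<lambda>X\<in>Ob C. \<lambda>u\<in>el F X A. h X u)"
  by (simp add: fam_def)

lemma (in functor_pair) eval_linear:
  assumes "A \<in> Ob C" "D \<in> Ob C" "Y \<in> Ob C" "u \<in> el F A Y"
  shows "(\<lambda>\<phi>. \<phi> Y u) \<in> lin_maps R (Val (neg_I R C F G) D A) (Val G D Y)"
  by (rule lin_mapsI) (use assms in \<open>auto simp: NT_closed\<close>)

text \<open>
  If \<open>F(A, -)\<close> is generated by \<open>\<omega>\<close> in \<open>F(A, Q)\<close>, it is a quotient of the representable functor at \<open>Q\<close>, and a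
  transformation out of it is, by Yoneda, an element of \<open>G(D, Q)\<close> annihilated by every morphism that
  annihilates \<open>\<omega>\<close>.
\<close>

lemma (in functor_pair) NT_generated:
  assumes ob: "A \<in> Ob C" "D \<in> Ob C" "Q \<in> Ob C" and \<omega>: "\<omega> \<in> el F A Q"
    and onto: "\<And>Z \<epsilon>. \<lbrakk>Z \<in> Ob C; \<epsilon> \<in> el F A Z\<rbrakk> \<Longrightarrow> \<exists>b. b \<in> mor C Q Z \<and> Push F A Q Z b \<omega> = \<epsilon>"
  shows "bij_betw (\<lambda>\<phi>. \<phi> Q \<omega>) (NT A D)
    {u \<in> el G D Q. \<forall>Z\<in>Ob C. \<forall>b\<in>mor C Q Z.
      Push F A Q Z b \<omega> = \<zero>\<^bsub>Val F A Z\<^esub> \<longrightarrow> Push G D Q Z b u = \<zero>\<^bsub>Val G D Z\<^esub>}" (is "bij_betw _ _ ?K")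
proof (rule bij_betw_imageI)
  have det: "\<phi> Z (Push F A Q Z b \<omega>) = Push G D Q Z b (\<phi> Q \<omega>)"
    if "\<phi> \<in> NT A D" "Z \<in> Ob C" "b \<in> mor C Q Z" for \<phi> Z b
    using that ob \<omega> by (intro NT_natural)
  show "inj_on (\<lambda>\<phi>. \<phi> Q \<omega>) (NT A D)"
  proof (rule inj_onI)
    fix \<phi> \<chi> assume pc: "\<phi> \<in> NT A D" "\<chi> \<in> NT A D" "\<phi> Q \<omega> = \<chi> Q \<omega>"
    show "\<phi> = \<chi>"
    proof (rule NT_ext[OF pc(1,2)])
      fix Z u assume Z: "Z \<in> Ob C" "u \<in> el F A Z"
      then obtain b where "b \<in> mor C Q Z" "Push F A Q Z b \<omega> = u" using onto by blast
      then show "\<phi> Z u = \<chi> Z u" using det[OF pc(1) Z(1)] det[OF pc(2) Z(1)] pc(3) by auto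
    qed
  qed
  show "(\<lambda>\<phi>. \<phi> Q \<omega>) ` NT A D = ?K"
  proof (intro equalityI subsetI)
    fix u assume "u \<in> (\<lambda>\<phi>. \<phi> Q \<omega>) ` NT A D"
    then obtain \<phi> where p: "\<phi> \<in> NT A D" "u = \<phi> Q \<omega>" by blast
    have "Push G D Q Z b u = \<zero>\<^bsub>Val G D Z\<^esub>"
      if b: "Z \<in> Ob C" "b \<in> mor C Q Z" "Push F A Q Z b \<omega> = \<zero>\<^bsub>Val F A Z\<^esub>" for Z b
      using det[OF p(1) b(1,2)] p(2) b
        lin_maps_zero[OF F.val_module[OF ob(1) b(1)] G.val_module[OF ob(2) b(1)] NT_linear[OF p(1) b(1)]]
      by simp
    then show "u \<in> ?K" using p NT_closed ob \<omega> by auto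
  next
    fix u assume u: "u \<in> ?K"
    then have uG: "u \<in> el G D Q" by simp
    define c where "c Z \<epsilon> = (SOME b. b \<in> mor C Q Z \<and> Push F A Q Z b \<omega> = \<epsilon>)" for Z \<epsilon>
    have c: "c Z \<epsilon> \<in> mor C Q Z" "Push F A Q Z (c Z \<epsilon>) \<omega> = \<epsilon>" if "Z \<in> Ob C" "\<epsilon> \<in> el F A Z" for Z \<epsilon>
      using someI_ex[OF onto[OF that]] unfolding c_def by blast+
    have indep: "Push G D Q Z (c Z \<epsilon>) u = Push G D Q Z a u"
      if z: "Z \<in> Ob C" "\<epsilon> \<in> el F A Z" "a \<in> mor C Q Z" "Push F A Q Z a \<omega> = \<epsilon>" for Z \<epsilon> a
    proof -
      let ?d = "c Z \<epsilon> \<ominus>\<^bsub>Hom C Q Z\<^esub> a"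
      have "Push F A Q Z ?d \<omega> = \<zero>\<^bsub>Val F A Z\<^esub>"
        using z ob \<omega> c[OF z(1,2)] by (simp add: F.push_mor_minus F.val_minus_self)
      then have "Push G D Q Z ?d u = \<zero>\<^bsub>Val G D Z\<^esub>"
        using u z ob c[OF z(1,2)] F.mor_minus_closed by blast
      then show ?thesis
        using z ob c[OF z(1,2)] uG
        by - (rule module_minus_eq_zero[OF G.val_module[OF ob(2) z(1)]], simp_all add: G.push_mor_minus G.push_closed)
    qed
    let ?h = "\<lambda>Z \<epsilon>. Push G D Q Z (c Z \<epsilon>) u"
    have "fam C F A ?h \<in> NT A D"
    proof (rule NT_I[OF ob(1,2)])
      fix Z assume Z: "Z \<in> Ob C"
      show "?h Z \<in> lin_maps R (Val F A Z) (Val G D Z)"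
      proof (rule lin_mapsI)
        show "?h Z \<epsilon> \<in> el G D Z" if "\<epsilon> \<in> el F A Z" for \<epsilon>
          using c[OF Z that] uG Z ob by (simp add: G.push_closed)
      next
        fix \<epsilon> \<eta> assume e: "\<epsilon> \<in> el F A Z" "\<eta> \<in> el F A Z"
        have "?h Z (\<epsilon> \<oplus>\<^bsub>Val F A Z\<^esub> \<eta>) = Push G D Q Z (c Z \<epsilon> \<oplus>\<^bsub>Hom C Q Z\<^esub> c Z \<eta>) u"
          by (rule indep)
            (use e c Z ob \<omega> in \<open>auto simp: F.val_add_closed F.push_mor_add module_add_closed[OF F.hom_module]\<close>)
        then show "?h Z (\<epsilon> \<oplus>\<^bsub>Val F A Z\<^esub> \<eta>) = ?h Z \<epsilon> \<oplus>\<^bsub>Val G D Z\<^esub> ?h Z \<eta>"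
          by (simp add: G.push_mor_add c e Z ob uG)
      next
        fix t \<epsilon> assume e: "t \<in> carrier R" "\<epsilon> \<in> el F A Z"
        have "?h Z (t \<odot>\<^bsub>Val F A Z\<^esub> \<epsilon>) = Push G D Q Z (t \<odot>\<^bsub>Hom C Q Z\<^esub> c Z \<epsilon>) u"
          by (rule indep)
            (use e c Z ob \<omega> in \<open>auto simp: F.val_smult_closed F.push_mor_smult module_smult_closed[OF F.hom_module]\<close>)
        then show "?h Z (t \<odot>\<^bsub>Val F A Z\<^esub> \<epsilon>) = t \<odot>\<^bsub>Val G D Z\<^esub> ?h Z \<epsilon>"
          by (simp add: G.push_mor_smult c e Z ob uG)
      qed
    next
      fix Z Z' a \<epsilon> assume Z: "Z \<in> Ob C" "Z' \<in> Ob C" "a \<in> mor C Z Z'" "\<epsilon> \<in> el F A Z"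
      have "?h Z' (Push F A Z Z' a \<epsilon>) = Push G D Q Z' (Cmp C Q Z Z' a (c Z \<epsilon>)) u"
        by (rule indep) (use c Z ob \<omega> in \<open>auto simp: F.push_closed F.comp_closed F.push_comp\<close>)
      then show "?h Z' (Push F A Z Z' a \<epsilon>) = Push G D Z Z' a (?h Z \<epsilon>)"
        using c Z ob uG by (simp add: G.push_comp)
    qed
    moreover have "fam C F A ?h Q \<omega> = u"
      using indep[OF ob(3) \<omega> F.id_mor[OF ob(3)]] ob \<omega> uG by (simp add: F.push_id G.push_id)
    ultimately show "u \<in> (\<lambda>\<phi>. \<phi> Q \<omega>) ` NT A D" by (intro image_eqI[of _ _ "fam C F A ?h"]) auto
  qed
qed

context ext_data
begin

abbreviation "NI n \<equiv> neg_I R C (EE n) (EE 0)"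
abbreviation "NII n \<equiv> neg_II R C (EE n) (EE 0)"
abbreviation "FI \<equiv> EI R C E"
abbreviation "FII \<equiv> EII R C E"
abbreviation "sI \<equiv> sharp_I R C E"
abbreviation "sII \<equiv> sharp_II R C E"

lemma EI_simps:
  "FI (int k) = transport NonNeg the_nonneg (EE k)"
  "FI (- int (Suc k)) = transport Neg the_neg (NI (Suc k))"
  "FII (int k) = transport NonNeg the_nonneg (EE k)"
  "FII (- int (Suc k)) = transport Neg the_neg (NII (Suc k))"
  by (simp_all add: EI_def EII_def nat_add_distrib)

lemma EI_simps_small:
  "FI 0 = transport NonNeg the_nonneg (EE 0)"
  "FI (- 1) = transport Neg the_neg (NI (Suc 0))"
  "FII 0 = transport NonNeg the_nonneg (EE 0)"
  "FII (- 1) = transport Neg the_neg (NII (Suc 0))"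
  using EI_simps[of 0] by simp_all

lemma EI_eq_EII: "n \<ge> 0 \<Longrightarrow> FI n = FII n"
  by (simp add: EI_def EII_def)

lemma functor_pair_Epos: "functor_pair R C (EE n) (EE m)"
  by (intro functor_pair.intro bilinear_functor_Epos)

lemma functor_pair_Epos_op: "functor_pair R (op_cat C) (op_bif (EE n)) (op_bif (EE m))"
  by (intro functor_pair.intro bilinear_functor_op bilinear_functor_Epos)

lemma bilinear_functor_EI: "bilinear_functor R C (FI n)"
  unfolding EI_def
  by (auto intro!: bilinear_functor_transport bilinear_functor_Epos
      functor_pair.bilinear_functor_neg_I[OF functor_pair_Epos])

lemma bilinear_functor_EII: "bilinear_functor R C (FII n)"
  unfolding EII_def
  by (auto intro!: bilinear_functor_transport bilinear_functor_Epos
      functor_pair.bilinear_functor_neg_II[OF functor_pair_Epos])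

lemma sharp_I_int: "sI (int k) X D A \<delta> = (\<lambda>z. NonNeg (cup_left R C E k X D A \<delta> (the_nonneg z)))"
  by (auto simp: sharp_I_def)

lemma sharp_I_minus1:
  "\<lbrakk>D \<in> Ob C; A \<in> Ob C; \<delta> \<in> el E D A\<rbrakk> \<Longrightarrow> sI (- 1) X D A \<delta> = (\<lambda>z. NonNeg (the_neg z A (Ext \<delta>)))"
  by (auto simp: sharp_I_def E.push_id)

lemma sharp_I_neg:
  "sI (- int (Suc (Suc k))) X D A \<delta>
    = (\<lambda>z. Neg (fam C (EE (Suc k)) A (\<lambda>Y u. the_neg z Y (cup_right R C E (Suc k) D A Y \<delta> u))))"
proof -
  have "nat (- (- int (Suc (Suc k)) + 1)) = Suc k" by simp
  then show ?thesis by (auto simp: sharp_I_def fam_def simp del: cup_right.simps)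
qed

lemma sharp_II_int: "sII (int k) D A Y \<delta> = (\<lambda>z. NonNeg (cup_right R C E k D A Y \<delta> (the_nonneg z)))"
  by (auto simp: sharp_II_def)

lemma sharp_II_minus1:
  "\<lbrakk>D \<in> Ob C; A \<in> Ob C; \<delta> \<in> el E D A\<rbrakk> \<Longrightarrow> sII (- 1) D A Y \<delta> = (\<lambda>z. NonNeg (the_neg z D (Ext \<delta>)))"
  by (auto simp: sharp_II_def E.pull_id)

lemma sharp_II_neg:
  "sII (- int (Suc (Suc k))) D A Y \<delta>
    = (\<lambda>z. Neg (fam (op_cat C) (op_bif (EE (Suc k))) D (\<lambda>X u. the_neg z X (cup_left R C E (Suc k) X D A \<delta> u))))"
proof -
  have "nat (- (- int (Suc (Suc k)) + 1)) = Suc k" by simp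
  then show ?thesis by (auto simp: sharp_II_def fam_op)
qed

lemma degree_succ:
  "int k + 1 = int (Suc k)" "- int (Suc (Suc k)) + 1 = - int (Suc k)" "(- 1 :: int) + 1 = 0"
  by simp_all

lemma precomposition_cup_right:
  assumes "D \<in> Ob C" "A \<in> Ob C" "\<delta> \<in> el E D A"
  shows "precomposition R C (EE n) (EE (Suc n)) (EE 0) A D (\<lambda>Y. cup_right R C E n D A Y \<delta>)"
  by (intro precomposition.intro precomposition_axioms.intro functor_pair_Epos cup_right_linear cup_right_push assms)

lemma precomposition_cup_left:
  assumes "D \<in> Ob C" "A \<in> Ob C" "\<delta> \<in> el E D A"
  shows "precomposition R (op_cat C) (op_bif (EE n)) (op_bif (EE (Suc n))) (op_bif (EE 0)) D A (\<lambda>X. cup_left R C E n X D A \<delta>)"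
  by (intro precomposition.intro precomposition_axioms.intro functor_pair_Epos_op)
    (use assms in \<open>simp_all add: cup_left_linear cup_left_pull\<close>)

lemma sharp_I_linear:
  assumes ob: "X \<in> Ob C" "D \<in> Ob C" "A \<in> Ob C" and d: "\<delta> \<in> el E D A"
  shows "sI n X D A \<delta> \<in> lin_maps R (Val (FI n) X D) (Val (FI (n + 1)) X A)"
proof (cases n rule: int_cases_neg)
  case (nonneg k)
  show ?thesis unfolding nonneg degree_succ EI_simps sharp_I_int transport_simps
    by (rule lin_maps_transport[OF cup_left_linear]) (use assms in auto)
next
  case minus1
  show ?thesis unfolding minus1 degree_succ EI_simps_small sharp_I_minus1[OF ob(2,3) d] transport_simps
    by (rule lin_maps_transport[OF functor_pair.eval_linear[OF functor_pair_Epos]]) (use assms in auto)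
next
  case (neg k)
  show ?thesis unfolding neg degree_succ EI_simps sharp_I_neg transport_simps
    by (rule lin_maps_transport[OF precomposition.pre_linear[OF precomposition_cup_right]]) (use assms in auto)
qed

lemma sharp_II_linear:
  assumes ob: "D \<in> Ob C" "A \<in> Ob C" "Y \<in> Ob C" and d: "\<delta> \<in> el E D A"
  shows "sII n D A Y \<delta> \<in> lin_maps R (Val (FII n) A Y) (Val (FII (n + 1)) D Y)"
proof (cases n rule: int_cases_neg)
  case (nonneg k)
  show ?thesis unfolding nonneg degree_succ EI_simps sharp_II_int transport_simps
    by (rule lin_maps_transport[OF cup_right_linear]) (use assms in auto)
next
  case minus1
  have "(\<lambda>\<phi>. \<phi> D (Ext \<delta>)) \<in> lin_maps R (Val (NII (Suc 0)) A Y) (Val (EE 0) D Y)"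
    using functor_pair.eval_linear[OF functor_pair_Epos_op, of A Y D "Ext \<delta>" "Suc 0" 0] assms
    by (simp add: neg_II_op)
  from lin_maps_transport[where i=Neg and j=the_neg and i'=NonNeg and j'=the_nonneg, OF this]
  show ?thesis unfolding minus1 degree_succ EI_simps_small sharp_II_minus1[OF ob(1,2) d] by simp
next
  case (neg k)
  note precomposition.pre_linear[OF precomposition_cup_left[OF ob(1,2) d, of "Suc k"], of Y]
  from lin_maps_transport[where i=Neg and j=the_neg and i'=Neg and j'=the_neg, OF this]
  show ?thesis unfolding neg degree_succ EI_simps sharp_II_neg using ob by (simp add: neg_II_op)
qed

lemmas sharp_I_closed = lin_maps_closed[OF sharp_I_linear]
lemmas sharp_II_closed = lin_maps_closed[OF sharp_II_linear]

lemma sharp_I_pull: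
  assumes ob: "X' \<in> Ob C" "X \<in> Ob C" "D \<in> Ob C" "A \<in> Ob C" and d: "\<delta> \<in> el E D A"
    and c: "c \<in> mor C X' X" and z: "z \<in> el (FI n) X D"
  shows "sI n X' D A \<delta> (Pull (FI n) X' X D c z) = Pull (FI (n + 1)) X' X A c (sI n X D A \<delta> z)"
proof (cases n rule: int_cases_neg)
  case (nonneg k)
  show ?thesis using z unfolding nonneg degree_succ EI_simps sharp_I_int
    using assms(1-6) by (auto simp: cup_left_pull)
next
  case minus1
  show ?thesis using z d unfolding minus1 degree_succ EI_simps_small sharp_I_minus1[OF ob(3,4) d]
    using ob by auto
next
  case (neg k)
  show ?thesis using z unfolding neg degree_succ EI_simps sharp_I_neg
    using assms(1-6) cup_right_closed by (auto simp del: cup_right.simps intro!: fam_cong)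
qed

lemma sharp_II_push:
  assumes ob: "D \<in> Ob C" "A \<in> Ob C" "Y \<in> Ob C" "Y' \<in> Ob C" and d: "\<delta> \<in> el E D A"
    and a: "a \<in> mor C Y Y'" and z: "z \<in> el (FII n) A Y"
  shows "sII n D A Y' \<delta> (Push (FII n) A Y Y' a z) = Push (FII (n + 1)) D Y Y' a (sII n D A Y \<delta> z)"
proof (cases n rule: int_cases_neg)
  case (nonneg k)
  show ?thesis using z unfolding nonneg degree_succ EI_simps sharp_II_int
    using assms(1-6) by (auto simp: cup_right_push simp del: cup_right.simps)
next
  case minus1
  show ?thesis using z d unfolding minus1 degree_succ EI_simps_small sharp_II_minus1[OF ob(1,2) d]
    using ob by (auto simp: neg_II_op)
next
  case (neg k)
  show ?thesis using z unfolding neg degree_succ EI_simps sharp_II_neg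
    using assms(1-6) cup_left_closed by (auto simp: neg_II_op intro!: fam_cong)
qed

lemma sharp_I_push_ext:
  assumes ob: "X \<in> Ob C" "D \<in> Ob C" "A \<in> Ob C" "A' \<in> Ob C" and d: "\<delta> \<in> el E D A"
    and b: "b \<in> mor C A A'" and z: "z \<in> el (FI n) X D"
  shows "sI n X D A' (Push E D A A' b \<delta>) z = Push (FI (n + 1)) X A A' b (sI n X D A \<delta> z)"
proof (cases n rule: int_cases_neg)
  case (nonneg k)
  show ?thesis using z unfolding nonneg degree_succ EI_simps sharp_I_int
    using assms(1-6) by (auto simp: cup_left_push_ext)
next
  case minus1
  interpret N: functor_pair R C "EE (Suc 0)" "EE 0" by (rule functor_pair_Epos)
  obtain \<phi> where p: "z = Neg \<phi>" "\<phi> \<in> N.NT D X" using z unfolding minus1 EI_simps_small by auto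
  have "\<phi> A' (Push (EE (Suc 0)) D A A' b (Ext \<delta>)) = Push (EE 0) X A A' b (\<phi> A (Ext \<delta>))"
    using p assms(1-6) by (intro N.NT_natural) auto
  then show ?thesis
    using assms(1-6) p(1) unfolding minus1 degree_succ EI_simps_small sharp_I_minus1[OF ob(2,3) d]
    by (simp add: sharp_I_minus1 E.push_closed)
next
  case (neg k)
  show ?thesis using z unfolding neg degree_succ EI_simps sharp_I_neg
    using assms(1-6) by (auto simp: cup_right_push_ext P.pull_closed simp del: cup_right.simps intro!: fam_cong)
qed

lemma sharp_II_pull_ext:
  assumes ob: "D' \<in> Ob C" "D \<in> Ob C" "A \<in> Ob C" "Y \<in> Ob C" and d: "\<delta> \<in> el E D A"
    and c: "c \<in> mor C D' D" and z: "z \<in> el (FII n) A Y"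
  shows "sII n D' A Y (Pull E D' D A c \<delta>) z = Pull (FII (n + 1)) D' D Y c (sII n D A Y \<delta> z)"
proof (cases n rule: int_cases_neg)
  case (nonneg k)
  show ?thesis using z unfolding nonneg degree_succ EI_simps sharp_II_int
    using assms(1-6) by (auto simp: cup_right_pull_ext simp del: cup_right.simps)
next
  case minus1
  interpret N: functor_pair R "op_cat C" "op_bif (EE (Suc 0))" "op_bif (EE 0)" by (rule functor_pair_Epos_op)
  obtain \<phi> where p: "z = Neg \<phi>" "\<phi> \<in> N.NT A Y" using z unfolding minus1 EI_simps_small by (auto simp: neg_II_op)
  have "\<phi> D' (Push (op_bif (EE (Suc 0))) A D D' c (Ext \<delta>)) = Push (op_bif (EE 0)) Y D D' c (\<phi> D (Ext \<delta>))"
    using p assms(1-6) by (intro N.NT_natural) auto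
  then show ?thesis
    using assms(1-6) p(1) unfolding minus1 degree_succ EI_simps_small sharp_II_minus1[OF ob(2,3) d]
    by (simp add: sharp_II_minus1 E.pull_closed)
next
  case (neg k)
  show ?thesis using z unfolding neg degree_succ EI_simps sharp_II_neg
    using assms(1-6) by (auto simp: neg_II_op cup_left_pull_ext P.push_closed intro!: fam_cong)
qed

lemma sharp_I_pull_ext:
  assumes ob: "X \<in> Ob C" "D' \<in> Ob C" "D \<in> Ob C" "A \<in> Ob C" and d: "\<delta> \<in> el E D A"
    and c: "c \<in> mor C D' D" and z: "z \<in> el (FI n) X D'"
  shows "sI n X D' A (Pull E D' D A c \<delta>) z = sI n X D A \<delta> (Push (FI n) X D' D c z)"
proof (cases n rule: int_cases_neg)
  case (nonneg k)
  show ?thesis using z unfolding nonneg degree_succ EI_simps sharp_I_int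
    using assms(1-6) by (auto simp: cup_left_pull_ext)
next
  case minus1
  show ?thesis using assms(1-6) unfolding minus1 degree_succ EI_simps_small
    by (simp add: sharp_I_minus1 E.pull_closed)
next
  case (neg k)
  show ?thesis using z unfolding neg degree_succ EI_simps sharp_I_neg
    using assms(1-6) cup_right_closed
    by (auto simp: cup_right_pull_ext simp del: cup_right.simps intro!: fam_cong)
qed

lemma sharp_II_push_ext:
  assumes ob: "D \<in> Ob C" "A \<in> Ob C" "A' \<in> Ob C" "Y \<in> Ob C" and d: "\<delta> \<in> el E D A"
    and b: "b \<in> mor C A A'" and z: "z \<in> el (FII n) A' Y"
  shows "sII n D A' Y (Push E D A A' b \<delta>) z = sII n D A Y \<delta> (Pull (FII n) A A' Y b z)"
proof (cases n rule: int_cases_neg)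
  case (nonneg k)
  show ?thesis using z unfolding nonneg degree_succ EI_simps sharp_II_int
    using assms(1-6) by (auto simp: cup_right_push_ext simp del: cup_right.simps)
next
  case minus1
  show ?thesis using assms(1-6) unfolding minus1 degree_succ EI_simps_small
    by (simp add: sharp_II_minus1 E.push_closed neg_II_op)
next
  case (neg k)
  show ?thesis using z unfolding neg degree_succ EI_simps sharp_II_neg
    using assms(1-6) cup_left_closed
    by (auto simp: neg_II_op cup_left_push_ext intro!: fam_cong)
qed

theorem sharps_commute_nonneg:
  assumes "n \<ge> 0" "W \<in> Ob C" "X \<in> Ob C" "Y \<in> Ob C" "Z \<in> Ob C" "\<delta> \<in> el E W X" "\<rho> \<in> el E Y Z" "z \<in> el (FI n) X Y"
  shows "sII (n + 1) W X Z \<delta> (sI n X Y Z \<rho> z) = sI (n + 1) W Y Z \<rho> (sII n W X Y \<delta> z)"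
proof -
  obtain k where k: "n = int k" using assms(1) nonneg_int_cases by blast
  show ?thesis using assms(8) unfolding k degree_succ EI_simps sharp_I_int sharp_II_int
    using cup_assoc[OF assms(2-7)] by auto
qed

end

section \<open>Dimension shifting in negative degrees\<close>

context projective_presentation
begin

theorem sharp_omega_bij:
  assumes X: "X \<in> Ob C" and n: "n \<le> - 2"
  shows "bij_betw (Pos.sI n X Y Q \<omega>) (el (Pos.FI n) X Y) (el (Pos.FI (n + 1)) X Q)"
proof -
  obtain k where k: "n = - int (Suc (Suc k))" using n by (cases n rule: int_cases_neg) auto
  have "bij_betw (\<lambda>\<phi>. fam C (Pos.EE (Suc k)) Q (\<lambda>Z u. \<phi> Z (cup_right R C E (Suc k) Y Q Z \<omega> u)))
      (el (Pos.NI (Suc (Suc k))) X Y) (el (Pos.NI (Suc k)) X Q)"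
    using precomposition.pre_bij[OF Pos.precomposition_cup_right[OF ob(3,1) \<omega>] X cup_omega_bij]
    by (simp del: cup_right.simps)
  from bij_betw_conjugate[where i=Neg and j=the_neg and i'=Neg and j'=the_neg, OF this]
  show ?thesis unfolding k Pos.degree_succ Pos.EI_simps Pos.sharp_I_neg by simp
qed

text \<open>
  A morphism out of \<open>Q\<close> that annihilates \<open>\<omega>\<close> factors through \<open>p\<close>, and \<open>p\<close> itself annihilates \<open>\<omega>\<close>.
\<close>

lemma annihilator_iff:
  assumes "X \<in> Ob C" "f \<in> mor C X Q"
  shows "(\<forall>Z\<in>Ob C. \<forall>b\<in>mor C Q Z. Push E Y Q Z b \<omega> = \<zero>\<^bsub>Val E Y Z\<^esub> \<longrightarrow> Cmp C X Q Z b f = \<zero>\<^bsub>Hom C X Z\<^esub>)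
    \<longleftrightarrow> Cmp C X Q G p f = \<zero>\<^bsub>Hom C X G\<^esub>"
proof (intro iffI ballI impI)
  fix Z b assume pf: "Cmp C X Q G p f = \<zero>\<^bsub>Hom C X G\<^esub>"
    and b: "Z \<in> Ob C" "b \<in> mor C Q Z" "Push E Y Q Z b \<omega> = \<zero>\<^bsub>Val E Y Z\<^esub>"
  obtain k where "k \<in> mor C G Z" "Cmp C Q G Z k p = b" using extend_along_inflation[OF tri b] by metis
  then show "Cmp C X Q Z b f = \<zero>\<^bsub>Hom C X Z\<^esub>"
    using assms b ob p pf comp_assoc[of X Q G Z f p k] by (auto simp: comp_zero_right)
qed (use push_inflation_zero[OF tri] ob p in blast)

text \<open>
  A transformation \<open>E(Y, -) \<rightarrow> C(X, -)\<close> is determined by the image \<open>f\<close> of \<open>\<omega>\<close>, and \<open>f\<close> may be any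
  morphism killed by \<open>p\<close>, since \<open>E(Y, -)\<close> is the cokernel of \<open>C(G, -) \<rightarrow> C(Q, -)\<close>.
\<close>

theorem sharp_omega_minus1:
  assumes X: "X \<in> Ob C"
  shows "bij_betw (Pos.sI (- 1) X Y Q \<omega>) (el (Pos.FI (- 1)) X Y)
    ((\<lambda>f. NonNeg (Mor f)) ` {f \<in> mor C X Q. Cmp C X Q G p f = \<zero>\<^bsub>Hom C X G\<^esub>})"
proof -
  interpret N: functor_pair R C "Pos.EE (Suc 0)" "Pos.EE 0" by (rule Pos.functor_pair_Epos)
  have "bij_betw (\<lambda>\<phi>. \<phi> Q (Ext \<omega>)) (N.NT Y X)
      {u \<in> el (Pos.EE 0) X Q. \<forall>Z\<in>Ob C. \<forall>b\<in>mor C Q Z.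
        Push (Pos.EE (Suc 0)) Y Q Z b (Ext \<omega>) = \<zero>\<^bsub>Val (Pos.EE (Suc 0)) Y Z\<^esub>
          \<longrightarrow> Push (Pos.EE 0) X Q Z b u = \<zero>\<^bsub>Val (Pos.EE 0) X Z\<^esub>}"
    by (rule N.NT_generated)
      (use X ob \<omega> in \<open>auto simp: Pos.el_Epos elim: push_omega_onto\<close>)
  also have "{u \<in> el (Pos.EE 0) X Q. \<forall>Z\<in>Ob C. \<forall>b\<in>mor C Q Z.
        Push (Pos.EE (Suc 0)) Y Q Z b (Ext \<omega>) = \<zero>\<^bsub>Val (Pos.EE (Suc 0)) Y Z\<^esub>
          \<longrightarrow> Push (Pos.EE 0) X Q Z b u = \<zero>\<^bsub>Val (Pos.EE 0) X Z\<^esub>}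
      = Mor ` {f \<in> mor C X Q. Cmp C X Q G p f = \<zero>\<^bsub>Hom C X G\<^esub>}"
    by (auto simp: Epos.simps annihilator_iff[OF X, symmetric])
  finally have "bij_betw (\<lambda>\<phi>. \<phi> Q (Ext \<omega>)) (N.NT Y X)
      (Mor ` {f \<in> mor C X Q. Cmp C X Q G p f = \<zero>\<^bsub>Hom C X G\<^esub>})" .
  from bij_betw_conjugate[where i=Neg and j=the_neg and i'=NonNeg and j'=the_nonneg, OF this]
  show ?thesis unfolding Pos.EI_simps_small Pos.sharp_I_minus1[OF ob(3,1) \<omega>] by (simp add: image_image)
qed

end

context injective_presentation
begin

text \<open>
  The dual statements come from the same lemmas on the opposite category.
\<close>

theorem sharp_iota_bij:
  assumes Y: "Y \<in> Ob C" and n: "n \<le> - 2"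
  shows "bij_betw (Pos.sII n J X Y \<iota>) (el (Pos.FII n) X Y) (el (Pos.FII (n + 1)) J Y)"
proof -
  obtain k where k: "n = - int (Suc (Suc k))" using n by (cases n rule: int_cases_neg) auto
  have "bij_betw (\<lambda>\<phi>. fam (op_cat C) (op_bif (Pos.EE (Suc k))) J (\<lambda>W u. \<phi> W (cup_left R C E (Suc k) W J X \<iota> u)))
      (el (Pos.NII (Suc (Suc k))) X Y) (el (Pos.NII (Suc k)) J Y)"
    using precomposition.pre_bij[OF Pos.precomposition_cup_left[OF ob(3,1) \<iota>], of Y "Suc k"] Y cup_iota_bij
    by (simp add: neg_II_op del: cup_left.simps)
  from bij_betw_conjugate[where i=Neg and j=the_neg and i'=Neg and j'=the_neg, OF this]
  show ?thesis unfolding k Pos.degree_succ Pos.EI_simps Pos.sharp_II_neg by simp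
qed

lemma annihilator_iff:
  assumes "Y \<in> Ob C" "f \<in> mor C J Y"
  shows "(\<forall>Z\<in>Ob C. \<forall>c\<in>mor C Z J. Pull E Z J X c \<iota> = \<zero>\<^bsub>Val E Z X\<^esub> \<longrightarrow> Cmp C Z J Y f c = \<zero>\<^bsub>Hom C Z Y\<^esub>)
    \<longleftrightarrow> Cmp C I J Y f i = \<zero>\<^bsub>Hom C I Y\<^esub>"
proof (intro iffI ballI impI)
  fix Z c assume fi: "Cmp C I J Y f i = \<zero>\<^bsub>Hom C I Y\<^esub>"
    and c: "Z \<in> Ob C" "c \<in> mor C Z J" "Pull E Z J X c \<iota> = \<zero>\<^bsub>Val E Z X\<^esub>"
  obtain k where "k \<in> mor C Z I" "Cmp C Z I J i k = c" using lift_along_deflation[OF tri c] by metis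
  then show "Cmp C Z J Y f c = \<zero>\<^bsub>Hom C Z Y\<^esub>"
    using assms c ob i fi comp_assoc[of Z I J Y k i f] by (auto simp: comp_zero_left)
qed (use pull_deflation_zero[OF tri] ob i in blast)

theorem sharp_iota_minus1:
  assumes Y: "Y \<in> Ob C"
  shows "bij_betw (Pos.sII (- 1) J X Y \<iota>) (el (Pos.FII (- 1)) X Y)
    ((\<lambda>f. NonNeg (Mor f)) ` {f \<in> mor C J Y. Cmp C I J Y f i = \<zero>\<^bsub>Hom C I Y\<^esub>})"
proof -
  interpret N: functor_pair R "op_cat C" "op_bif (Pos.EE (Suc 0))" "op_bif (Pos.EE 0)" by (rule Pos.functor_pair_Epos_op)
  have "bij_betw (\<lambda>\<phi>. \<phi> J (Ext \<iota>)) (N.NT X Y)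
      {u \<in> el (op_bif (Pos.EE 0)) Y J. \<forall>Z\<in>Ob (op_cat C). \<forall>c\<in>mor (op_cat C) J Z.
        Push (op_bif (Pos.EE (Suc 0))) X J Z c (Ext \<iota>) = \<zero>\<^bsub>Val (op_bif (Pos.EE (Suc 0))) X Z\<^esub>
          \<longrightarrow> Push (op_bif (Pos.EE 0)) Y J Z c u = \<zero>\<^bsub>Val (op_bif (Pos.EE 0)) Y Z\<^esub>}"
    by (rule N.NT_generated)
      (use Y ob \<iota> in \<open>auto simp: Pos.el_Epos elim: pull_iota_onto\<close>)
  also have "{u \<in> el (op_bif (Pos.EE 0)) Y J. \<forall>Z\<in>Ob (op_cat C). \<forall>c\<in>mor (op_cat C) J Z.
        Push (op_bif (Pos.EE (Suc 0))) X J Z c (Ext \<iota>) = \<zero>\<^bsub>Val (op_bif (Pos.EE (Suc 0))) X Z\<^esub>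
          \<longrightarrow> Push (op_bif (Pos.EE 0)) Y J Z c u = \<zero>\<^bsub>Val (op_bif (Pos.EE 0)) Y Z\<^esub>}
      = Mor ` {f \<in> mor C J Y. Cmp C I J Y f i = \<zero>\<^bsub>Hom C I Y\<^esub>}"
    by (auto simp: Epos.simps annihilator_iff[OF Y, symmetric])
  finally have "bij_betw (\<lambda>\<phi>. \<phi> J (Ext \<iota>)) (N.NT X Y)
      (Mor ` {f \<in> mor C J Y. Cmp C I J Y f i = \<zero>\<^bsub>Hom C I Y\<^esub>})" .
  from bij_betw_conjugate[where i=Neg and j=the_neg and i'=NonNeg and j'=the_nonneg, OF this]
  show ?thesis unfolding Pos.EI_simps_small Pos.sharp_II_minus1[OF ob(3,1) \<iota>]
    by (simp add: image_image neg_II_op)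
qed

end

section \<open>Natural isomorphisms\<close>

lemma nat_isosD:
  assumes "\<psi> \<in> nat_isos R C F G"
  shows nat_isos_linear: "\<And>X Y. \<lbrakk>X \<in> Ob C; Y \<in> Ob C\<rbrakk> \<Longrightarrow> \<psi> X Y \<in> lin_maps R (Val F X Y) (Val G X Y)"
    and nat_isos_bij: "\<And>X Y. \<lbrakk>X \<in> Ob C; Y \<in> Ob C\<rbrakk> \<Longrightarrow> bij_betw (\<psi> X Y) (el F X Y) (el G X Y)"
    and nat_isos_push: "\<And>X Y Y' a u. \<lbrakk>X \<in> Ob C; Y \<in> Ob C; Y' \<in> Ob C; a \<in> mor C Y Y'; u \<in> el F X Y\<rbrakk>
      \<Longrightarrow> \<psi> X Y' (Push F X Y Y' a u) = Push G X Y Y' a (\<psi> X Y u)"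
    and nat_isos_pull: "\<And>X' X Y c u. \<lbrakk>X' \<in> Ob C; X \<in> Ob C; Y \<in> Ob C; c \<in> mor C X' X; u \<in> el F X Y\<rbrakk>
      \<Longrightarrow> \<psi> X' Y (Pull F X' X Y c u) = Pull G X' X Y c (\<psi> X Y u)"
  using assms unfolding nat_isos_def by blast+

lemma nat_isos_closed:
  "\<lbrakk>\<psi> \<in> nat_isos R C F G; X \<in> Ob C; Y \<in> Ob C; u \<in> el F X Y\<rbrakk> \<Longrightarrow> \<psi> X Y u \<in> el G X Y"
  by (rule lin_maps_closed[OF nat_isos_linear])

lemma nat_isos_eqI:
  assumes "\<psi> \<in> nat_isos R C F G" "\<chi> \<in> nat_isos R C F G"
    and eq: "\<And>X Y z. \<lbrakk>X \<in> Ob C; Y \<in> Ob C; z \<in> el F X Y\<rbrakk> \<Longrightarrow> \<psi> X Y z = \<chi> X Y z"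
  shows "\<psi> = \<chi>"
proof -
  have ext: "\<xi> \<in> (\<Pi>\<^sub>E X\<in>Ob C. \<Pi>\<^sub>E Y\<in>Ob C. el F X Y \<rightarrow>\<^sub>E el G X Y)" if "\<xi> \<in> nat_isos R C F G" for \<xi>
    using that unfolding nat_isos_def by (elim CollectE conjE)
  note m = ext[OF assms(1)] ext[OF assms(2)]
  show ?thesis
  proof (rule PiE_ext[OF m])
    fix X assume X: "X \<in> Ob C"
    show "\<psi> X = \<chi> X"
    proof (rule PiE_ext[OF PiE_mem[OF m(1) X] PiE_mem[OF m(2) X]])
      fix Y assume Y: "Y \<in> Ob C"
      show "\<psi> X Y = \<chi> X Y"
        by (rule PiE_ext[OF PiE_mem[OF PiE_mem[OF m(1) X] Y] PiE_mem[OF PiE_mem[OF m(2) X] Y]])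
          (rule eq[OF X Y])
    qed
  qed
qed

lemma nat_isosI:
  assumes F: "bilinear_functor R C F"
    and lin: "\<And>X Y. \<lbrakk>X \<in> Ob C; Y \<in> Ob C\<rbrakk> \<Longrightarrow> h X Y \<in> lin_maps R (Val F X Y) (Val G X Y)"
    and bij: "\<And>X Y. \<lbrakk>X \<in> Ob C; Y \<in> Ob C\<rbrakk> \<Longrightarrow> bij_betw (h X Y) (el F X Y) (el G X Y)"
    and push: "\<And>X Y Y' a u. \<lbrakk>X \<in> Ob C; Y \<in> Ob C; Y' \<in> Ob C; a \<in> mor C Y Y'; u \<in> el F X Y\<rbrakk>
      \<Longrightarrow> h X Y' (Push F X Y Y' a u) = Push G X Y Y' a (h X Y u)"
    and pull: "\<And>X' X Y c u. \<lbrakk>X' \<in> Ob C; X \<in> Ob C; Y \<in> Ob C; c \<in> mor C X' X; u \<in> el F X Y\<rbrakk>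
      \<Longrightarrow> h X' Y (Pull F X' X Y c u) = Pull G X' X Y c (h X Y u)"
  shows "(\<lambda>X\<in>Ob C. \<lambda>Y\<in>Ob C. \<lambda>z\<in>el F X Y. h X Y z) \<in> nat_isos R C F G"
proof -
  interpret F: bilinear_functor R C F by (rule F)
  let ?\<psi> = "\<lambda>X\<in>Ob C. \<lambda>Y\<in>Ob C. \<lambda>z\<in>el F X Y. h X Y z"
  have "?\<psi> \<in> (\<Pi>\<^sub>E X\<in>Ob C. \<Pi>\<^sub>E Y\<in>Ob C. el F X Y \<rightarrow>\<^sub>E el G X Y)"
    by (intro restrict_PiE_iff[THEN iffD2] ballI lin_maps_closed[OF lin])
  moreover have "?\<psi> X Y \<in> lin_maps R (Val F X Y) (Val G X Y)" if "X \<in> Ob C" "Y \<in> Ob C" for X Y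
    by (rule lin_maps_cong[OF F.val_module lin]) (use that in auto)
  moreover have "bij_betw (?\<psi> X Y) (el F X Y) (el G X Y)" if "X \<in> Ob C" "Y \<in> Ob C" for X Y
    using bij[OF that] by (rule bij_betw_cong[THEN iffD1, rotated]) (use that in auto)
  ultimately show ?thesis
    unfolding nat_isos_def
    by (auto simp: F.push_closed F.pull_closed push pull)
qed

locale nat_iso = F: bilinear_functor R C F + G: bilinear_functor R C G
  for R :: "'r ring" and C :: "('r, 'o, 'm) lincat" and F :: "('r, 'o, 'm, 'x) bifunctor"
    and G :: "('r, 'o, 'm, 'y) bifunctor" +
  fixes \<psi> :: "'o \<Rightarrow> 'o \<Rightarrow> 'x \<Rightarrow> 'y"
  assumes iso: "\<psi> \<in> nat_isos R C F G"
begin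

abbreviation inv_\<psi> where "inv_\<psi> X Y \<equiv> inv_into (el F X Y) (\<psi> X Y)"

lemmas closed = nat_isos_closed[OF iso] and linear = nat_isos_linear[OF iso]
  and bij = nat_isos_bij[OF iso] and push = nat_isos_push[OF iso] and pull = nat_isos_pull[OF iso]

lemma inv_linear: "\<lbrakk>X \<in> Ob C; Y \<in> Ob C\<rbrakk> \<Longrightarrow> inv_\<psi> X Y \<in> lin_maps R (Val G X Y) (Val F X Y)"
  by (rule lin_maps_inv_into[OF F.val_module linear bij])

lemmas inv_closed = lin_maps_closed[OF inv_linear]

lemma inv_bij: "\<lbrakk>X \<in> Ob C; Y \<in> Ob C\<rbrakk> \<Longrightarrow> bij_betw (inv_\<psi> X Y) (el G X Y) (el F X Y)"
  by (rule bij_betw_inv_into[OF bij])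

lemma inv_left: "\<lbrakk>X \<in> Ob C; Y \<in> Ob C; u \<in> el F X Y\<rbrakk> \<Longrightarrow> inv_\<psi> X Y (\<psi> X Y u) = u"
  by (rule bij_betw_inv_into_left[OF bij])

lemma inv_right: "\<lbrakk>X \<in> Ob C; Y \<in> Ob C; u \<in> el G X Y\<rbrakk> \<Longrightarrow> \<psi> X Y (inv_\<psi> X Y u) = u"
  by (rule bij_betw_inv_into_right[OF bij])

lemma inv_push:
  assumes "X \<in> Ob C" "Y \<in> Ob C" "Y' \<in> Ob C" "a \<in> mor C Y Y'" "u \<in> el G X Y"
  shows "inv_\<psi> X Y' (Push G X Y Y' a u) = Push F X Y Y' a (inv_\<psi> X Y u)"
proof -
  have "\<psi> X Y' (Push F X Y Y' a (inv_\<psi> X Y u)) = Push G X Y Y' a u"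
    using assms by (simp add: push inv_closed inv_right)
  then show ?thesis using assms inv_left F.push_closed inv_closed by metis
qed

lemma inv_pull:
  assumes "X' \<in> Ob C" "X \<in> Ob C" "Y \<in> Ob C" "c \<in> mor C X' X" "u \<in> el G X Y"
  shows "inv_\<psi> X' Y (Pull G X' X Y c u) = Pull F X' X Y c (inv_\<psi> X Y u)"
proof -
  have "\<psi> X' Y (Pull F X' X Y c (inv_\<psi> X Y u)) = Pull G X' X Y c u"
    using assms by (simp add: pull inv_closed inv_right)
  then show ?thesis using assms inv_left F.pull_closed inv_closed by metis
qed

end

text \<open>
  A formula for the comparison isomorphism would depend on chosen presentations, and its naturality would
  be hard to see. A relation that is stated without choices is natural by inspection, and being a
  bijection on each component is then enough.
\<close>

lemma relation_nat_iso:
  assumes F: "bilinear_functor R C F" and G: "bilinear_functor R C G"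
    and ex_right: "\<And>X Y z. \<lbrakk>X \<in> Ob C; Y \<in> Ob C; z \<in> el F X Y\<rbrakk> \<Longrightarrow> \<exists>!w. w \<in> el G X Y \<and> T X Y z w"
    and ex_left: "\<And>X Y w. \<lbrakk>X \<in> Ob C; Y \<in> Ob C; w \<in> el G X Y\<rbrakk> \<Longrightarrow> \<exists>!z. z \<in> el F X Y \<and> T X Y z w"
    and add: "\<And>X Y z w z' w'. \<lbrakk>X \<in> Ob C; Y \<in> Ob C; z \<in> el F X Y; z' \<in> el F X Y; w \<in> el G X Y; w' \<in> el G X Y;
      T X Y z w; T X Y z' w'\<rbrakk> \<Longrightarrow> T X Y (z \<oplus>\<^bsub>Val F X Y\<^esub> z') (w \<oplus>\<^bsub>Val G X Y\<^esub> w')"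
    and smult: "\<And>X Y z w r. \<lbrakk>X \<in> Ob C; Y \<in> Ob C; z \<in> el F X Y; w \<in> el G X Y; r \<in> carrier R; T X Y z w\<rbrakk>
      \<Longrightarrow> T X Y (r \<odot>\<^bsub>Val F X Y\<^esub> z) (r \<odot>\<^bsub>Val G X Y\<^esub> w)"
    and push: "\<And>X Y Y' a z w. \<lbrakk>X \<in> Ob C; Y \<in> Ob C; Y' \<in> Ob C; a \<in> mor C Y Y'; z \<in> el F X Y; w \<in> el G X Y; T X Y z w\<rbrakk>
      \<Longrightarrow> T X Y' (Push F X Y Y' a z) (Push G X Y Y' a w)"
    and pull: "\<And>X' X Y c z w. \<lbrakk>X' \<in> Ob C; X \<in> Ob C; Y \<in> Ob C; c \<in> mor C X' X; z \<in> el F X Y; w \<in> el G X Y; T X Y z w\<rbrakk>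
      \<Longrightarrow> T X' Y (Pull F X' X Y c z) (Pull G X' X Y c w)"
  shows "\<exists>!\<psi>. \<psi> \<in> nat_isos R C F G \<and> (\<forall>X\<in>Ob C. \<forall>Y\<in>Ob C. \<forall>z\<in>el F X Y. T X Y z (\<psi> X Y z))"
proof -
  interpret F: bilinear_functor R C F by (rule F)
  interpret G: bilinear_functor R C G by (rule G)
  define h where "h X Y z = (THE w. w \<in> el G X Y \<and> T X Y z w)" for X Y z
  have h: "h X Y z \<in> el G X Y" "T X Y z (h X Y z)" if "X \<in> Ob C" "Y \<in> Ob C" "z \<in> el F X Y" for X Y z
    using theI'[OF ex_right[OF that]] unfolding h_def by blast+
  have hI: "h X Y z = w" if "X \<in> Ob C" "Y \<in> Ob C" "z \<in> el F X Y" "w \<in> el G X Y" "T X Y z w" for X Y z w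
    using ex_right[OF that(1-3)] h[OF that(1-3)] that(4,5) by blast
  have "(\<lambda>X\<in>Ob C. \<lambda>Y\<in>Ob C. \<lambda>z\<in>el F X Y. h X Y z) \<in> nat_isos R C F G"
  proof (rule nat_isosI[OF F])
    fix X Y assume ob: "X \<in> Ob C" "Y \<in> Ob C"
    show "h X Y \<in> lin_maps R (Val F X Y) (Val G X Y)"
      by (rule lin_mapsI; (intro hI)?)
        (use ob in \<open>auto simp: h add smult F.val_add_closed F.val_smult_closed G.val_add_closed G.val_smult_closed\<close>)
    show "bij_betw (h X Y) (el F X Y) (el G X Y)"
    proof (rule bij_betw_imageI)
      show "inj_on (h X Y) (el F X Y)"
      proof (rule inj_onI)
        fix z z' assume "z \<in> el F X Y" "z' \<in> el F X Y" "h X Y z = h X Y z'"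
        then show "z = z'" using h ex_left ob by metis
      qed
      show "h X Y ` el F X Y = el G X Y"
      proof (intro equalityI subsetI)
        fix w assume "w \<in> el G X Y"
        then obtain z where "z \<in> el F X Y" "T X Y z w" using ex_left[OF ob] by blast
        then show "w \<in> h X Y ` el F X Y" using hI ob \<open>w \<in> el G X Y\<close> by blast
      qed (use h ob in auto)
    qed
  next
    fix X Y Y' a z assume "X \<in> Ob C" "Y \<in> Ob C" "Y' \<in> Ob C" "a \<in> mor C Y Y'" "z \<in> el F X Y"
    then show "h X Y' (Push F X Y Y' a z) = Push G X Y Y' a (h X Y z)"
      by (intro hI push) (auto simp: h F.push_closed G.push_closed)
  next
    fix X' X Y c z assume "X' \<in> Ob C" "X \<in> Ob C" "Y \<in> Ob C" "c \<in> mor C X' X" "z \<in> el F X Y"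
    then show "h X' Y (Pull F X' X Y c z) = Pull G X' X Y c (h X Y z)"
      by (intro hI pull) (auto simp: h F.pull_closed G.pull_closed)
  qed
  moreover have "\<psi> = \<chi>"
    if "\<psi> \<in> nat_isos R C F G" "\<forall>X\<in>Ob C. \<forall>Y\<in>Ob C. \<forall>z\<in>el F X Y. T X Y z (\<psi> X Y z)"
      "\<chi> \<in> nat_isos R C F G" "\<forall>X\<in>Ob C. \<forall>Y\<in>Ob C. \<forall>z\<in>el F X Y. T X Y z (\<chi> X Y z)" for \<psi> \<chi>
    by (rule nat_isos_eqI[OF that(1,3)]) (use that ex_right nat_isos_closed in metis)
  ultimately show ?thesis
    by (intro ex_ex1I exI[of _ "\<lambda>X\<in>Ob C. \<lambda>Y\<in>Ob C. \<lambda>z\<in>el F X Y. h X Y z"]) (auto simp: h)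
qed

section \<open>Comparing the two presentations\<close>

text \<open>
  The use of (NI+): a morphism into \<open>Q\<close> that vanishes in \<open>G\<close> is \<open>\<omega>\<^sub>\<sharp> z\<close> for some \<open>z\<close>, and (NI+) makes \<open>z\<close> zero
  if \<open>\<omega>\<^sub>\<sharp> z\<close> is injective.
\<close>

lemma (in projective_presentation) no_injective_into_Q:
  assumes NI: "NI_plus R C E s" and Z: "Z \<in> Ob C"
    and f: "f \<in> inj_mors C E Z Q" "Cmp C Z Q G p f = \<zero>\<^bsub>Hom C Z G\<^esub>"
  shows "f = \<zero>\<^bsub>Hom C Z Q\<^esub>"
proof -
  have "f \<in> mor C Z Q" using f(1) by (simp add: inj_mors_def)
  then have "NonNeg (Mor f) \<in> Pos.sI (- 1) Z Y Q \<omega> ` el (Pos.FI (- 1)) Z Y"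
    using bij_betw_imp_surj_on[OF sharp_omega_minus1[OF Z]] f(2) by auto
  then obtain z where z: "z \<in> el (Pos.FI (- 1)) Z Y" "Pos.sI (- 1) Z Y Q \<omega> z = NonNeg (Mor f)" by auto
  then have "z \<in> {z \<in> el (Pos.FI (- 1)) Z Y. Pos.sI (- 1) Z Y Q \<omega> z \<in> (\<lambda>f. NonNeg (Mor f)) ` inj_mors C E Z Q}"
    using f(1) by auto
  then have "z = \<zero>\<^bsub>Val (Pos.FI (- 1)) Z Y\<^esub>"
    using NI dominant Z ob unfolding NI_plus_def by blast
  moreover have "Pos.sI (- 1) Z Y Q \<omega> \<zero>\<^bsub>Val (Pos.FI (- 1)) Z Y\<^esub> = \<zero>\<^bsub>Val (Pos.FI (- 1 + 1)) Z Q\<^esub>"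
    by (rule lin_maps_zero[OF bilinear_functor.val_module bilinear_functor.val_module Pos.sharp_I_linear])
      (use ob Z \<omega> Pos.bilinear_functor_EI in auto)
  ultimately show ?thesis using z(2) by (simp add: Pos.EI_simps_small Epos.simps)
qed

lemma (in injective_presentation) no_projective_from_J:
  assumes NII: "NII_plus R C E" and Z: "Z \<in> Ob C"
    and f: "f \<in> proj_mors C E J Z" "Cmp C I J Z f i = \<zero>\<^bsub>Hom C I Z\<^esub>"
  shows "f = \<zero>\<^bsub>Hom C J Z\<^esub>"
proof -
  have "f \<in> mor C J Z" using f(1) by (simp add: proj_mors_def)
  then have "NonNeg (Mor f) \<in> Pos.sII (- 1) J X Z \<iota> ` el (Pos.FII (- 1)) X Z"
    using bij_betw_imp_surj_on[OF sharp_iota_minus1[OF Z]] f(2) by auto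
  then obtain z where z: "z \<in> el (Pos.FII (- 1)) X Z" "Pos.sII (- 1) J X Z \<iota> z = NonNeg (Mor f)" by auto
  then have "z \<in> {z \<in> el (Pos.FII (- 1)) X Z. Pos.sII (- 1) J X Z \<iota> z \<in> (\<lambda>f. NonNeg (Mor f)) ` proj_mors C E J Z}"
    using f(1) by auto
  then have "z = \<zero>\<^bsub>Val (Pos.FII (- 1)) X Z\<^esub>"
    using NII codominant Z ob unfolding NII_plus_def by blast
  moreover have "Pos.sII (- 1) J X Z \<iota> \<zero>\<^bsub>Val (Pos.FII (- 1)) X Z\<^esub> = \<zero>\<^bsub>Val (Pos.FII (- 1 + 1)) J Z\<^esub>"
    by (rule lin_maps_zero[OF bilinear_functor.val_module bilinear_functor.val_module Pos.sharp_II_linear])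
      (use ob Z \<iota> Pos.bilinear_functor_EII in auto)
  ultimately show ?thesis using z(2) by (simp add: Pos.EI_simps_small Epos.simps)
qed

locale presentation_pair =
  P: projective_presentation R C E s Y Q G p g \<omega> + I: injective_presentation R C E s X J I j i \<iota>
  for R :: "'r ring" and C :: "('r, 'o, 'm) lincat" and E :: "('r, 'o, 'm, 'e) bifunctor"
    and s :: "('o, 'm, 'e) realization" and Y Q G p g \<omega> X J I j i \<iota> +
  assumes NI: "NI_plus R C E s" and NII: "NII_plus R C E"
begin

lemmas ob = P.ob I.ob

text \<open>
  If \<open>p f = 0\<close>, then \<open>f i\<close> is still killed by \<open>p\<close> and is an injective morphism, because it starts at an
  injective object; so it is zero. The converse is dual.
\<close>

lemma kernels_agree:
  assumes f: "f \<in> mor C J Q"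
  shows "Cmp C I J Q f i = \<zero>\<^bsub>Hom C I Q\<^esub> \<longleftrightarrow> Cmp C J Q G p f = \<zero>\<^bsub>Hom C J G\<^esub>"
proof
  assume a: "Cmp C J Q G p f = \<zero>\<^bsub>Hom C J G\<^esub>"
  have fi: "Cmp C I J Q f i \<in> mor C I Q" using f ob I.i by (intro P.comp_closed) auto
  have "Push E D I Q (Cmp C I J Q f i) \<delta> = \<zero>\<^bsub>Val E D Q\<^esub>" if "D \<in> Ob C" "\<delta> \<in> el E D I" for D \<delta>
    using I.ext_into_I[OF that] P.push_zero[OF that(1) _ _ fi] ob by simp
  then have "Cmp C I J Q f i \<in> inj_mors C E I Q" using fi by (simp add: inj_mors_def)
  moreover have "Cmp C I Q G p (Cmp C I J Q f i) = \<zero>\<^bsub>Hom C I G\<^esub>"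
    using f ob I.i P.p a by (simp add: P.comp_assoc P.comp_zero_left)
  ultimately show "Cmp C I J Q f i = \<zero>\<^bsub>Hom C I Q\<^esub>"
    using P.no_injective_into_Q[OF NI] ob by blast
next
  assume a: "Cmp C I J Q f i = \<zero>\<^bsub>Hom C I Q\<^esub>"
  have pf: "Cmp C J Q G p f \<in> mor C J G" using f ob P.p by (intro P.comp_closed) auto
  have "Pull E J G A (Cmp C J Q G p f) \<delta> = \<zero>\<^bsub>Val E J A\<^esub>" if "A \<in> Ob C" "\<delta> \<in> el E G A" for A \<delta>
    using P.ext_from_G[OF that] P.pull_zero[OF _ _ that(1) pf] ob by simp
  then have "Cmp C J Q G p f \<in> proj_mors C E J G" using pf by (simp add: proj_mors_def)
  moreover have "Cmp C I J G (Cmp C J Q G p f) i = \<zero>\<^bsub>Hom C I G\<^esub>"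
    using f ob I.i P.p a by (simp add: P.comp_assoc[symmetric] P.comp_zero_right)
  ultimately show "Cmp C J Q G p f = \<zero>\<^bsub>Hom C J G\<^esub>"
    using I.no_projective_from_J[OF NII] ob by blast
qed

text \<open>
  As \<open>p\<^sub>*f\<^sub>*\<iota> = 0\<close>, there is some \<open>h\<close> with \<open>h\<^sup>*\<omega> = f\<^sub>*\<iota>\<close>, and \<open>(f, h)\<close> extends to a morphism of triangles with
  middle part \<open>b : I \<rightarrow> G\<close>. Because \<open>b j = p f = 0\<close>, the map \<open>b\<close> factors as \<open>k i\<close>; subtracting \<open>g k\<close> from \<open>h\<close>
  kills \<open>h i = g b\<close> and does not change \<open>h\<^sup>*\<omega>\<close>, as \<open>g\<^sup>*\<omega> = 0\<close>.
\<close>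

lemma transfer_left:
  assumes f: "f \<in> mor C X Q" "Cmp C X Q G p f = \<zero>\<^bsub>Hom C X G\<^esub>"
  obtains h where "h \<in> mor C J Y" "Cmp C I J Y h i = \<zero>\<^bsub>Hom C I Y\<^esub>" "Pull E J Y Q h \<omega> = Push E J X Q f \<iota>"
proof -
  have e: "Push E J X Q f \<iota> \<in> el E J Q" using f ob I.\<iota> by (intro P.push_closed) auto
  have "Push E J Q G p (Push E J X Q f \<iota>) = \<zero>\<^bsub>Val E J G\<^esub>"
    using f ob P.p I.\<iota> by (simp add: P.push_comp[symmetric] P.push_zero_mor)
  then obtain h where h: "h \<in> mor C J Y" "Pull E J Y Q h \<omega> = Push E J X Q f \<iota>"
    using P.pullback_of_triangle[OF P.tri ob(6) e] by metis
  obtain b where b: "b \<in> mor C I G" "Cmp C X I G b j = Cmp C X Q G p f" "Cmp C I G Y g b = Cmp C I J Y h i"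
    using P.triangle_morphism[OF I.tri P.tri f(1) h(1)] h(2) by metis
  obtain k where k: "k \<in> mor C J G" "Cmp C I J G k i = b"
    using P.factor_through_deflation[OF I.tri ob(2) b(1)] b(2) f(2) by metis
  let ?h = "h \<ominus>\<^bsub>Hom C J Y\<^esub> Cmp C J G Y g k"
  have gk: "Cmp C J G Y g k \<in> mor C J Y" using ob k P.g by (intro P.comp_closed) auto
  have hi: "Cmp C I J Y h i \<in> mor C I Y" using ob h I.i by (intro P.comp_closed) auto
  have "Cmp C I J Y (Cmp C J G Y g k) i = Cmp C I J Y h i"
    using ob k P.g I.i b(3) by (simp add: P.comp_assoc[symmetric])
  then have "Cmp C I J Y ?h i = \<zero>\<^bsub>Hom C I Y\<^esub>"
    using ob h gk I.i hi by (simp add: P.comp_minus_left P.mor_minus_self)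
  moreover have "Pull E J Y Q (Cmp C J G Y g k) \<omega> = \<zero>\<^bsub>Val E J Q\<^esub>"
    using ob k P.g P.\<omega> P.pull_deflation_zero[OF P.tri] by (simp add: P.pull_comp P.pull_zero)
  then have "Pull E J Y Q ?h \<omega> = Push E J X Q f \<iota>"
    using ob h gk e P.\<omega> by (simp add: P.pull_mor_minus) (simp add: module_minus_zero[OF P.val_module])
  moreover have "?h \<in> mor C J Y" using ob h gk by (intro P.mor_minus_closed) auto
  ultimately show ?thesis using that by blast
qed

text \<open>
  The same correction on the other side: now \<open>g b = h i = 0\<close>, so \<open>b = p k\<close>, and \<open>k j\<close> is subtracted from \<open>f\<close>.
\<close>

lemma transfer_right:
  assumes h: "h \<in> mor C J Y" "Cmp C I J Y h i = \<zero>\<^bsub>Hom C I Y\<^esub>"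
  obtains f where "f \<in> mor C X Q" "Cmp C X Q G p f = \<zero>\<^bsub>Hom C X G\<^esub>" "Pull E J Y Q h \<omega> = Push E J X Q f \<iota>"
proof -
  have e: "Pull E J Y Q h \<omega> \<in> el E J Q" using h ob P.\<omega> by (intro P.pull_closed) auto
  have "Pull E I J Q i (Pull E J Y Q h \<omega>) = \<zero>\<^bsub>Val E I Q\<^esub>"
    using h ob I.i P.\<omega> by (simp add: P.pull_comp[symmetric] P.pull_zero_mor)
  then obtain f where f: "f \<in> mor C X Q" "Push E J X Q f \<iota> = Pull E J Y Q h \<omega>"
    using P.pushout_of_triangle[OF I.tri ob(1) e] by metis
  obtain b where b: "b \<in> mor C I G" "Cmp C X I G b j = Cmp C X Q G p f" "Cmp C I G Y g b = Cmp C I J Y h i"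
    using P.triangle_morphism[OF I.tri P.tri f(1) h(1)] f(2) by metis
  obtain k where k: "k \<in> mor C I Q" "Cmp C I Q G p k = b"
    using P.factor_through_inflation[OF P.tri ob(5) b(1)] b(3) h(2) by metis
  let ?f = "f \<ominus>\<^bsub>Hom C X Q\<^esub> Cmp C X I Q k j"
  have kj: "Cmp C X I Q k j \<in> mor C X Q" using ob k I.j by (intro P.comp_closed) auto
  have pf: "Cmp C X Q G p f \<in> mor C X G" using ob f P.p by (intro P.comp_closed) auto
  have "Cmp C X Q G p (Cmp C X I Q k j) = Cmp C X Q G p f"
    using ob k I.j P.p b(2) by (simp add: P.comp_assoc)
  then have "Cmp C X Q G p ?f = \<zero>\<^bsub>Hom C X G\<^esub>"
    using ob f kj P.p pf by (simp add: P.comp_minus_right P.mor_minus_self)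
  moreover have "Push E J X Q (Cmp C X I Q k j) \<iota> = \<zero>\<^bsub>Val E J Q\<^esub>"
    using ob k I.j I.\<iota> P.push_inflation_zero[OF I.tri] by (simp add: P.push_comp P.push_zero)
  then have "Push E J X Q ?f \<iota> = Pull E J Y Q h \<omega>"
    using ob f kj e I.\<iota> by (simp add: P.push_mor_minus) (simp add: module_minus_zero[OF P.val_module])
  moreover have "?f \<in> mor C X Q" using ob f kj by (intro P.mor_minus_closed) auto
  ultimately show ?thesis using that by metis
qed

text \<open>
  A morphism that annihilates \<open>\<iota>\<close> annihilates all extensions of \<open>X\<close>, hence is an injective morphism.
\<close>

lemma push_iota_injective:
  "inj_on (\<lambda>f. Push E J X Q f \<iota>) {f \<in> mor C X Q. Cmp C X Q G p f = \<zero>\<^bsub>Hom C X G\<^esub>}"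
proof (rule inj_onI, clarify)
  fix f f' assume f: "f \<in> mor C X Q" "Cmp C X Q G p f = \<zero>\<^bsub>Hom C X G\<^esub>"
    and f': "f' \<in> mor C X Q" "Cmp C X Q G p f' = \<zero>\<^bsub>Hom C X G\<^esub>"
    and eq: "Push E J X Q f \<iota> = Push E J X Q f' \<iota>"
  let ?d = "f \<ominus>\<^bsub>Hom C X Q\<^esub> f'"
  have d: "?d \<in> mor C X Q" using ob f f' by (intro P.mor_minus_closed) auto
  have z: "Push E J X Q ?d \<iota> = \<zero>\<^bsub>Val E J Q\<^esub>"
    using ob f f' eq I.\<iota> P.push_closed by (simp add: P.push_mor_minus P.val_minus_self)
  have "Push E D X Q ?d \<delta> = \<zero>\<^bsub>Val E D Q\<^esub>" if D: "D \<in> Ob C" "\<delta> \<in> el E D X" for D \<delta>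
  proof -
    obtain c where c: "c \<in> mor C D J" "Pull E D J X c \<iota> = \<delta>" using I.pull_iota_onto[OF D] by metis
    have "Push E D X Q ?d (Pull E D J X c \<iota>) = Pull E D J Q c (Push E J X Q ?d \<iota>)"
      using D c d ob I.\<iota> by (intro P.push_pull)
    then show ?thesis using z c D ob by (simp add: P.pull_zero)
  qed
  then have "?d \<in> inj_mors C E X Q" using d by (simp add: inj_mors_def)
  moreover have "Cmp C X Q G p ?d = \<zero>\<^bsub>Hom C X G\<^esub>"
    using ob f f' P.p by (simp add: P.comp_minus_right P.mor_minus_self P.mor_zero_closed)
  ultimately have "?d = \<zero>\<^bsub>Hom C X Q\<^esub>" using P.no_injective_into_Q[OF NI] ob by blast
  then show "f = f'" using module_minus_eq_zero[OF P.hom_module] ob f f' by metis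
qed

lemma pull_omega_injective:
  "inj_on (\<lambda>h. Pull E J Y Q h \<omega>) {h \<in> mor C J Y. Cmp C I J Y h i = \<zero>\<^bsub>Hom C I Y\<^esub>}"
proof (rule inj_onI, clarify)
  fix f f' assume f: "f \<in> mor C J Y" "Cmp C I J Y f i = \<zero>\<^bsub>Hom C I Y\<^esub>"
    and f': "f' \<in> mor C J Y" "Cmp C I J Y f' i = \<zero>\<^bsub>Hom C I Y\<^esub>"
    and eq: "Pull E J Y Q f \<omega> = Pull E J Y Q f' \<omega>"
  let ?d = "f \<ominus>\<^bsub>Hom C J Y\<^esub> f'"
  have d: "?d \<in> mor C J Y" using ob f f' by (intro P.mor_minus_closed) auto
  have z: "Pull E J Y Q ?d \<omega> = \<zero>\<^bsub>Val E J Q\<^esub>"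
    using ob f f' eq P.\<omega> P.pull_closed by (simp add: P.pull_mor_minus P.val_minus_self)
  have "Pull E J Y A ?d \<delta> = \<zero>\<^bsub>Val E J A\<^esub>" if A: "A \<in> Ob C" "\<delta> \<in> el E Y A" for A \<delta>
  proof -
    obtain b where b: "b \<in> mor C Q A" "Push E Y Q A b \<omega> = \<delta>" using P.push_omega_onto[OF A] by metis
    have "Push E J Q A b (Pull E J Y Q ?d \<omega>) = Pull E J Y A ?d (Push E Y Q A b \<omega>)"
      using A b d ob P.\<omega> by (intro P.push_pull)
    then show ?thesis using z b A ob by (simp add: P.push_zero)
  qed
  then have "?d \<in> proj_mors C E J Y" using d by (simp add: proj_mors_def)
  moreover have "Cmp C I J Y ?d i = \<zero>\<^bsub>Hom C I Y\<^esub>"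
    using ob f f' I.i by (simp add: P.comp_minus_left P.mor_minus_self P.mor_zero_closed)
  ultimately have "?d = \<zero>\<^bsub>Hom C J Y\<^esub>" using I.no_projective_from_J[OF NII] ob by blast
  then show "f = f'" using module_minus_eq_zero[OF P.hom_module] ob f f' by metis
qed

lemma transfer_images:
  "(\<lambda>f. Push E J X Q f \<iota>) ` {f \<in> mor C X Q. Cmp C X Q G p f = \<zero>\<^bsub>Hom C X G\<^esub>}
    = (\<lambda>h. Pull E J Y Q h \<omega>) ` {h \<in> mor C J Y. Cmp C I J Y h i = \<zero>\<^bsub>Hom C I Y\<^esub>}"
proof (intro equalityI subsetI)
  fix e assume "e \<in> (\<lambda>f. Push E J X Q f \<iota>) ` {f \<in> mor C X Q. Cmp C X Q G p f = \<zero>\<^bsub>Hom C X G\<^esub>}"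
  then obtain f where f: "f \<in> mor C X Q" "Cmp C X Q G p f = \<zero>\<^bsub>Hom C X G\<^esub>" "e = Push E J X Q f \<iota>" by blast
  show "e \<in> (\<lambda>h. Pull E J Y Q h \<omega>) ` {h \<in> mor C J Y. Cmp C I J Y h i = \<zero>\<^bsub>Hom C I Y\<^esub>}"
  proof (rule transfer_left[OF f(1,2)])
    fix h assume "h \<in> mor C J Y" "Cmp C I J Y h i = \<zero>\<^bsub>Hom C I Y\<^esub>" "Pull E J Y Q h \<omega> = Push E J X Q f \<iota>"
    then show ?thesis unfolding f(3) by (intro image_eqI[of _ _ h]) auto
  qed
next
  fix e assume "e \<in> (\<lambda>h. Pull E J Y Q h \<omega>) ` {h \<in> mor C J Y. Cmp C I J Y h i = \<zero>\<^bsub>Hom C I Y\<^esub>}"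
  then obtain h where h: "h \<in> mor C J Y" "Cmp C I J Y h i = \<zero>\<^bsub>Hom C I Y\<^esub>" "e = Pull E J Y Q h \<omega>" by blast
  show "e \<in> (\<lambda>f. Push E J X Q f \<iota>) ` {f \<in> mor C X Q. Cmp C X Q G p f = \<zero>\<^bsub>Hom C X G\<^esub>}"
  proof (rule transfer_right[OF h(1,2)])
    fix f assume "f \<in> mor C X Q" "Cmp C X Q G p f = \<zero>\<^bsub>Hom C X G\<^esub>" "Pull E J Y Q h \<omega> = Push E J X Q f \<iota>"
    then show ?thesis unfolding h(3) by (intro image_eqI[of _ _ f]) auto
  qed
qed

end

section \<open>One step of the comparison\<close>

lemma (in extriangulated_category) obtain_projective_presentation:
  assumes "enough_projectives C E s" "Y \<in> Ob C"
  obtains Q G p g \<omega> where "projective_presentation R C E s Y Q G p g \<omega>"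
proof -
  obtain G g where G: "proj_object C E G" "is_deflation C E s G Y g"
    using assms unfolding enough_projectives_def by blast
  then obtain Q \<omega> p where "Q \<in> Ob C" "\<omega> \<in> el E Y Q" "(G, p, g) \<in> s Y Q \<omega>"
    unfolding is_deflation_def by blast
  then have "tri Q G Y p g \<omega>" using assms(2) by (simp add: tri_def)
  then show ?thesis
    using that G(1) by (intro that projective_presentation.intro projective_presentation_axioms.intro extriangulated_category_axioms)
qed

lemma (in extriangulated_category) obtain_injective_presentation:
  assumes "enough_injectives C E s" "X \<in> Ob C"
  obtains J I j i \<iota> where "injective_presentation R C E s X J I j i \<iota>"
proof -
  obtain I j where I: "inj_object C E I" "is_inflation C E s X I j"
    using assms unfolding enough_injectives_def by blast
  then obtain J \<iota> i where "J \<in> Ob C" "\<iota> \<in> el E J X" "(I, j, i) \<in> s J X \<iota>"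
    unfolding is_inflation_def by blast
  then have "tri X I J j i \<iota>" using assms(2) by (simp add: tri_def)
  then show ?thesis
    using that I(1) by (intro that injective_presentation.intro injective_presentation_axioms.intro extriangulated_category_axioms)
qed

text \<open>
  One step of the descending recursion: \<open>\<psi>1\<close> and \<open>\<psi>2\<close> are the isomorphisms in degrees \<open>n + 1\<close> and \<open>n + 2\<close>. That
  they are identities in degrees \<open>0\<close> and \<open>1\<close> enters only for \<open>n = -1\<close> and \<open>n = -2\<close>, where the two sides of the
  compatibility condition have to be computed as morphisms or extensions.
\<close>

locale comparison_step = extriangulated_category R C E s
  for R :: "'r ring" and C :: "('r, 'o, 'm) lincat" and E :: "('r, 'o, 'm, 'e) bifunctor"
    and s :: "('o, 'm, 'e) realization" +
  fixes n :: int and \<psi>1 \<psi>2 :: "'o \<Rightarrow> 'o \<Rightarrow> ('r, 'o, 'm, 'e) zext \<Rightarrow> ('r, 'o, 'm, 'e) zext"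
  assumes enough: "enough_projectives C E s" "enough_injectives C E s"
    and NI: "NI_plus R C E s" and NII: "NII_plus R C E"
    and n: "n \<le> - 1"
    and iso1: "\<psi>1 \<in> nat_isos R C (EI R C E (n + 1)) (EII R C E (n + 1))"
    and iso2: "\<psi>2 \<in> nat_isos R C (EI R C E (n + 2)) (EII R C E (n + 2))"
    and id1: "\<And>X Y z. \<lbrakk>n + 1 \<ge> 0; X \<in> Ob C; Y \<in> Ob C; z \<in> el (EI R C E (n + 1)) X Y\<rbrakk> \<Longrightarrow> \<psi>1 X Y z = z"
    and id2: "\<And>X Y z. \<lbrakk>n + 2 \<ge> 0; X \<in> Ob C; Y \<in> Ob C; z \<in> el (EI R C E (n + 2)) X Y\<rbrakk> \<Longrightarrow> \<psi>2 X Y z = z"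

sublocale comparison_step \<subseteq> I1: nat_iso R C "EI R C E (n + 1)" "EII R C E (n + 1)" \<psi>1
  by (intro nat_iso.intro nat_iso_axioms.intro Pos.bilinear_functor_EI Pos.bilinear_functor_EII iso1)

sublocale comparison_step \<subseteq> I2: nat_iso R C "EI R C E (n + 2)" "EII R C E (n + 2)" \<psi>2
  by (intro nat_iso.intro nat_iso_axioms.intro Pos.bilinear_functor_EI Pos.bilinear_functor_EII iso2)

context comparison_step
begin

lemma degree_plus_two: "n + 1 + 1 = n + 2"
  by simp

lemmas sI_next_linear = Pos.sharp_I_linear[where n="n + 1", unfolded degree_plus_two]
  and sI_next_pull = Pos.sharp_I_pull[where n="n + 1", unfolded degree_plus_two]
  and sI_next_push_ext = Pos.sharp_I_push_ext[where n="n + 1", unfolded degree_plus_two]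
  and sI_next_pull_ext = Pos.sharp_I_pull_ext[where n="n + 1", unfolded degree_plus_two]
  and sII_next_linear = Pos.sharp_II_linear[where n="n + 1", unfolded degree_plus_two]
  and sII_next_push = Pos.sharp_II_push[where n="n + 1", unfolded degree_plus_two]
  and sII_next_pull_ext = Pos.sharp_II_pull_ext[where n="n + 1", unfolded degree_plus_two]
  and sII_next_push_ext = Pos.sharp_II_push_ext[where n="n + 1", unfolded degree_plus_two]

lemmas sI_next_closed = lin_maps_closed[OF sI_next_linear]

definition lhs where
  "lhs W X Y Z \<delta> \<rho> z = Pos.sII (n + 1) W X Z \<delta> (\<psi>1 X Z (Pos.sI n X Y Z \<rho> z))"

definition rhs where
  "rhs W X Y Z \<delta> \<rho> w = \<psi>2 W Z (Pos.sI (n + 1) W Y Z \<rho> (I1.inv_\<psi> W Y (Pos.sII n W X Y \<delta> w)))"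

definition compatible where
  "compatible X Y z w \<longleftrightarrow> (\<forall>W\<in>Ob C. \<forall>Z\<in>Ob C. \<forall>\<delta>\<in>el E W X. \<forall>\<rho>\<in>el E Y Z.
    lhs W X Y Z \<delta> \<rho> z = rhs W X Y Z \<delta> \<rho> w)"

lemma lhs_linear:
  assumes "W \<in> Ob C" "X \<in> Ob C" "Y \<in> Ob C" "Z \<in> Ob C" "\<delta> \<in> el E W X" "\<rho> \<in> el E Y Z"
  shows "lhs W X Y Z \<delta> \<rho> \<in> lin_maps R (Val (Pos.FI n) X Y) (Val (Pos.FII (n + 2)) W Z)"
  unfolding lhs_def[abs_def]
  by (rule lin_maps_comp[OF lin_maps_comp[OF Pos.sharp_I_linear I1.linear] sII_next_linear]) (use assms in auto)

lemma rhs_linear: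
  assumes "W \<in> Ob C" "X \<in> Ob C" "Y \<in> Ob C" "Z \<in> Ob C" "\<delta> \<in> el E W X" "\<rho> \<in> el E Y Z"
  shows "rhs W X Y Z \<delta> \<rho> \<in> lin_maps R (Val (Pos.FII n) X Y) (Val (Pos.FII (n + 2)) W Z)"
  unfolding rhs_def[abs_def]
  by (rule lin_maps_comp[OF lin_maps_comp[OF lin_maps_comp[OF Pos.sharp_II_linear I1.inv_linear] sI_next_linear] I2.linear])
    (use assms in auto)

text \<open>
  Both sides react to a change of \<open>\<delta>\<close> and \<open>\<rho>\<close> by the same operation on their value, so an equation for one pair
  propagates to all pairs derived from it.
\<close>

lemma lhs_change:
  assumes "W \<in> Ob C" "W' \<in> Ob C" "X \<in> Ob C" "Y \<in> Ob C" "Z \<in> Ob C" "Z' \<in> Ob C" "\<delta> \<in> el E W X" "\<rho> \<in> el E Y Z"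
    and "c \<in> mor C W' W" "b \<in> mor C Z Z'" "z \<in> el (Pos.FI n) X Y"
  shows "lhs W' X Y Z' (Pull E W' W X c \<delta>) (Push E Y Z Z' b \<rho>) z
    = Push (Pos.FII (n + 2)) W' Z Z' b (Pull (Pos.FII (n + 2)) W' W Z c (lhs W X Y Z \<delta> \<rho> z))"
  unfolding lhs_def using assms
  by (simp add: Pos.sharp_I_push_ext I1.push Pos.sharp_I_closed I1.closed pull_closed sII_next_push sII_next_pull_ext)

lemma rhs_change:
  assumes "W \<in> Ob C" "W' \<in> Ob C" "X \<in> Ob C" "Y \<in> Ob C" "Z \<in> Ob C" "Z' \<in> Ob C" "\<delta> \<in> el E W X" "\<rho> \<in> el E Y Z"
    and "c \<in> mor C W' W" "b \<in> mor C Z Z'" "w \<in> el (Pos.FII n) X Y"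
  shows "rhs W' X Y Z' (Pull E W' W X c \<delta>) (Push E Y Z Z' b \<rho>) w
    = Push (Pos.FII (n + 2)) W' Z Z' b (Pull (Pos.FII (n + 2)) W' W Z c (rhs W X Y Z \<delta> \<rho> w))"
  unfolding rhs_def using assms
  by (simp add: Pos.sharp_II_pull_ext I1.inv_pull Pos.sharp_II_closed I1.inv_closed sI_next_pull sI_next_push_ext
      sI_next_closed I2.push I2.pull I1.F.pull_closed I2.F.pull_closed)

text \<open>
  Both sides turn a morphism acting on \<open>z\<close> and \<open>w\<close> into the same morphism acting on \<open>\<delta>\<close> or on \<open>\<rho>\<close>. As
  compatibility quantifies over all \<open>\<delta>\<close> and \<open>\<rho>\<close>, it is natural in \<open>X\<close> and \<open>Y\<close>.
\<close>

lemma lhs_pull: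
  assumes "W \<in> Ob C" "X' \<in> Ob C" "X \<in> Ob C" "Y \<in> Ob C" "Z \<in> Ob C" "\<delta> \<in> el E W X'" "\<rho> \<in> el E Y Z"
    and "c \<in> mor C X' X" "z \<in> el (Pos.FI n) X Y"
  shows "lhs W X' Y Z \<delta> \<rho> (Pull (Pos.FI n) X' X Y c z) = lhs W X Y Z (Push E W X' X c \<delta>) \<rho> z"
  unfolding lhs_def using assms
  by (simp add: Pos.sharp_I_pull I1.pull Pos.sharp_I_closed I1.closed sII_next_push_ext)

lemma rhs_pull:
  assumes "W \<in> Ob C" "X' \<in> Ob C" "X \<in> Ob C" "Y \<in> Ob C" "Z \<in> Ob C" "\<delta> \<in> el E W X'" "\<rho> \<in> el E Y Z"
    and "c \<in> mor C X' X" "w \<in> el (Pos.FII n) X Y"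
  shows "rhs W X' Y Z \<delta> \<rho> (Pull (Pos.FII n) X' X Y c w) = rhs W X Y Z (Push E W X' X c \<delta>) \<rho> w"
  unfolding rhs_def using assms by (simp add: Pos.sharp_II_push_ext)

lemma lhs_push:
  assumes "W \<in> Ob C" "X \<in> Ob C" "Y \<in> Ob C" "Y' \<in> Ob C" "Z \<in> Ob C" "\<delta> \<in> el E W X" "\<rho> \<in> el E Y' Z"
    and "a \<in> mor C Y Y'" "z \<in> el (Pos.FI n) X Y"
  shows "lhs W X Y' Z \<delta> \<rho> (Push (Pos.FI n) X Y Y' a z) = lhs W X Y Z \<delta> (Pull E Y Y' Z a \<rho>) z"
  unfolding lhs_def using assms by (simp add: Pos.sharp_I_pull_ext)

lemma rhs_push:
  assumes "W \<in> Ob C" "X \<in> Ob C" "Y \<in> Ob C" "Y' \<in> Ob C" "Z \<in> Ob C" "\<delta> \<in> el E W X" "\<rho> \<in> el E Y' Z"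
    and "a \<in> mor C Y Y'" "w \<in> el (Pos.FII n) X Y"
  shows "rhs W X Y' Z \<delta> \<rho> (Push (Pos.FII n) X Y Y' a w) = rhs W X Y Z \<delta> (Pull E Y Y' Z a \<rho>) w"
  unfolding rhs_def using assms
  by (simp add: Pos.sharp_II_push I1.inv_push Pos.sharp_II_closed I1.inv_closed sI_next_pull_ext)

text \<open>
  All extensions \<open>\<delta>\<close> of \<open>X\<close> are pulled back from \<open>\<iota>\<close> and all \<open>\<rho>\<close> pushed out from \<open>\<omega>\<close>, so naturality reduces
  compatibility to one equation.
\<close>

lemma compatible_iff:
  assumes PP: "presentation_pair R C E s Y Q G p g \<omega> X J I j i \<iota>"
    and z: "z \<in> el (Pos.FI n) X Y" and w: "w \<in> el (Pos.FII n) X Y"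
  shows "compatible X Y z w \<longleftrightarrow> lhs J X Y Q \<iota> \<omega> z = rhs J X Y Q \<iota> \<omega> w"
proof -
  interpret PP: presentation_pair R C E s Y Q G p g \<omega> X J I j i \<iota> by (rule PP)
  have "lhs W X Y Z \<delta> \<rho> z = rhs W X Y Z \<delta> \<rho> w"
    if eq: "lhs J X Y Q \<iota> \<omega> z = rhs J X Y Q \<iota> \<omega> w"
      and a: "W \<in> Ob C" "Z \<in> Ob C" "\<delta> \<in> el E W X" "\<rho> \<in> el E Y Z" for W Z \<delta> \<rho>
  proof -
    obtain c where c: "c \<in> mor C W J" "Pull E W J X c \<iota> = \<delta>" using PP.I.pull_iota_onto a by metis
    obtain b where b: "b \<in> mor C Q Z" "Push E Y Q Z b \<omega> = \<rho>" using PP.P.push_omega_onto a by metis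
    have "lhs W X Y Z (Pull E W J X c \<iota>) (Push E Y Q Z b \<omega>) z = rhs W X Y Z (Pull E W J X c \<iota>) (Push E Y Q Z b \<omega>) w"
      using a c(1) b(1) PP.ob PP.I.\<iota> PP.P.\<omega> z w eq by (simp add: lhs_change rhs_change)
    then show ?thesis using b c by simp
  qed
  then show ?thesis unfolding compatible_def using PP.ob PP.I.\<iota> PP.P.\<omega> by blast
qed

text \<open>
  Each side contains two connecting maps, which are bijections as long as they start in degree \<open>-2\<close> or below.
  For \<open>n \<le> -3\<close> both do, for \<open>n = -2\<close> one does, and for \<open>n = -1\<close> neither does.
\<close>

lemma lhs_rhs_common_image:
  assumes PP: "presentation_pair R C E s Y Q G p g \<omega> X J I j i \<iota>"
  obtains B where "bij_betw (lhs J X Y Q \<iota> \<omega>) (el (Pos.FI n) X Y) B" "bij_betw (rhs J X Y Q \<iota> \<omega>) (el (Pos.FII n) X Y) B"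
proof -
  interpret PP: presentation_pair R C E s Y Q G p g \<omega> X J I j i \<iota> by (rule PP)
  note ob = PP.ob
  have cases: "n = - 1 \<or> n = - 2 \<or> n \<le> - 3" using n by linarith
  have lhs: "lhs J X Y Q \<iota> \<omega> = Pos.sII (n + 1) J X Q \<iota> \<circ> (\<psi>1 X Q \<circ> Pos.sI n X Y Q \<omega>)"
    by (auto simp: lhs_def)
  have rhs: "rhs J X Y Q \<iota> \<omega> = \<psi>2 J Q \<circ> (Pos.sI (n + 1) J Y Q \<omega> \<circ> (I1.inv_\<psi> J Y \<circ> Pos.sII n J X Y \<iota>))"
    by (auto simp: rhs_def)
  let ?KL = "{f \<in> mor C X Q. Cmp C X Q G p f = \<zero>\<^bsub>Hom C X G\<^esub>}"
  let ?KR = "{h \<in> mor C J Y. Cmp C I J Y h i = \<zero>\<^bsub>Hom C I Y\<^esub>}"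
  show ?thesis
  proof (cases "n = - 1")
    case True
    have L: "bij_betw (lhs J X Y Q \<iota> \<omega>) (el (Pos.FI n) X Y) ((\<lambda>e. NonNeg (Ext e)) ` (\<lambda>f. Push E J X Q f \<iota>) ` ?KL)"
    proof -
      have 1: "bij_betw (Pos.sI n X Y Q \<omega>) (el (Pos.FI n) X Y) ((\<lambda>f. NonNeg (Mor f)) ` ?KL)"
        unfolding True by (rule PP.P.sharp_omega_minus1[OF ob(4)])
      have 2: "bij_betw (Pos.sII (n + 1) J X Q \<iota> \<circ> \<psi>1 X Q) ((\<lambda>f. NonNeg (Mor f)) ` ?KL) ((\<lambda>e. NonNeg (Ext e)) ` (\<lambda>f. Push E J X Q f \<iota>) ` ?KL)"
      proof -
        have e: "(Pos.sII (n + 1) J X Q \<iota> \<circ> \<psi>1 X Q) (NonNeg (Mor f)) = NonNeg (Ext (Push E J X Q f \<iota>))" if "f \<in> mor C X Q" for f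
        proof -
          have "\<psi>1 X Q (NonNeg (Mor f)) = NonNeg (Mor f)"
            by (rule id1) (use that ob True in \<open>auto simp: Pos.EI_simps_small\<close>)
          then show ?thesis using True Pos.sharp_II_int[of 0] by simp
        qed
        have "inj_on (Pos.sII (n + 1) J X Q \<iota> \<circ> \<psi>1 X Q) ((\<lambda>f. NonNeg (Mor f)) ` ?KL)"
          using PP.push_iota_injective e by (auto simp: inj_on_def simp del: comp_apply)
        moreover have "(Pos.sII (n + 1) J X Q \<iota> \<circ> \<psi>1 X Q) ` (\<lambda>f. NonNeg (Mor f)) ` ?KL = (\<lambda>e. NonNeg (Ext e)) ` (\<lambda>f. Push E J X Q f \<iota>) ` ?KL"
          unfolding image_image by (rule image_cong) (use e in auto)
        ultimately show ?thesis by (rule bij_betw_imageI)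
      qed
      show ?thesis using bij_betw_trans[OF 1 2] by (simp add: lhs Fun.comp_assoc)
    qed
    have R: "bij_betw (rhs J X Y Q \<iota> \<omega>) (el (Pos.FII n) X Y) ((\<lambda>e. NonNeg (Ext e)) ` (\<lambda>h. Pull E J Y Q h \<omega>) ` ?KR)"
    proof -
      let ?t = "\<psi>2 J Q \<circ> (Pos.sI (n + 1) J Y Q \<omega> \<circ> I1.inv_\<psi> J Y)"
      have 1: "bij_betw (Pos.sII n J X Y \<iota>) (el (Pos.FII n) X Y) ((\<lambda>f. NonNeg (Mor f)) ` ?KR)"
        unfolding True by (rule PP.I.sharp_iota_minus1[OF ob(3)])
      have 2: "bij_betw ?t ((\<lambda>f. NonNeg (Mor f)) ` ?KR) ((\<lambda>e. NonNeg (Ext e)) ` (\<lambda>h. Pull E J Y Q h \<omega>) ` ?KR)"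
      proof -
        have e: "?t (NonNeg (Mor f)) = NonNeg (Ext (Pull E J Y Q f \<omega>))" if "f \<in> mor C J Y" for f
        proof -
          have m: "NonNeg (Mor f) \<in> el (Pos.FI (n + 1)) J Y" using that ob True by (auto simp: Pos.EI_simps_small)
          have "\<psi>1 J Y (NonNeg (Mor f)) = NonNeg (Mor f)"
            by (rule id1) (use m ob True in auto)
          then have "I1.inv_\<psi> J Y (NonNeg (Mor f)) = NonNeg (Mor f)" using I1.inv_left[OF ob(6,3) m] by simp
          moreover have "Pos.sI (n + 1) J Y Q \<omega> (NonNeg (Mor f)) = NonNeg (Ext (Pull E J Y Q f \<omega>))"
            using True Pos.sharp_I_int[of 0] by simp
          moreover have "\<psi>2 J Q (NonNeg (Ext (Pull E J Y Q f \<omega>))) = NonNeg (Ext (Pull E J Y Q f \<omega>))"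
            by (rule id2) (use that ob True PP.P.\<omega> pull_closed Pos.EI_simps(1)[of 1] in auto)
          ultimately show ?thesis by simp
        qed
        have "inj_on ?t ((\<lambda>f. NonNeg (Mor f)) ` ?KR)"
          using PP.pull_omega_injective e by (auto simp: inj_on_def simp del: comp_apply)
        moreover have "?t ` (\<lambda>f. NonNeg (Mor f)) ` ?KR = (\<lambda>e. NonNeg (Ext e)) ` (\<lambda>h. Pull E J Y Q h \<omega>) ` ?KR"
          unfolding image_image by (rule image_cong) (use e in auto)
        ultimately show ?thesis by (rule bij_betw_imageI)
      qed
      show ?thesis using bij_betw_trans[OF 1 2] by (simp add: rhs Fun.comp_assoc)
    qed
    show ?thesis by (rule that[OF L R[folded PP.transfer_images]])
  next
    case False
    then have n2: "n \<le> - 2" using cases by linarith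
    have L1: "bij_betw (\<psi>1 X Q \<circ> Pos.sI n X Y Q \<omega>) (el (Pos.FI n) X Y) (el (Pos.FII (n + 1)) X Q)"
      by (rule bij_betw_trans[OF PP.P.sharp_omega_bij[OF ob(4) n2] I1.bij]) (use ob in auto)
    have R1: "bij_betw (I1.inv_\<psi> J Y \<circ> Pos.sII n J X Y \<iota>) (el (Pos.FII n) X Y) (el (Pos.FI (n + 1)) J Y)"
      by (rule bij_betw_trans[OF PP.I.sharp_iota_bij[OF ob(3) n2] I1.inv_bij]) (use ob in auto)
    show ?thesis
    proof (cases "n = - 2")
      case True
      let ?K = "(\<lambda>f. NonNeg (Mor f)) ` {f \<in> mor C J Q. Cmp C J Q G p f = \<zero>\<^bsub>Hom C J G\<^esub>}"
      have K: "?K = (\<lambda>f. NonNeg (Mor f)) ` {f \<in> mor C J Q. Cmp C I J Q f i = \<zero>\<^bsub>Hom C I Q\<^esub>}"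
        using PP.kernels_agree by (intro image_cong) auto
      have "bij_betw (Pos.sII (n + 1) J X Q \<iota>) (el (Pos.FII (n + 1)) X Q) ?K"
        unfolding K using PP.I.sharp_iota_minus1[OF ob(1)] True by simp
      then have L: "bij_betw (lhs J X Y Q \<iota> \<omega>) (el (Pos.FI n) X Y) ?K"
        unfolding lhs by (rule bij_betw_trans[OF L1])
      have "bij_betw (Pos.sI (n + 1) J Y Q \<omega>) (el (Pos.FI (n + 1)) J Y) ?K"
        using PP.P.sharp_omega_minus1[OF ob(6)] True by simp
      from bij_betw_trans[OF R1 this]
      have "bij_betw (Pos.sI (n + 1) J Y Q \<omega> \<circ> (I1.inv_\<psi> J Y \<circ> Pos.sII n J X Y \<iota>)) (el (Pos.FII n) X Y) ?K" .
      moreover have "bij_betw (\<psi>2 J Q) ?K ?K"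
      proof -
        have "\<psi>2 J Q u = u" if "u \<in> ?K" for u
          by (rule id2) (use that ob True in \<open>auto simp: Pos.EI_simps_small\<close>)
        then show ?thesis by (subst bij_betw_cong[of _ _ "\<lambda>u. u"]) (auto simp: bij_betw_def)
      qed
      ultimately have R: "bij_betw (rhs J X Y Q \<iota> \<omega>) (el (Pos.FII n) X Y) ?K"
        unfolding rhs by (rule bij_betw_trans)
      show ?thesis using that L R by blast
    next
      case False
      then have n3: "n + 1 \<le> - 2" using n2 by linarith
      have "bij_betw (lhs J X Y Q \<iota> \<omega>) (el (Pos.FI n) X Y) (el (Pos.FII (n + 2)) J Q)"
        unfolding lhs using bij_betw_trans[OF L1 PP.I.sharp_iota_bij[OF ob(1) n3]] by (simp add: degree_plus_two)
      moreover have "bij_betw (rhs J X Y Q \<iota> \<omega>) (el (Pos.FII n) X Y) (el (Pos.FII (n + 2)) J Q)"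
        unfolding rhs using bij_betw_trans[OF bij_betw_trans[OF R1 PP.P.sharp_omega_bij[OF ob(6) n3], unfolded degree_plus_two] I2.bij[OF ob(6,1)]] .
      ultimately show ?thesis using that by blast
    qed
  qed
qed

lemma compatible_unique:
  assumes ob: "X \<in> Ob C" "Y \<in> Ob C"
  shows "z \<in> el (Pos.FI n) X Y \<Longrightarrow> \<exists>!w. w \<in> el (Pos.FII n) X Y \<and> compatible X Y z w"
    and "w \<in> el (Pos.FII n) X Y \<Longrightarrow> \<exists>!z. z \<in> el (Pos.FI n) X Y \<and> compatible X Y z w"
proof -
  obtain Q G p g \<omega> where P: "projective_presentation R C E s Y Q G p g \<omega>"
    using obtain_projective_presentation[OF enough(1) ob(2)] by metis
  obtain J I j i \<iota> where I: "injective_presentation R C E s X J I j i \<iota>"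
    using obtain_injective_presentation[OF enough(2) ob(1)] by metis
  have PP: "presentation_pair R C E s Y Q G p g \<omega> X J I j i \<iota>"
    by (intro presentation_pair.intro presentation_pair_axioms.intro P I NI NII)
  obtain B where B: "bij_betw (lhs J X Y Q \<iota> \<omega>) (el (Pos.FI n) X Y) B" "bij_betw (rhs J X Y Q \<iota> \<omega>) (el (Pos.FII n) X Y) B"
    using lhs_rhs_common_image[OF PP] by metis
  note iff = compatible_iff[OF PP]
  show "\<exists>!w. w \<in> el (Pos.FII n) X Y \<and> compatible X Y z w" if z: "z \<in> el (Pos.FI n) X Y"
  proof -
    have "lhs J X Y Q \<iota> \<omega> z \<in> B" using B(1) z by (rule bij_betw_apply)
    then obtain w where w: "w \<in> el (Pos.FII n) X Y" "rhs J X Y Q \<iota> \<omega> w = lhs J X Y Q \<iota> \<omega> z"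
      using bij_betw_imp_surj_on[OF B(2)] by force
    show ?thesis
      by (rule ex1I[of _ w])
        (use w z iff bij_betw_imp_inj_on[OF B(2)] in \<open>auto simp: inj_on_def\<close>)
  qed
  show "\<exists>!z. z \<in> el (Pos.FI n) X Y \<and> compatible X Y z w" if w: "w \<in> el (Pos.FII n) X Y"
  proof -
    have "rhs J X Y Q \<iota> \<omega> w \<in> B" using B(2) w by (rule bij_betw_apply)
    then obtain z where z: "z \<in> el (Pos.FI n) X Y" "lhs J X Y Q \<iota> \<omega> z = rhs J X Y Q \<iota> \<omega> w"
      using bij_betw_imp_surj_on[OF B(1)] by force
    show ?thesis
      by (rule ex1I[of _ z])
        (use w z iff bij_betw_imp_inj_on[OF B(1)] in \<open>auto simp: inj_on_def\<close>)
  qed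
qed

theorem unique_step:
  "\<exists>!\<psi>. \<psi> \<in> nat_isos R C (Pos.FI n) (Pos.FII n) \<and>
    (\<forall>X\<in>Ob C. \<forall>Y\<in>Ob C. \<forall>z\<in>el (Pos.FI n) X Y. compatible X Y z (\<psi> X Y z))"
proof (rule relation_nat_iso[OF Pos.bilinear_functor_EI Pos.bilinear_functor_EII compatible_unique])
  fix X Y z w z' w'
  assume ob: "X \<in> Ob C" "Y \<in> Ob C" and el: "z \<in> el (Pos.FI n) X Y" "z' \<in> el (Pos.FI n) X Y"
    "w \<in> el (Pos.FII n) X Y" "w' \<in> el (Pos.FII n) X Y" and c: "compatible X Y z w" "compatible X Y z' w'"
  show "compatible X Y (z \<oplus>\<^bsub>Val (Pos.FI n) X Y\<^esub> z') (w \<oplus>\<^bsub>Val (Pos.FII n) X Y\<^esub> w')"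
    using c ob el unfolding compatible_def
    by (simp add: lin_maps_add[OF lhs_linear] lin_maps_add[OF rhs_linear])
next
  fix X Y z w r
  assume ob: "X \<in> Ob C" "Y \<in> Ob C" and el: "z \<in> el (Pos.FI n) X Y" "w \<in> el (Pos.FII n) X Y"
    and r: "r \<in> carrier R" and c: "compatible X Y z w"
  show "compatible X Y (r \<odot>\<^bsub>Val (Pos.FI n) X Y\<^esub> z) (r \<odot>\<^bsub>Val (Pos.FII n) X Y\<^esub> w)"
    using c ob el r unfolding compatible_def
    by (simp add: lin_maps_smult[OF lhs_linear] lin_maps_smult[OF rhs_linear])
next
  fix X Y Y' a z w
  assume "X \<in> Ob C" "Y \<in> Ob C" "Y' \<in> Ob C" "a \<in> mor C Y Y'" "z \<in> el (Pos.FI n) X Y" "w \<in> el (Pos.FII n) X Y" "compatible X Y z w"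
  then show "compatible X Y' (Push (Pos.FI n) X Y Y' a z) (Push (Pos.FII n) X Y Y' a w)"
    unfolding compatible_def by (simp add: lhs_push rhs_push pull_closed)
next
  fix X' X Y c z w
  assume "X' \<in> Ob C" "X \<in> Ob C" "Y \<in> Ob C" "c \<in> mor C X' X" "z \<in> el (Pos.FI n) X Y" "w \<in> el (Pos.FII n) X Y" "compatible X Y z w"
  then show "compatible X' Y (Pull (Pos.FI n) X' X Y c z) (Pull (Pos.FII n) X' X Y c w)"
    unfolding compatible_def by (simp add: lhs_pull rhs_pull push_closed)
qed

end

section \<open>The comparison isomorphisms\<close>

context extriangulated_category
begin

definition identity_iso :: "int \<Rightarrow> 'o \<Rightarrow> 'o \<Rightarrow> ('r, 'o, 'm, 'e) zext \<Rightarrow> ('r, 'o, 'm, 'e) zext" where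
  "identity_iso n = (\<lambda>X\<in>Ob C. \<lambda>Y\<in>Ob C. \<lambda>z\<in>el (Pos.FI n) X Y. z)"

lemma identity_iso: "n \<ge> 0 \<Longrightarrow> identity_iso n \<in> nat_isos R C (Pos.FI n) (Pos.FII n)"
  unfolding identity_iso_def using Pos.EI_eq_EII[of n]
  by (intro nat_isosI Pos.bilinear_functor_EI) (auto simp: lin_maps_id bij_betw_def)

end

theorem theorem5p36:
  fixes R :: "'r ring"
    and C :: "('r, 'o, 'm) lincat"
    and E :: "('r, 'o, 'm, 'e) bifunctor"
    and s :: "('o, 'm, 'e) realization"
  assumes "extriangulated_category R C E s"
    and "enough_projectives C E s"
    and "enough_injectives C E s"
    and "NI_plus R C E s"
    and "NII_plus R C E"
  shows "\<exists>!\<psi> :: int \<Rightarrow> 'o \<Rightarrow> 'o \<Rightarrow> ('r, 'o, 'm, 'e) zext \<Rightarrow> ('r, 'o, 'm, 'e) zext.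
    (\<forall>n. \<psi> n \<in> nat_isos R C (EI R C E n) (EII R C E n)) \<and>
    (\<forall>n\<ge>0. \<forall>X\<in>Ob C. \<forall>Y\<in>Ob C. \<forall>z\<in>el (EI R C E n) X Y. \<psi> n X Y z = z) \<and>
    (\<forall>n. \<forall>W\<in>Ob C. \<forall>X\<in>Ob C. \<forall>Y\<in>Ob C. \<forall>Z\<in>Ob C.
      \<forall>\<delta>\<in>el E W X. \<forall>\<rho>\<in>el E Y Z. \<forall>z\<in>el (EI R C E n) X Y.
        sharp_II R C E (n + 1) W X Z \<delta>
          (\<psi> (n + 1) X Z (sharp_I R C E n X Y Z \<rho> z))
        = \<psi> (n + 2) W Z (sharp_I R C E (n + 1) W Y Z \<rho>
            (inv_into (el (EI R C E (n + 1)) W Y) (\<psi> (n + 1) W Y)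
              (sharp_II R C E n W X Y \<delta> (\<psi> n X Y z)))))"
    (is "\<exists>!\<psi>. ?iso \<psi> \<and> ?id \<psi> \<and> ?comm \<psi>")
proof -
  interpret extriangulated_category R C E s by (rule assms(1))
  have step: "comparison_step R C E s n \<psi>1 \<psi>2"
    if "n \<le> - 1" "\<psi>1 \<in> nat_isos R C (EI R C E (n + 1)) (EII R C E (n + 1))"
      "\<psi>2 \<in> nat_isos R C (EI R C E (n + 2)) (EII R C E (n + 2))"
      "n + 1 \<ge> 0 \<Longrightarrow> \<forall>X\<in>Ob C. \<forall>Y\<in>Ob C. \<forall>z\<in>el (EI R C E (n + 1)) X Y. \<psi>1 X Y z = z"
      "n + 2 \<ge> 0 \<Longrightarrow> \<forall>X\<in>Ob C. \<forall>Y\<in>Ob C. \<forall>z\<in>el (EI R C E (n + 2)) X Y. \<psi>2 X Y z = z" for n \<psi>1 \<psi>2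
    by (intro comparison_step.intro comparison_step_axioms.intro assms extriangulated_category_axioms)
      (use that in auto)
  have family: "comparison_step R C E s n (\<psi> (n + 1)) (\<psi> (n + 2))" if "?iso \<psi>" "?id \<psi>" "n \<le> - 1" for \<psi> n
    by (rule step) (use that in auto)
  have comm_step: "\<forall>X\<in>Ob C. \<forall>Y\<in>Ob C. \<forall>z\<in>el (EI R C E n) X Y.
      comparison_step.compatible R C E n (\<psi> (n + 1)) (\<psi> (n + 2)) X Y z (\<psi> n X Y z)"
    if "?iso \<psi>" "?id \<psi>" "n \<le> - 1" "?comm \<psi>" for \<psi> n
  proof -
    interpret comparison_step R C E s n "\<psi> (n + 1)" "\<psi> (n + 2)" by (rule family[OF that(1-3)])
    show ?thesis using that(4) unfolding compatible_def lhs_def rhs_def by blast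
  qed
  have unique: "\<psi> = \<chi>" if p: "?iso \<psi> \<and> ?id \<psi> \<and> ?comm \<psi>" and c: "?iso \<chi> \<and> ?id \<chi> \<and> ?comm \<chi>" for \<psi> \<chi>
  proof -
    have nn: "\<psi> n = \<chi> n" if "n \<ge> 0" for n
      by (rule nat_isos_eqI[where R=R and C=C and F="EI R C E n" and G="EII R C E n"]) (use that p c in auto)
    have "\<psi> (- int k) = \<chi> (- int k) \<and> \<psi> (- int k + 1) = \<chi> (- int k + 1)" for k
    proof (induction k)
      case 0
      show ?case using nn by simp
    next
      case (Suc k)
      let ?n = "- int (Suc k)"
      have e: "?n + 1 = - int k" "?n + 2 = - int k + 1" by simp_all
      have eq: "\<psi> (?n + 1) = \<chi> (?n + 1)" "\<psi> (?n + 2) = \<chi> (?n + 2)" using Suc.IH unfolding e by simp_all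
      interpret comparison_step R C E s ?n "\<psi> (?n + 1)" "\<psi> (?n + 2)" by (rule family) (use p in auto)
      have "\<psi> ?n = \<chi> ?n"
        using unique_step comm_step[of \<psi> ?n] comm_step[of \<chi> ?n] p c eq by auto
      then show ?case using eq by simp
    qed
    note neg = this
    show ?thesis
    proof
      fix n show "\<psi> n = \<chi> n"
        using nn[of n] neg[of "nat (- n)"] by (cases "n \<ge> 0") auto
    qed
  qed
  define pick where "pick n \<psi>1 \<psi>2 = (THE \<psi>. \<psi> \<in> nat_isos R C (EI R C E n) (EII R C E n) \<and>
    (\<forall>X\<in>Ob C. \<forall>Y\<in>Ob C. \<forall>z\<in>el (EI R C E n) X Y. comparison_step.compatible R C E n \<psi>1 \<psi>2 X Y z (\<psi> X Y z)))"
    for n \<psi>1 \<psi>2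
  have pick: "pick n \<psi>1 \<psi>2 \<in> nat_isos R C (EI R C E n) (EII R C E n) \<and>
    (\<forall>X\<in>Ob C. \<forall>Y\<in>Ob C. \<forall>z\<in>el (EI R C E n) X Y. comparison_step.compatible R C E n \<psi>1 \<psi>2 X Y z (pick n \<psi>1 \<psi>2 X Y z))"
    if "comparison_step R C E s n \<psi>1 \<psi>2" for n \<psi>1 \<psi>2
    unfolding pick_def by (rule theI'[OF comparison_step.unique_step[OF that]])
  \<comment> \<open>The recursion needs the two preceding isomorphisms, so it runs on pairs of consecutive degrees.\<close>
  define pr where "pr = rec_nat (identity_iso 0, identity_iso 1) (\<lambda>k q. (pick (- int (Suc k)) (fst q) (snd q), fst q))"
  define \<psi> where "\<psi> n = (if n \<ge> 0 then identity_iso n else fst (pr (nat (- n))))" for n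
  have pr: "pr k = (\<psi> (- int k), \<psi> (- int k + 1))" for k
  proof (induction k)
    case 0
    show ?case by (simp add: pr_def \<psi>_def)
  next
    case (Suc k)
    have "snd (pr (Suc k)) = fst (pr k)" by (simp add: pr_def)
    then have "snd (pr (Suc k)) = \<psi> (- int (Suc k) + 1)" using Suc.IH by simp
    moreover have "fst (pr (Suc k)) = \<psi> (- int (Suc k))" by (simp add: \<psi>_def nat_add_distrib)
    ultimately show ?case by (simp add: prod_eq_iff)
  qed
  have psi_neg: "\<psi> (- int (Suc k)) = pick (- int (Suc k)) (\<psi> (- int (Suc k) + 1)) (\<psi> (- int (Suc k) + 2))" for k
  proof -
    have "fst (pr (Suc k)) = pick (- int (Suc k)) (fst (pr k)) (snd (pr k))" by (simp add: pr_def)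
    then show ?thesis unfolding pr by simp
  qed
  have id: "?id \<psi>" by (auto simp: \<psi>_def identity_iso_def)
  have iso_neg: "\<psi> (- int k) \<in> nat_isos R C (EI R C E (- int k)) (EII R C E (- int k)) \<and>
      \<psi> (- int k + 1) \<in> nat_isos R C (EI R C E (- int k + 1)) (EII R C E (- int k + 1))" for k
  proof (induction k)
    case 0
    show ?case using identity_iso[of 0] identity_iso[of 1] by (simp add: \<psi>_def)
  next
    case (Suc k)
    let ?n = "- int (Suc k)"
    have e: "?n + 1 = - int k" "?n + 2 = - int k + 1" by simp_all
    have st: "comparison_step R C E s ?n (\<psi> (?n + 1)) (\<psi> (?n + 2))"
      by (rule step) (use Suc.IH[folded e] id in auto)
    have "\<psi> ?n \<in> nat_isos R C (EI R C E ?n) (EII R C E ?n)"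
      by (subst psi_neg) (use pick[OF st] in blast)
    then show ?case using Suc.IH unfolding e by blast
  qed
  have iso: "?iso \<psi>"
  proof
    fix n show "\<psi> n \<in> nat_isos R C (EI R C E n) (EII R C E n)"
      using iso_neg[of "nat (- n)"] identity_iso[of n] by (cases "n \<ge> 0") (auto simp: \<psi>_def)
  qed
  have comm: "?comm \<psi>"
  proof (intro allI ballI)
    fix n W X Y Z \<delta> \<rho> z
    assume a: "W \<in> Ob C" "X \<in> Ob C" "Y \<in> Ob C" "Z \<in> Ob C" "\<delta> \<in> el E W X" "\<rho> \<in> el E Y Z" "z \<in> el (EI R C E n) X Y"
    show "Pos.sII (n + 1) W X Z \<delta> (\<psi> (n + 1) X Z (Pos.sI n X Y Z \<rho> z)) =
      \<psi> (n + 2) W Z (Pos.sI (n + 1) W Y Z \<rho> (inv_into (el (Pos.FI (n + 1)) W Y) (\<psi> (n + 1) W Y) (Pos.sII n W X Y \<delta> (\<psi> n X Y z))))"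
    proof (cases "n \<ge> 0")
      case True
      have degree_plus_two: "n + 1 + 1 = n + 2" by simp
      have c1: "Pos.sI n X Y Z \<rho> z \<in> el (Pos.FI (n + 1)) X Z" using a by (intro Pos.sharp_I_closed)
      have c2: "Pos.sII n W X Y \<delta> z \<in> el (Pos.FI (n + 1)) W Y"
        using a True Pos.EI_eq_EII[of n] Pos.EI_eq_EII[of "n + 1"] Pos.sharp_II_closed[OF a(1-3,5)] by simp
      have c3: "Pos.sI (n + 1) W Y Z \<rho> (Pos.sII n W X Y \<delta> z) \<in> el (Pos.FI (n + 2)) W Z"
        using Pos.sharp_I_closed[OF a(1,3,4,6) c2] unfolding degree_plus_two .
      have fixed: "\<psi> m A B u = u" if "m \<ge> 0" "A \<in> Ob C" "B \<in> Ob C" "u \<in> el (Pos.FI m) A B" for m A B u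
        using id that by blast
      have b: "bij_betw (\<psi> (n + 1) W Y) (el (Pos.FI (n + 1)) W Y) (el (Pos.FII (n + 1)) W Y)"
        by (rule nat_isos_bij[OF iso[rule_format] a(1,3)])
      have f1: "\<psi> n X Y z = z" "\<psi> (n + 1) X Z (Pos.sI n X Y Z \<rho> z) = Pos.sI n X Y Z \<rho> z"
        "\<psi> (n + 2) W Z (Pos.sI (n + 1) W Y Z \<rho> (Pos.sII n W X Y \<delta> z)) = Pos.sI (n + 1) W Y Z \<rho> (Pos.sII n W X Y \<delta> z)"
        "\<psi> (n + 1) W Y (Pos.sII n W X Y \<delta> z) = Pos.sII n W X Y \<delta> z"
        using fixed[OF _ a(2,3,7)] fixed[OF _ a(2,4) c1] fixed[OF _ a(1,4) c3] fixed[OF _ a(1,3) c2] True by auto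
      have f2: "inv_into (el (Pos.FI (n + 1)) W Y) (\<psi> (n + 1) W Y) (Pos.sII n W X Y \<delta> z) = Pos.sII n W X Y \<delta> z"
        using bij_betw_inv_into_left[OF b c2] unfolding f1(4) .
      show ?thesis unfolding f1(1,2) f2 f1(3) by (rule Pos.sharps_commute_nonneg[OF True a])
    next
      case False
      then obtain k where k: "n = - int (Suc k)" by (cases n rule: int_cases) auto
      have st: "comparison_step R C E s n (\<psi> (n + 1)) (\<psi> (n + 2))" by (rule family[OF iso id]) (use False in simp)
      interpret comparison_step R C E s n "\<psi> (n + 1)" "\<psi> (n + 2)" by (rule st)
      have "compatible X Y z (\<psi> n X Y z)" using pick[OF st] psi_neg[of k] a(2,3,7) unfolding k by simp
      then show ?thesis using a unfolding compatible_def lhs_def rhs_def by blast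
    qed
  qed
  show ?thesis
  proof (rule ex1I)
    show "?iso \<psi> \<and> ?id \<psi> \<and> ?comm \<psi>" using iso id comm by (intro conjI)
    fix \<chi> assume "?iso \<chi> \<and> ?id \<chi> \<and> ?comm \<chi>"
    then show "\<chi> = \<psi>" using iso id comm by (intro unique conjI) auto
  qed
qed

end
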